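(* Let $H$ be the $7$-dimensional Heisenberg group with Lie algebra $\mathfrak h$ as in the context, let $A>0$, and let $\varphi_2=e^{127}-e^{347}-e^{567}+e^{135}-e^{146}+e^{236}+e^{245}$. The solution of the modified Laplacian coflow with constant $A$ and initial coclosed $\mathrm{G}_2$ form $\varphi_2$ is defined on a bounded interval, and is given by $\psi(t)=\star_t\varphi(t)$ with $$\varphi(t)=\frac{y(t)}{z(t)^2}e^{127}-y(t)^{-1}\big(e^{347}+e^{567}\big)+y(t)z(t)^2\big(e^{135}-e^{146}+e^{236}+e^{245}\big),$$ where $y,z$ satisfy $$y'(t)=\frac{2A\sqrt6\,y(t)z(t)^6+2z(t)^2+y(t)^2}{12\,y(t)^3z(t)^8},\qquad z'(t)=-\frac{2A\sqrt6\,y(t)z(t)^4+1}{12\,y(t)^2z(t)^7},\qquad y(0)=1,\ z(0)=1.$$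
   Context: The Heisenberg Lie algebra $\mathfrak h$ has a dual basis $\{e^1,\dots,e^7\}$ with $de^i=0$ ($1\le i\le6$) and $de^7=\frac{\sqrt6}{6}(e^{12}+e^{34}+e^{56})$, where $e^{ij\cdots}=e^i\wedge e^j\wedge\cdots$; $H$ is the simply connected Lie group with Lie algebra $\mathfrak h$ and left invariant forms are identified with $\Lambda^*\mathfrak h^*$. A left invariant $\mathrm{G}_2$ form is $\varphi\in\Lambda^3\mathfrak h^*$ equal to $x^{127}+x^{347}+x^{567}+x^{135}-x^{146}-x^{236}-x^{245}$ in some basis $\{x^i\}$ of $\mathfrak h^*$; it determines the metric $g_\varphi$ and orientation for which $\{x^i\}$ is oriented orthonormal, the Hodge star $\star_\varphi$, and $\psi=\star_\varphi\varphi$; it is coclosed if $d\psi=0$. For coclosed $\varphi$ one has uniquely $d\varphi=\tau_0\psi+\star_\varphi\tau_3$ with $\tau_0\in\mathbb R$ and $\tau_3\in\Lambda^3\mathfrak h^*$ satisfying $\tau_3\wedge\varphi=0=\tau_3\wedge\psi$. The modified Laplacian coflow with constant $A>0$ is $$\frac{d}{dt}\psi(t)=\Delta_t\psi(t)+2d\Big(\big(A-\mathrm{Tr}_t(\tau(t))\big)\varphi(t)\Big),\quad d\psi(t)=0,\quad\psi(0)=\star_{\varphi_2}\varphi_2,$$ where $\psi(t)=\star_t\varphi(t)$, $\star_t$ and $\Delta_t=dd^*+d^*d$ are with respect to $g_t=g_{\varphi(t)}$, and $\mathrm{Tr}_t(\tau(t))$ is the trace of the full torsion tensor of $\varphi(t)$,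 which for coclosed structures equals $\frac74\tau_0(t)$. "Defined on a bounded interval" means the maximal interval of existence $(t_-,t_+)$ satisfies $-\infty<t_-<0<t_+<+\infty$. *)

theory Defs
  imports "HOL-Analysis.Analysis"
begin

text \<open>Left invariant forms on the 7-dimensional Heisenberg group, i.e. elements of the
exterior algebra of the dual of the Lie algebra, with respect to the fixed dual basis
e^1,...,e^7.  A (possibly inhomogeneous) form is represented by its coefficient function
on index sets: alpha I is the coefficient of e^I = e^{i_1} wedge ... wedge e^{i_k} where
I = {i_1 < ... < i_k} is a subset of {1..7}.\<close>

type_synonym form = "nat set \<Rightarrow> real"

definition fzero :: form where "fzero = (\<lambda>K. 0)"
definition fadd :: "form \<Rightarrow> form \<Rightarrow> form" where "fadd a b = (\<lambda>K. a K + b K)"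
definition fsub :: "form \<Rightarrow> form \<Rightarrow> form" where "fsub a b = (\<lambda>K. a K - b K)"
definition fscale :: "real \<Rightarrow> form \<Rightarrow> form" where "fscale c a = (\<lambda>K. c * a K)"

definition eform :: "nat set \<Rightarrow> form" where "eform I = (\<lambda>K. if K = I then 1 else 0)"

text \<open>Sign of the permutation sorting the concatenation of I and J (both increasing).\<close>
definition shuffle_sign :: "nat set \<Rightarrow> nat set \<Rightarrow> real" where
  "shuffle_sign I J = (-1) ^ card {(i, j). i \<in> I \<and> j \<in> J \<and> j < i}"

text \<open>Wedge product: e^I wedge e^J = shuffle_sign I J e^{I \<union> J} if disjoint, 0 otherwise.\<close>
definition wedge :: "form \<Rightarrow> form \<Rightarrow> form" where
  "wedge a b = (\<lambda>K. \<Sum>I\<in>Pow K. shuffle_sign I (K - I) * a I * b (K - I))"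

definition one_form :: "(nat \<Rightarrow> real) \<Rightarrow> form" where
  "one_form c = (\<lambda>K. if \<exists>j\<in>{1..7}. K = {j} then c (the_elem K) else 0)"

text \<open>A basis x^1..x^7 of the dual Lie algebra is given by x^i = sum_j P i j e^j.
xform P I is x^I = x^{i_1} wedge ... wedge x^{i_k} for I = {i_1 < ... < i_k}.\<close>
definition xform :: "(nat \<Rightarrow> nat \<Rightarrow> real) \<Rightarrow> nat set \<Rightarrow> form" where
  "xform P I = foldr wedge (map (\<lambda>i. one_form (P i)) (sorted_list_of_set I)) (eform {})"

definition is_basis :: "(nat \<Rightarrow> nat \<Rightarrow> real) \<Rightarrow> bool" where
  "is_basis P \<longleftrightarrow> (\<forall>a::nat \<Rightarrow> real.
      (\<lambda>K. \<Sum>i\<in>{1..7}. a i * one_form (P i) K) = fzero \<longrightarrow> (\<forall>i\<in>{1..7}. a i = 0))"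

definition std_phi :: "(nat \<Rightarrow> nat \<Rightarrow> real) \<Rightarrow> form" where
  "std_phi P = (\<lambda>K. xform P {1,2,7} K + xform P {3,4,7} K + xform P {5,6,7} K
      + xform P {1,3,5} K - xform P {1,4,6} K - xform P {2,3,6} K - xform P {2,4,5} K)"

definition G2_adapted :: "form \<Rightarrow> (nat \<Rightarrow> nat \<Rightarrow> real) \<Rightarrow> bool" where
  "G2_adapted \<phi> P \<longleftrightarrow> is_basis P \<and> \<phi> = std_phi P"

definition is_G2_form :: "form \<Rightarrow> bool" where
  "is_G2_form \<phi> \<longleftrightarrow> (\<exists>P. G2_adapted \<phi> P)"

definition coords :: "(nat \<Rightarrow> nat \<Rightarrow> real) \<Rightarrow> form \<Rightarrow> nat set \<Rightarrow> real" where
  "coords P a = (THE c. (\<forall>I. \<not> I \<subseteq> {1..7} \<longrightarrow> c I = 0) \<and>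
       a = (\<lambda>K. \<Sum>I\<in>Pow {1..7}. c I * xform P I K))"

text \<open>Hodge star for the metric and orientation making {x^i} oriented orthonormal:
star x^I = shuffle_sign I I^c x^{I^c}, so that x^I wedge star x^I = x^{1...7}.\<close>
definition hodge_wrt :: "(nat \<Rightarrow> nat \<Rightarrow> real) \<Rightarrow> form \<Rightarrow> form" where
  "hodge_wrt P a = (\<lambda>K. \<Sum>I\<in>Pow {1..7}.
       coords P a I * shuffle_sign I ({1..7} - I) * xform P ({1..7} - I) K)"

text \<open>Hodge star determined by a G2 form phi (independent of the adapted basis).\<close>
definition hodge :: "form \<Rightarrow> form \<Rightarrow> form" where
  "hodge \<phi> a = hodge_wrt (SOME P. G2_adapted \<phi> P) a"

definition psi_of :: "form \<Rightarrow> form" where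
  "psi_of \<phi> = hodge \<phi> \<phi>"

definition de :: "nat \<Rightarrow> form" where
  "de j = (if j = 7 then fscale (sqrt 6 / 6)
              (\<lambda>K. eform {1,2} K + eform {3,4} K + eform {5,6} K) else fzero)"

definition dext :: "form \<Rightarrow> form" where
  "dext a = (\<lambda>K. \<Sum>I\<in>Pow {1..7}. a I *
      (\<Sum>j\<in>I. (-1) ^ card {i\<in>I. i < j} * wedge (de j) (eform (I - {j})) K))"

text \<open>Codifferential in dimension 7: on k-forms d^* = (-1)^k star d star.\<close>
definition codiff :: "form \<Rightarrow> form \<Rightarrow> form" where
  "codiff \<phi> a = hodge \<phi> (dext (hodge \<phi> (\<lambda>I. (-1) ^ card I * a I)))"

definition laplacian :: "form \<Rightarrow> form \<Rightarrow> form" where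
  "laplacian \<phi> a = fadd (dext (codiff \<phi> a)) (codiff \<phi> (dext a))"

definition homog :: "nat \<Rightarrow> form \<Rightarrow> bool" where
  "homog k a \<longleftrightarrow> (\<forall>I. a I \<noteq> 0 \<longrightarrow> I \<subseteq> {1..7} \<and> card I = k)"

text \<open>Torsion form tau_0 of a coclosed G2 structure:
d phi = tau_0 psi + star tau_3, with tau_3 wedge phi = 0 = tau_3 wedge psi.\<close>
definition tau0 :: "form \<Rightarrow> real" where
  "tau0 \<phi> = (THE r. \<exists>\<tau>3. homog 3 \<tau>3 \<and>
       dext \<phi> = fadd (fscale r (psi_of \<phi>)) (hodge \<phi> \<tau>3) \<and>
       wedge \<tau>3 \<phi> = fzero \<and> wedge \<tau>3 (psi_of \<phi>) = fzero)"

definition torsion_trace :: "form \<Rightarrow> real" where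
  "torsion_trace \<phi> = 7 / 4 * tau0 \<phi>"

definition phi2 :: form where
  "phi2 = (\<lambda>K. eform {1,2,7} K - eform {3,4,7} K - eform {5,6,7} K + eform {1,3,5} K
      - eform {1,4,6} K + eform {2,3,6} K + eform {2,4,5} K)"

text \<open>Solution of the modified Laplacian coflow with constant A on the open interval J
starting at psi(0) = star phi2 (orientation fixed by phi(0) = phi2, phi continuous).\<close>
definition coflow_solution :: "real \<Rightarrow> real set \<Rightarrow> (real \<Rightarrow> form) \<Rightarrow> bool" where
  "coflow_solution A J \<Phi> \<longleftrightarrow>
     is_interval J \<and> open J \<and> 0 \<in> J \<and> \<Phi> 0 = phi2 \<and>
     (\<forall>t\<in>J. is_G2_form (\<Phi> t)) \<and>
     (\<forall>I. continuous_on J (\<lambda>t. \<Phi> t I)) \<and>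
     (\<forall>t\<in>J. dext (psi_of (\<Phi> t)) = fzero) \<and>
     (\<forall>t\<in>J. \<forall>I. ((\<lambda>s. psi_of (\<Phi> s) I) has_real_derivative
         (fadd (laplacian (\<Phi> t) (psi_of (\<Phi> t)))
               (fscale 2 (dext (fscale (A - torsion_trace (\<Phi> t)) (\<Phi> t)))) I)) (at t))"

definition phi_yz :: "real \<Rightarrow> real \<Rightarrow> form" where
  "phi_yz y z = (\<lambda>K. y / z^2 * eform {1,2,7} K - inverse y * (eform {3,4,7} K + eform {5,6,7} K)
      + y * z^2 * (eform {1,3,5} K - eform {1,4,6} K + eform {2,3,6} K + eform {2,4,5} K))"

end

theory Submission
  imports Defs
begin

text \<open>On the Heisenberg algebra \<open>d\<close> is contraction with the central vector \<open>e\<^sub>7\<close> followed by multiplication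
with \<open>c \<omega>\<close>, where \<open>c = sqrt 6 / 6\<close> and \<open>\<omega> = e\<^sup>1\<^sup>2 + e\<^sup>3\<^sup>4 + e\<^sup>5\<^sup>6\<close>. Since \<open>G\<^sub>2\<close> acts transitively on the
sphere, every \<open>G\<^sub>2\<close> form has an adapted frame in which only the last covector sees \<open>e\<^sub>7\<close>, with value \<open>h\<close>. In such
a frame the torsion terms of the flow cancel and it reads
\<open>\<psi>' = 2 A c \<omega> \<and> \<iota>\<^sub>7 \<phi> - c\<^sup>2 h\<^sup>2 \<omega> \<and> \<omega>\<close>. Hence \<open>\<iota>\<^sub>7 \<psi>\<close> is constant along any solution. This 3-form determines
a complex structure on the quotient by the centre, so that a solution amounts to a curve of Hermitian matrices with
\<open>e\<^sub>7\<close> orthogonal to the other basis vectors. The off-diagonal entries and the difference of the last two diagonal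
entries satisfy linear homogeneous equations and vanish. What remains is the planar system for \<open>(y, z)\<close>. In
logarithmic coordinates its orbits are graphs over \<open>x = 2 ln (z / y)\<close> that solve a globally Lipschitz equation on
the real line, and the time needed to traverse the whole line is finite in both directions.\<close>

text \<open>Uniqueness is claimed among all curves of G2 forms, and an adapted frame can only be
  picked separately at each time, with no continuity. So only coefficients of phi and psi are ever
  differentiated, and every frame quantity, including h, must be expressed through them. The torsion
  cancels as follows. Let alpha be \<open>omega\<close> written in the frame and L its trace.
  Closedness of psi makes alpha of type (1,1), so the Laplacian contributes c^2 h^2 L times alpha
  wedge (frame Kaehler form), while the trace is c h L / 2 and enters the flow with factor -2, which
  removes exactly this term. For the planar system put l = ln (z^4 + y^2 z^2) and u = c / (y z^4).
  This l is chosen because the u^2 terms drop out of l', leaving l' = -2 A u; hence dl/dx lies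
  between 0 and 1 / (1 + exp x). Consequently L(x) stays below 2 ln 2, and -dt/dx is at most a
  constant times exp (- |x|), which makes the total time finite.\<close>

declare One_nat_def [simp del]

section \<open>Exterior algebra\<close>

text \<open>The type \<open>form\<close> allows coefficients on arbitrary sets of naturals; this
  predicate singles out genuine elements of the exterior algebra of a 7-dimensional space.\<close>

definition supp7 :: "form \<Rightarrow> bool" where
  "supp7 a \<longleftrightarrow> (\<forall>K. \<not> K \<subseteq> {1..7} \<longrightarrow> a K = 0)"

text \<open>The sign in e^j wedge e^(K - {j}) = sign e^K. As j itself is not counted, K and K - {j}
  give the same value.\<close>

definition sort_sign :: "nat set \<Rightarrow> nat \<Rightarrow> real" where
  "sort_sign K j = (-1) ^ card {i \<in> K. i < j}"

definition lmul :: "(nat \<Rightarrow> real) \<Rightarrow> form \<Rightarrow> form" where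
  "lmul c a = (\<lambda>K. \<Sum>j\<in>K \<inter> {1..7}. c j * sort_sign K j * a (K - {j}))"

text \<open>The interior product with the vector whose components are n; the sign brings e^j to the
  front before it is removed.\<close>

definition contr :: "(nat \<Rightarrow> real) \<Rightarrow> form \<Rightarrow> form" where
  "contr n a = (\<lambda>K. \<Sum>j\<in>{1..7} - K. n j * sort_sign K j * a (insert j K))"

definition pairing :: "(nat \<Rightarrow> real) \<Rightarrow> (nat \<Rightarrow> real) \<Rightarrow> real" where
  "pairing c n = (\<Sum>j\<in>{1..7}. c j * n j)"

definition kron :: "nat \<Rightarrow> nat \<Rightarrow> real" where
  "kron i j = (if i = j then 1 else 0)"

text \<open>The endomorphism of the exterior algebra with e^i mapped to x^i. Adapted frames enter
  only through it: a G2 form is \<open>pull P phi0\<close>.\<close>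

definition pull :: "(nat \<Rightarrow> nat \<Rightarrow> real) \<Rightarrow> form \<Rightarrow> form" where
  "pull P a = (\<lambda>K. \<Sum>I\<in>Pow {1..7}. a I * xform P I K)"

definition linear_op :: "(form \<Rightarrow> form) \<Rightarrow> bool" where
  "linear_op f \<longleftrightarrow> (\<forall>a b c d. f (\<lambda>K. c * a K + d * b K) = (\<lambda>K. c * f a K + d * f b K))"

lemma supp7I: "(\<And>K. \<not> K \<subseteq> {1..7} \<Longrightarrow> a K = 0) \<Longrightarrow> supp7 a"
  by (auto simp: supp7_def)

lemma supp7D: "supp7 a \<Longrightarrow> \<not> K \<subseteq> {1..7} \<Longrightarrow> a K = 0"
  by (auto simp: supp7_def)

lemma supp7_eqI:
  assumes "supp7 a" "supp7 b" "\<And>K. K \<subseteq> {1..7} \<Longrightarrow> a K = b K"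
  shows "a = b"
proof
  fix K show "a K = b K" using assms by (cases "K \<subseteq> {1..7}") (auto simp: supp7_def)
qed

lemma supp7_eform: "I \<subseteq> {1..7} \<Longrightarrow> supp7 (eform I)"
  by (auto simp: supp7_def eform_def)

lemma supp7_zero: "supp7 (\<lambda>K. 0)" by (simp add: supp7_def)

lemma supp7_scale: "supp7 a \<Longrightarrow> supp7 (\<lambda>K. c * a K)"
  by (simp add: supp7_def)

lemma supp7_add: "supp7 a \<Longrightarrow> supp7 b \<Longrightarrow> supp7 (\<lambda>K. a K + b K)"
  by (simp add: supp7_def)

lemma supp7_sum: "(\<And>i. i \<in> S \<Longrightarrow> supp7 (f i)) \<Longrightarrow> supp7 (\<lambda>K. \<Sum>i\<in>S. f i K)"
  by (simp add: supp7_def)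

lemma supp7_one_form: "supp7 (one_form c)"
  by (auto simp: supp7_def one_form_def)

lemma supp7_wedge:
  assumes "supp7 a" "supp7 b" shows "supp7 (wedge a b)"
proof (rule supp7I)
  fix K :: "nat set" assume K: "\<not> K \<subseteq> {1..7}"
  have "shuffle_sign I (K - I) * a I * b (K - I) = 0" if "I \<in> Pow K" for I
  proof (cases "I \<subseteq> {1..7}")
    case True
    then have "\<not> K - I \<subseteq> {1..7}" using K by auto
    then show ?thesis using assms by (simp add: supp7_def)
  qed (use assms in \<open>simp add: supp7_def\<close>)
  then show "wedge a b K = 0" unfolding wedge_def by (intro sum.neutral) blast
qed

lemma supp7_lmul: "supp7 a \<Longrightarrow> supp7 (lmul c a)"
proof (rule supp7I)
  fix K :: "nat set" assume a: "supp7 a" and K: "\<not> K \<subseteq> {1..7}"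
  have "a (K - {j}) = 0" if "j \<in> K \<inter> {1..7}" for j
    using that K by (intro supp7D[OF a]) auto
  then show "lmul c a K = 0" by (simp add: lmul_def)
qed

lemma supp7_contr: "supp7 a \<Longrightarrow> supp7 (contr c a)"
proof (rule supp7I)
  fix K :: "nat set" assume a: "supp7 a" and K: "\<not> K \<subseteq> {1..7}"
  have "a (insert j K) = 0" for j
    using K by (intro supp7D[OF a]) auto
  then show "contr c a K = 0" by (simp add: contr_def)
qed

lemma sort_sign_sq [simp]: "sort_sign K j * sort_sign K j = 1"
  by (cases "even (card {i \<in> K. i < j})") (simp_all add: sort_sign_def)

lemma sort_sign_empty [simp]: "sort_sign {} j = 1" by (simp add: sort_sign_def)

lemma sort_sign_insert:
  assumes "finite K" "i \<notin> K"
  shows "sort_sign (insert i K) j = (if i < j then - sort_sign K j else sort_sign K j)"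
proof (cases "i < j")
  case True
  then have "{k \<in> insert i K. k < j} = insert i {k \<in> K. k < j}" by auto
  then show ?thesis using assms True by (simp add: sort_sign_def)
next
  case False
  then have "{k \<in> insert i K. k < j} = {k \<in> K. k < j}" by auto
  then show ?thesis using False by (simp add: sort_sign_def)
qed

lemma sort_sign_remove:
  assumes "finite K" "i \<in> K"
  shows "sort_sign (K - {i}) j = (if i < j then - sort_sign K j else sort_sign K j)"
proof -
  have "sort_sign K j = sort_sign (insert i (K - {i})) j" using assms by (simp add: insert_absorb)
  also have "\<dots> = (if i < j then - sort_sign (K - {i}) j else sort_sign (K - {i}) j)"
    using assms by (intro sort_sign_insert) auto
  finally show ?thesis by auto
qed

lemma sort_sign_Un:
  assumes "finite A" "finite B" "A \<inter> B = {}"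
  shows "sort_sign (A \<union> B) j = sort_sign A j * sort_sign B j"
proof -
  have "{i \<in> A \<union> B. i < j} = {i \<in> A. i < j} \<union> {i \<in> B. i < j}" by auto
  moreover have "card \<dots> = card {i \<in> A. i < j} + card {i \<in> B. i < j}"
    using assms by (intro card_Un_disjoint) auto
  ultimately show ?thesis by (simp add: sort_sign_def power_add)
qed

lemma shuffle_sign_empty [simp]: "shuffle_sign {} J = 1"
  by (simp add: shuffle_sign_def)

lemma shuffle_sign_insert:
  assumes "finite I" "finite J" "m \<notin> I"
  shows "shuffle_sign (insert m I) J = sort_sign J m * shuffle_sign I J"
proof -
  have fin: "finite {(i, j). i \<in> I \<and> j \<in> J \<and> j < i}"
    by (rule finite_subset[of _ "I \<times> J"]) (use assms in auto)
  have eq: "{(i, j). i \<in> insert m I \<and> j \<in> J \<and> j < i} =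
      Pair m ` {j \<in> J. j < m} \<union> {(i, j). i \<in> I \<and> j \<in> J \<and> j < i}"
    by auto
  have "card {(i, j). i \<in> insert m I \<and> j \<in> J \<and> j < i} =
      card (Pair m ` {j \<in> J. j < m}) + card {(i, j). i \<in> I \<and> j \<in> J \<and> j < i}"
    unfolding eq using assms fin by (intro card_Un_disjoint) auto
  also have "card (Pair m ` {j \<in> J. j < m}) = card {j \<in> J. j < m}"
    by (rule card_image) (auto simp: inj_on_def)
  finally show ?thesis by (simp add: shuffle_sign_def sort_sign_def power_add)
qed

text \<open>Only singletons contribute to the sum over subsets. This turns \<open>xform\<close> into
  iterated \<open>lmul\<close>, for which signs are manageable.\<close>

lemma wedge_one_form:
  assumes a: "supp7 a" shows "wedge (one_form c) a = lmul c a"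
proof (rule supp7_eqI)
  fix K :: "nat set" assume K: "K \<subseteq> {1..7}"
  then have fK: "finite K" by (rule finite_subset) simp
  have "wedge (one_form c) a K = (\<Sum>I\<in>(\<lambda>j. {j}) ` K. shuffle_sign I (K - I) * one_form c I * a (K - I))"
    unfolding wedge_def
    by (rule sum.mono_neutral_right) (use fK in \<open>auto simp: one_form_def\<close>)
  also have "\<dots> = (\<Sum>j\<in>K. shuffle_sign {j} (K - {j}) * one_form c {j} * a (K - {j}))"
    by (subst sum.reindex) (auto simp: inj_on_def)
  also have "\<dots> = (\<Sum>j\<in>K. c j * sort_sign K j * a (K - {j}))"
  proof (rule sum.cong)
    fix j assume j: "j \<in> K"
    have "shuffle_sign {j} (K - {j}) = sort_sign K j"
      using fK j shuffle_sign_insert[of "{}" "K - {j}" j] sort_sign_remove[of K j j] by simp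
    moreover have "one_form c {j} = c j" using j K by (auto simp: one_form_def)
    ultimately show "shuffle_sign {j} (K - {j}) * one_form c {j} * a (K - {j}) = c j * sort_sign K j * a (K - {j})"
      by simp
  qed simp
  finally show "wedge (one_form c) a K = lmul c a K" using K by (simp add: lmul_def Int_absorb2)
qed (use a in \<open>auto intro: supp7_wedge supp7_lmul supp7_one_form\<close>)

section \<open>Linear operators on forms and reduction to monomials and basis vectors\<close>

lemma linear_op_comb: "linear_op f \<Longrightarrow> f (\<lambda>K. c * a K + d * b K) = (\<lambda>K. c * f a K + d * f b K)"
  by (simp add: linear_op_def)

lemma linear_op_scale: "linear_op f \<Longrightarrow> f (\<lambda>K. c * a K) = (\<lambda>K. c * f a K)"
  using linear_op_comb[of f c a 0 a] by simp

lemma linear_op_zero: "linear_op f \<Longrightarrow> f (\<lambda>K. 0) = (\<lambda>K. 0)"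
  using linear_op_comb[of f 0 "\<lambda>K. 0" 0 "\<lambda>K. 0"] by simp

lemma linear_op_add: "linear_op f \<Longrightarrow> f (\<lambda>K. a K + b K) = (\<lambda>K. f a K + f b K)"
  using linear_op_comb[of f 1 a 1 b] by simp

lemma linear_op_diff: "linear_op f \<Longrightarrow> f (\<lambda>K. a K - b K) = (\<lambda>K. f a K - f b K)"
  using linear_op_comb[of f 1 a "-1" b] by simp

lemma linear_op_sum:
  assumes "linear_op f" "finite S"
  shows "f (\<lambda>K. \<Sum>i\<in>S. c i * a i K) = (\<lambda>K. \<Sum>i\<in>S. c i * f (a i) K)"
  using assms(2)
proof (induction S rule: finite_induct)
  case empty then show ?case by (simp add: linear_op_zero[OF assms(1)])
next
  case (insert x F)
  have "f (\<lambda>K. \<Sum>i\<in>insert x F. c i * a i K) = f (\<lambda>K. c x * a x K + 1 * (\<Sum>i\<in>F. c i * a i K))"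
    using insert by simp
  also have "\<dots> = (\<lambda>K. c x * f (a x) K + 1 * f (\<lambda>K. \<Sum>i\<in>F. c i * a i K) K)"
    by (rule linear_op_comb[OF assms(1)])
  finally show ?case using insert by simp
qed

lemma eform_expand:
  assumes "supp7 a" shows "a = (\<lambda>K. \<Sum>I\<in>Pow {1..7}. a I * eform I K)"
proof
  fix K
  have "(\<Sum>I\<in>Pow {1..7}. a I * eform I K) = (\<Sum>I\<in>Pow {1..7}. if I = K then a I else 0)"
    by (rule sum.cong) (auto simp: eform_def)
  also have "\<dots> = a K" using assms by (auto simp: supp7_def)
  finally show "a K = (\<Sum>I\<in>Pow {1..7}. a I * eform I K)" by simp
qed

lemma lin_expand:
  assumes "linear_op f" "supp7 a"
  shows "f a = (\<lambda>K. \<Sum>I\<in>Pow {1..7}. a I * f (eform I) K)"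
  by (subst eform_expand[OF assms(2)], rule linear_op_sum[OF assms(1)]) simp

lemma lin_eqI:
  assumes "linear_op f" "linear_op g" "supp7 a" "\<And>I. I \<subseteq> {1..7} \<Longrightarrow> f (eform I) = g (eform I)"
  shows "f a = g a"
  unfolding lin_expand[OF assms(1,3)] lin_expand[OF assms(2,3)]
  using assms(4) by (intro ext sum.cong) auto

lemma linear_op_comp:
  assumes "linear_op f" "linear_op g" shows "linear_op (\<lambda>a. f (g a))"
  unfolding linear_op_def by (simp add: linear_op_comb[OF assms(1)] linear_op_comb[OF assms(2)])

lemma linear_op_lincomb:
  assumes "linear_op f" "linear_op g" shows "linear_op (\<lambda>a K. c * f a K + d * g a K)"
  unfolding linear_op_def by (simp add: linear_op_comb[OF assms(1)] linear_op_comb[OF assms(2)] algebra_simps)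

lemma linear_op_id: "linear_op (\<lambda>a. a)" by (simp add: linear_op_def)

lemma linear_op_wedge_left: "linear_op (\<lambda>a. wedge a b)"
  by (simp add: linear_op_def wedge_def fun_eq_iff algebra_simps sum.distrib sum_distrib_left)

lemma linear_op_wedge_right: "linear_op (wedge a)"
  by (simp add: linear_op_def wedge_def fun_eq_iff algebra_simps sum.distrib sum_distrib_left)

lemma linear_op_lmul: "linear_op (lmul c)"
  by (simp add: linear_op_def lmul_def fun_eq_iff algebra_simps sum.distrib sum_distrib_left)

lemma linear_op_contr: "linear_op (contr c)"
  by (simp add: linear_op_def contr_def fun_eq_iff algebra_simps sum.distrib sum_distrib_left)

lemma linear_op_pull: "linear_op (pull P)"
  by (simp add: linear_op_def pull_def fun_eq_iff algebra_simps sum.distrib sum_distrib_left)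

lemma lmul_sum:
  "lmul (\<lambda>j. \<Sum>i\<in>S. d i * c i j) a = (\<lambda>K. \<Sum>i\<in>S. d i * lmul (c i) a K)"
proof
  fix K
  have "lmul (\<lambda>j. \<Sum>i\<in>S. d i * c i j) a K = (\<Sum>j\<in>K \<inter> {1..7}. \<Sum>i\<in>S. d i * (c i j * sort_sign K j * a (K - {j})))"
    by (simp add: lmul_def sum_distrib_right mult.assoc)
  also have "\<dots> = (\<Sum>i\<in>S. d i * lmul (c i) a K)"
    by (subst sum.swap) (simp add: lmul_def sum_distrib_left)
  finally show "lmul (\<lambda>j. \<Sum>i\<in>S. d i * c i j) a K = (\<Sum>i\<in>S. d i * lmul (c i) a K)" .
qed

lemma contr_sum:
  "contr (\<lambda>j. \<Sum>i\<in>S. d i * c i j) a = (\<lambda>K. \<Sum>i\<in>S. d i * contr (c i) a K)"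
proof
  fix K
  have "contr (\<lambda>j. \<Sum>i\<in>S. d i * c i j) a K = (\<Sum>j\<in>{1..7} - K. \<Sum>i\<in>S. d i * (c i j * sort_sign K j * a (insert j K)))"
    by (simp add: contr_def sum_distrib_right mult.assoc)
  also have "\<dots> = (\<Sum>i\<in>S. d i * contr (c i) a K)"
    by (subst sum.swap) (simp add: contr_def sum_distrib_left)
  finally show "contr (\<lambda>j. \<Sum>i\<in>S. d i * c i j) a K = (\<Sum>i\<in>S. d i * contr (c i) a K)" .
qed

lemma lmul_scale: "lmul (\<lambda>j. d * c j) a = (\<lambda>K. d * lmul c a K)"
  by (auto simp: lmul_def fun_eq_iff sum_distrib_left algebra_simps)

lemma contr_scale: "contr (\<lambda>j. d * c j) a = (\<lambda>K. d * contr c a K)"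
  by (auto simp: contr_def fun_eq_iff sum_distrib_left algebra_simps)

lemma lmul_cong: "(\<And>j. j \<in> {1..7} \<Longrightarrow> c j = d j) \<Longrightarrow> lmul c a = lmul d a"
  unfolding lmul_def by (intro ext sum.cong) auto

lemma contr_cong: "(\<And>j. j \<in> {1..7} \<Longrightarrow> c j = d j) \<Longrightarrow> contr c a = contr d a"
  unfolding contr_def by (intro ext sum.cong) auto

lemma lmul_kron: "j \<in> {1..7} \<Longrightarrow> lmul (kron j) a K = (if j \<in> K then sort_sign K j * a (K - {j}) else 0)"
proof -
  assume j: "j \<in> {1..7}"
  have "lmul (kron j) a K = (\<Sum>i\<in>K \<inter> {1..7}. if i = j then sort_sign K j * a (K - {j}) else 0)"
    unfolding lmul_def by (rule sum.cong) (auto simp: kron_def)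
  then show ?thesis using j by simp
qed

lemma contr_kron: "j \<in> {1..7} \<Longrightarrow> contr (kron j) a K = (if j \<in> K then 0 else sort_sign K j * a (insert j K))"
proof -
  assume j: "j \<in> {1..7}"
  have "contr (kron j) a K = (\<Sum>i\<in>{1..7} - K. if i = j then sort_sign K j * a (insert j K) else 0)"
    unfolding contr_def by (rule sum.cong) (auto simp: kron_def)
  then show ?thesis using j by simp
qed

lemma vec_expand: "j \<in> {1..7} \<Longrightarrow> c j = (\<Sum>i\<in>{1..7}. c i * kron i j)"
proof -
  assume j: "j \<in> {1..7}"
  have "(\<Sum>i\<in>{1..7}. c i * kron i j) = (\<Sum>i\<in>{1..7}. if i = j then c i else 0)"
    by (rule sum.cong) (auto simp: kron_def)
  then show ?thesis using j by simp
qed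

lemma lmul_expand: "lmul c a = (\<lambda>K. \<Sum>i\<in>{1..7}. c i * lmul (kron i) a K)"
  unfolding lmul_sum[symmetric] by (rule lmul_cong) (rule vec_expand)

lemma contr_expand: "contr c a = (\<lambda>K. \<Sum>i\<in>{1..7}. c i * contr (kron i) a K)"
  unfolding contr_sum[symmetric] by (rule contr_cong) (rule vec_expand)

lemma linear_op_lmul_expand:
  assumes "linear_op f" shows "f (lmul c a) = (\<lambda>K. \<Sum>i\<in>{1..7}. c i * f (lmul (kron i) a) K)"
  using linear_op_sum[OF assms, of "{1..7}" c "\<lambda>i. lmul (kron i) a"] lmul_expand[of c a] by simp

lemma linear_op_contr_expand:
  assumes "linear_op f" shows "f (contr c a) = (\<lambda>K. \<Sum>i\<in>{1..7}. c i * f (contr (kron i) a) K)"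
  using linear_op_sum[OF assms, of "{1..7}" c "\<lambda>i. contr (kron i) a"] contr_expand[of c a] by simp

lemma lmul_lmul_expand:
  "lmul c (lmul d a) K = (\<Sum>i\<in>{1..7}. \<Sum>j\<in>{1..7}. c i * (d j * lmul (kron i) (lmul (kron j) a) K))"
  using fun_cong[OF lmul_expand[of c "lmul d a"], of K]
  by (simp add: linear_op_lmul_expand[OF linear_op_lmul, of "kron i" d a for i] sum_distrib_left)

lemma contr_lmul_expand:
  "contr c (lmul d a) K = (\<Sum>i\<in>{1..7}. \<Sum>j\<in>{1..7}. c i * (d j * contr (kron i) (lmul (kron j) a) K))"
  using fun_cong[OF contr_expand[of c "lmul d a"], of K]
  by (simp add: linear_op_lmul_expand[OF linear_op_contr, of "kron i" d a for i] sum_distrib_left)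

lemma lmul_contr_expand:
  "lmul c (contr d a) K = (\<Sum>i\<in>{1..7}. \<Sum>j\<in>{1..7}. c i * (d j * lmul (kron i) (contr (kron j) a) K))"
  using fun_cong[OF lmul_expand[of c "contr d a"], of K]
  by (simp add: linear_op_contr_expand[OF linear_op_lmul, of "kron i" d a for i] sum_distrib_left)

section \<open>Anticommutation, the Clifford relation and associativity with a covector\<close>

lemma lmul_kron_anti:
  assumes a: "supp7 a" and ij: "i \<in> {1..7}" "j \<in> {1..7}"
  shows "lmul (kron i) (lmul (kron j) a) = (\<lambda>K. - lmul (kron j) (lmul (kron i) a) K)"
proof (rule supp7_eqI)
  show "supp7 (lmul (kron i) (lmul (kron j) a))" using a by (intro supp7_lmul)
  have "supp7 (lmul (kron j) (lmul (kron i) a))" using a by (intro supp7_lmul)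
  then show "supp7 (\<lambda>K. - lmul (kron j) (lmul (kron i) a) K)" by (simp add: supp7_def)
  fix K :: "nat set" assume "K \<subseteq> {1..7}"
  then have f: "finite K" by (rule finite_subset) simp
  have "K - {j} - {i} = K - {i} - {j}" by auto
  then show "lmul (kron i) (lmul (kron j) a) K = - lmul (kron j) (lmul (kron i) a) K"
    using f by (auto simp: lmul_kron[OF ij(1)] lmul_kron[OF ij(2)] sort_sign_remove)
qed

lemma lmul_anti:
  assumes a: "supp7 a"
  shows "lmul c (lmul d a) = (\<lambda>K. - lmul d (lmul c a) K)"
proof
  fix K
  have "lmul c (lmul d a) K = (\<Sum>i\<in>{1..7}. \<Sum>j\<in>{1..7}. c i * (d j * lmul (kron i) (lmul (kron j) a) K))"
    by (rule lmul_lmul_expand)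
  also have "\<dots> = (\<Sum>i\<in>{1..7}. \<Sum>j\<in>{1..7}. - (c i * (d j * lmul (kron j) (lmul (kron i) a) K)))"
    by (intro sum.cong refl, subst lmul_kron_anti[OF a]) simp_all
  also have "\<dots> = (\<Sum>j\<in>{1..7}. \<Sum>i\<in>{1..7}. - (d j * (c i * lmul (kron j) (lmul (kron i) a) K)))"
    by (subst sum.swap) (simp add: algebra_simps)
  also have "\<dots> = - lmul d (lmul c a) K"
    by (subst lmul_lmul_expand) (simp add: sum_negf)
  finally show "lmul c (lmul d a) K = - lmul d (lmul c a) K" .
qed

lemma lmul_lmul_same: "supp7 a \<Longrightarrow> lmul c (lmul c a) = (\<lambda>K. 0)"
proof
  fix K assume "supp7 a"
  from fun_cong[OF lmul_anti[OF this, of c c], of K] show "lmul c (lmul c a) K = 0" by simp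
qed

lemma clifford_kron:
  assumes a: "supp7 a" and ij: "i \<in> {1..7}" "j \<in> {1..7}"
  shows "contr (kron i) (lmul (kron j) a) = (\<lambda>K. kron i j * a K - lmul (kron j) (contr (kron i) a) K)"
proof (rule supp7_eqI)
  show "supp7 (contr (kron i) (lmul (kron j) a))" using a by (intro supp7_lmul supp7_contr)
  have "supp7 (lmul (kron j) (contr (kron i) a))" using a by (intro supp7_lmul supp7_contr)
  then show "supp7 (\<lambda>K. kron i j * a K - lmul (kron j) (contr (kron i) a) K)"
    using a by (simp add: supp7_def)
  fix K :: "nat set" assume "K \<subseteq> {1..7}"
  then have f: "finite K" by (rule finite_subset) simp
  have 1: "insert i K - {j} = insert i (K - {j})" if "i \<noteq> j" using that by auto
  show "contr (kron i) (lmul (kron j) a) K = kron i j * a K - lmul (kron j) (contr (kron i) a) K"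
    using f by (auto simp: lmul_kron[OF ij(2)] contr_kron[OF ij(1)] sort_sign_remove sort_sign_insert 1 kron_def insert_absorb)
qed

text \<open>Contraction is an antiderivation, here for a covector factor, which suffices because
  monomials are built by \<open>lmul\<close>. Both sides are bilinear in n and c, so basis vectors
  decide.\<close>

lemma clifford:
  assumes a: "supp7 a"
  shows "contr n (lmul c a) = (\<lambda>K. pairing c n * a K - lmul c (contr n a) K)"
proof
  fix K
  have "contr n (lmul c a) K = (\<Sum>i\<in>{1..7}. \<Sum>j\<in>{1..7}. n i * (c j * contr (kron i) (lmul (kron j) a) K))"
    by (rule contr_lmul_expand)
  also have "\<dots> = (\<Sum>i\<in>{1..7}. \<Sum>j\<in>{1..7}. (n i * a K) * (c j * kron i j) - n i * (c j * lmul (kron j) (contr (kron i) a) K))"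
    by (intro sum.cong refl) (simp add: clifford_kron[OF a] algebra_simps)
  also have "\<dots> = (\<Sum>i\<in>{1..7}. (n i * a K) * (\<Sum>j\<in>{1..7}. c j * kron j i)) - 
     (\<Sum>i\<in>{1..7}. \<Sum>j\<in>{1..7}. n i * (c j * lmul (kron j) (contr (kron i) a) K))"
    by (simp add: sum_subtractf sum_distrib_left kron_def eq_commute)
  also have "(\<Sum>i\<in>{1..7}. (n i * a K) * (\<Sum>j\<in>{1..7}. c j * kron j i)) = pairing c n * a K"
  proof -
    have "(n i * a K) * (\<Sum>j\<in>{1..7}. c j * kron j i) = c i * n i * a K" if "i \<in> {1..7}" for i
      using vec_expand[OF that, of c] by simp
    then show ?thesis unfolding pairing_def sum_distrib_right by (rule sum.cong[OF refl])
  qed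
  also have "(\<Sum>i\<in>{1..7}. \<Sum>j\<in>{1..7}. n i * (c j * lmul (kron j) (contr (kron i) a) K)) = lmul c (contr n a) K"
    by (subst sum.swap, subst lmul_contr_expand) (simp add: algebra_simps)
  finally show "contr n (lmul c a) K = pairing c n * a K - lmul c (contr n a) K" .
qed

text \<open>The instance of associativity on which products of monomials rest. Only subsets of K
  containing j contribute, and they are the sets \<open>insert j I\<close> with I inside K -
  {j}.\<close>

lemma wedge_lmul_kron:
  assumes a: "supp7 a" "supp7 b" and j: "j \<in> {1..7}"
  shows "wedge (lmul (kron j) a) b = lmul (kron j) (wedge a b)"
proof (rule supp7_eqI)
  show "supp7 (wedge (lmul (kron j) a) b)" "supp7 (lmul (kron j) (wedge a b))"
    using a by (auto intro: supp7_wedge supp7_lmul)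
  fix K :: "nat set" assume "K \<subseteq> {1..7}"
  then have f: "finite K" by (rule finite_subset) simp
  show "wedge (lmul (kron j) a) b K = lmul (kron j) (wedge a b) K"
  proof (cases "j \<in> K")
    case False
    then show ?thesis by (auto simp: wedge_def lmul_kron[OF j] intro!: sum.neutral)
  next
    case True
    have "wedge (lmul (kron j) a) b K =
       (\<Sum>I\<in>insert j ` Pow (K - {j}). shuffle_sign I (K - I) * lmul (kron j) a I * b (K - I))"
      unfolding wedge_def
    proof (rule sum.mono_neutral_right)
      show "\<forall>I\<in>Pow K - insert j ` Pow (K - {j}). shuffle_sign I (K - I) * lmul (kron j) a I * b (K - I) = 0"
      proof
        fix I assume I: "I \<in> Pow K - insert j ` Pow (K - {j})"
        have "j \<notin> I"
        proof
          assume "j \<in> I"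
          then have "I = insert j (I - {j})" "I - {j} \<in> Pow (K - {j})" using I by auto
          then show False using I by blast
        qed
        then show "shuffle_sign I (K - I) * lmul (kron j) a I * b (K - I) = 0"
          by (simp add: lmul_kron[OF j])
      qed
    qed (use f True in auto)
    also have "\<dots> = (\<Sum>I\<in>Pow (K - {j}). shuffle_sign (insert j I) (K - insert j I) *
        lmul (kron j) a (insert j I) * b (K - insert j I))"
      by (subst sum.reindex) (auto simp: inj_on_def o_def)
    also have "\<dots> = (\<Sum>I\<in>Pow (K - {j}). sort_sign K j * (shuffle_sign I (K - {j} - I) * a I * b (K - {j} - I)))"
    proof (rule sum.cong)
      fix I assume I: "I \<in> Pow (K - {j})"
      then have fI: "finite I" "j \<notin> I" "finite (K - {j} - I)" using f by (auto intro: finite_subset)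
      have e: "K - insert j I = K - {j} - I" by auto
      \<comment> \<open>Moving j to its place in K means passing the smaller elements of I and those
        of the rest.\<close>
      have K: "sort_sign I j * sort_sign (K - {j} - I) j = sort_sign K j"
      proof -
        have "sort_sign (K - {j}) j = sort_sign (I \<union> (K - {j} - I)) j" using I by (simp add: Un_absorb1)
        also have "\<dots> = sort_sign I j * sort_sign (K - {j} - I) j" using fI by (intro sort_sign_Un) auto
        finally show ?thesis using f True by (simp add: sort_sign_remove)
      qed
      have "sort_sign (insert j I) j = sort_sign I j" using fI by (simp add: sort_sign_insert)
      then show "shuffle_sign (insert j I) (K - insert j I) * lmul (kron j) a (insert j I) * b (K - insert j I)
        = sort_sign K j * (shuffle_sign I (K - {j} - I) * a I * b (K - {j} - I))"
        using fI by (simp add: e shuffle_sign_insert lmul_kron[OF j] K[symmetric])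
    qed simp
    also have "\<dots> = lmul (kron j) (wedge a b) K"
      using True by (simp add: lmul_kron[OF j] wedge_def sum_distrib_left)
    finally show ?thesis .
  qed
qed

lemma wedge_lmul:
  assumes a: "supp7 a" "supp7 b"
  shows "wedge (lmul c a) b = lmul c (wedge a b)"
proof -
  have "wedge (lmul c a) b = (\<lambda>K. \<Sum>i\<in>{1..7}. c i * wedge (lmul (kron i) a) b K)"
    by (rule linear_op_lmul_expand[OF linear_op_wedge_left])
  also have "\<dots> = lmul c (wedge a b)"
    unfolding lmul_expand[of c "wedge a b"] by (intro ext sum.cong) (simp_all add: wedge_lmul_kron[OF a])
  finally show ?thesis .
qed

lemma wedge_eform_empty: "supp7 b \<Longrightarrow> wedge (eform {}) b = b"
proof (rule supp7_eqI)
  fix K :: "nat set" assume "K \<subseteq> {1..7}"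
  then have f: "finite K" by (rule finite_subset) simp
  have "wedge (eform {}) b K = (\<Sum>I\<in>Pow K. if I = {} then b K else 0)"
    unfolding wedge_def by (rule sum.cong) (auto simp: eform_def)
  then show "wedge (eform {}) b K = b K" using f by simp
qed (auto intro: supp7_wedge supp7_eform)

section \<open>Pullback along a change of coframe\<close>

lemma supp7_foldr: "supp7 (foldr wedge (map (\<lambda>i. one_form (P i)) xs) (eform {}))"
  by (induction xs) (auto intro: supp7_eform supp7_wedge supp7_one_form)

lemma supp7_xform: "supp7 (xform P I)"
  by (simp add: xform_def supp7_foldr)

lemma supp7_pull: "supp7 (pull P a)"
  unfolding pull_def by (intro supp7_sum supp7_scale supp7_xform)

lemma xform_empty: "xform P {} = eform {}"
  by (simp add: xform_def)

lemma xform_insert_min: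
  assumes "finite I" "\<forall>i\<in>I. m < i"
  shows "xform P (insert m I) = lmul (P m) (xform P I)"
proof -
  have "m \<notin> I" using assms by auto
  then have "sorted_list_of_set (insert m I) = m # sorted_list_of_set I"
    using assms by (simp add: insort_is_Cons less_imp_le)
  then have "xform P (insert m I) = wedge (one_form (P m)) (xform P I)" by (simp add: xform_def)
  then show ?thesis by (simp add: wedge_one_form supp7_xform)
qed

text \<open>Induction on adjoining a new least index m. A covector with i > m first passes
  \<open>P m\<close> at the cost of one sign; i = m produces a square, hence zero.\<close>

lemma lmul_xform:
  assumes "finite I"
  shows "lmul (P i) (xform P I) = (if i \<in> I then (\<lambda>K. 0) else (\<lambda>K. sort_sign I i * xform P (insert i I) K))"
  using assms
proof (induction I rule: finite_linorder_min_induct)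
  case empty
  then show ?case using xform_insert_min[of "{}" i P] by simp
next
  case (insert m I)
  have mI: "m \<notin> I" using insert by auto
  have X: "xform P (insert m I) = lmul (P m) (xform P I)" using insert by (intro xform_insert_min) auto
  consider "i = m" | "i < m" | "m < i" by linarith
  then show ?case
  proof cases
    case 1 then show ?thesis by (simp add: X lmul_lmul_same supp7_xform)
  next
    case 2
    then have "i \<notin> I" "i \<noteq> m" using insert by auto
    moreover have "{k \<in> insert m I. k < i} = {}" using 2 insert by auto
    then have "sort_sign (insert m I) i = 1" by (simp add: sort_sign_def del: Collect_empty_eq)
    moreover have "xform P (insert i (insert m I)) = lmul (P i) (xform P (insert m I))"
      using 2 insert by (intro xform_insert_min) auto
    ultimately show ?thesis by simp
  next
    case 3
    have A: "lmul (P i) (xform P (insert m I)) = (\<lambda>K. - lmul (P m) (lmul (P i) (xform P I)) K)"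
      unfolding X by (rule lmul_anti[OF supp7_xform])
    show ?thesis
    proof (cases "i \<in> I")
      case True
      then show ?thesis using insert by (simp add: A linear_op_zero[OF linear_op_lmul])
    next
      case False
      have Y: "xform P (insert m (insert i I)) = lmul (P m) (xform P (insert i I))"
        using insert 3 by (intro xform_insert_min) auto
      have "lmul (P i) (xform P I) = (\<lambda>K. sort_sign I i * xform P (insert i I) K)"
        using False insert by simp
      then have "lmul (P i) (xform P (insert m I)) = (\<lambda>K. - (sort_sign I i * xform P (insert m (insert i I)) K))"
        unfolding A Y by (simp add: linear_op_scale[OF linear_op_lmul])
      moreover have "insert i (insert m I) = insert m (insert i I)" by auto
      ultimately show ?thesis using False 3 insert mI by (simp add: sort_sign_insert)
    qed
  qed
qed

text \<open>Arbitrary covectors multiply by the same table as the e^i, independent or not; hence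
  \<open>pull P\<close> respects wedge products for every matrix P.\<close>

lemma wedge_xform:
  assumes "finite I" "finite J"
  shows "wedge (xform P I) (xform P J) =
    (if I \<inter> J = {} then (\<lambda>K. shuffle_sign I J * xform P (I \<union> J) K) else (\<lambda>K. 0))"
  using assms(1)
proof (induction I rule: finite_linorder_min_induct)
  case empty then show ?case by (simp add: xform_empty wedge_eform_empty supp7_xform)
next
  case (insert m I)
  have mI: "m \<notin> I" using insert by auto
  have W: "wedge (xform P (insert m I)) (xform P J) = lmul (P m) (wedge (xform P I) (xform P J))"
    using insert by (simp add: xform_insert_min wedge_lmul supp7_xform)
  show ?case
  proof (cases "I \<inter> J = {}")
    case False
    then show ?thesis using insert by (auto simp: W linear_op_zero[OF linear_op_lmul])
  next
    case True
    have "lmul (P m) (wedge (xform P I) (xform P J)) = (\<lambda>K. shuffle_sign I J * lmul (P m) (xform P (I \<union> J)) K)"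
      using True insert by (simp add: linear_op_scale[OF linear_op_lmul])
    also have "\<dots> = (\<lambda>K. shuffle_sign I J * (if m \<in> J then 0 else sort_sign (I \<union> J) m * xform P (insert m (I \<union> J)) K))"
      using insert mI assms(2) by (subst lmul_xform) (auto simp: fun_eq_iff)
    finally have *: "wedge (xform P (insert m I)) (xform P J) = \<dots>" using W by simp
    have "{k \<in> I. k < m} = {}" using insert by auto
    then have "sort_sign I m = 1" by (simp add: sort_sign_def del: Collect_empty_eq)
    then have "sort_sign (I \<union> J) m = sort_sign J m" using sort_sign_Un[of I J m] insert assms True by simp
    then show ?thesis using True mI insert assms(2)
      by (auto simp: * shuffle_sign_insert)
  qed
qed

lemma lmul_kron_eform_min:
  assumes "finite I" "\<forall>i\<in>I. m < i" "m \<in> {1..7}"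
  shows "lmul (kron m) (eform I) = eform (insert m I)"
proof
  fix K
  have 1: "K - {m} = I \<longleftrightarrow> K = insert m I" if "m \<in> K" using that assms by auto
  have "{k. (k = m \<or> k \<in> I) \<and> k < m} = {}" using assms by auto
  then have "sort_sign (insert m I) m = 1" by (simp add: sort_sign_def del: Collect_empty_eq)
  then show "lmul (kron m) (eform I) K = eform (insert m I) K"
    using 1 by (auto simp: lmul_kron[OF assms(3)] eform_def)
qed

lemma xform_kron:
  assumes "I \<subseteq> {1..7}" shows "xform kron I = eform I"
proof -
  have "finite I" using assms by (rule finite_subset) simp
  then show ?thesis using assms
    by (induction I rule: finite_linorder_min_induct) (auto simp: xform_empty xform_insert_min lmul_kron_eform_min)
qed

lemma pull_eform: "I \<subseteq> {1..7} \<Longrightarrow> pull P (eform I) = xform P I"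
proof
  fix K assume "I \<subseteq> {1..7}"
  moreover have "pull P (eform I) K = (\<Sum>J\<in>Pow {1..7}. if J = I then xform P I K else 0)"
    unfolding pull_def by (rule sum.cong) (auto simp: eform_def)
  ultimately show "pull P (eform I) K = xform P I K" by simp
qed

lemma finite_subset17: "I \<subseteq> {1..7::nat} \<Longrightarrow> finite I"
  by (rule finite_subset) auto

lemma pull_wedge:
  assumes "supp7 a" "supp7 b"
  shows "pull P (wedge a b) = wedge (pull P a) (pull P b)"
proof (rule lin_eqI[where a = a])
  show "linear_op (\<lambda>a. pull P (wedge a b))" by (intro linear_op_comp[OF linear_op_pull] linear_op_wedge_left)
  show "linear_op (\<lambda>a. wedge (pull P a) (pull P b))" by (rule linear_op_comp[OF linear_op_wedge_left linear_op_pull])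
  fix I :: "nat set" assume I: "I \<subseteq> {1..7}"
  show "pull P (wedge (eform I) b) = wedge (pull P (eform I)) (pull P b)"
  proof (rule lin_eqI[where a = b])
    show "linear_op (\<lambda>b. pull P (wedge (eform I) b))" by (rule linear_op_comp[OF linear_op_pull linear_op_wedge_right])
    show "linear_op (\<lambda>b. wedge (pull P (eform I)) (pull P b))" by (rule linear_op_comp[OF linear_op_wedge_right linear_op_pull])
    fix J :: "nat set" assume J: "J \<subseteq> {1..7}"
    show "pull P (wedge (eform I) (eform J)) = wedge (pull P (eform I)) (pull P (eform J))"
      using I J wedge_xform[OF finite_subset17 finite_subset17, of I J kron]
      by (simp add: wedge_xform finite_subset17 pull_eform xform_kron linear_op_zero[OF linear_op_pull] linear_op_scale[OF linear_op_pull])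
  qed fact
qed fact

definition covP :: "(nat \<Rightarrow> real) \<Rightarrow> (nat \<Rightarrow> nat \<Rightarrow> real) \<Rightarrow> nat \<Rightarrow> real" where
  "covP c P j = (\<Sum>i\<in>{1..7}. c i * P i j)"

text \<open>The values x^i(n), that is, the components of n with respect to the frame dual to
  P.\<close>

definition vecP :: "(nat \<Rightarrow> nat \<Rightarrow> real) \<Rightarrow> (nat \<Rightarrow> real) \<Rightarrow> nat \<Rightarrow> real" where
  "vecP P n i = (\<Sum>j\<in>{1..7}. P i j * n j)"

definition mmul :: "(nat \<Rightarrow> nat \<Rightarrow> real) \<Rightarrow> (nat \<Rightarrow> nat \<Rightarrow> real) \<Rightarrow> nat \<Rightarrow> nat \<Rightarrow> real" where
  "mmul R P i j = (\<Sum>k\<in>{1..7}. R i k * P k j)"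

lemma pull_lmul_kron:
  assumes "supp7 a" "i \<in> {1..7}"
  shows "pull P (lmul (kron i) a) = lmul (P i) (pull P a)"
proof (rule lin_eqI[where a = a])
  show "linear_op (\<lambda>a. pull P (lmul (kron i) a))" by (rule linear_op_comp[OF linear_op_pull linear_op_lmul])
  show "linear_op (\<lambda>a. lmul (P i) (pull P a))" by (rule linear_op_comp[OF linear_op_lmul linear_op_pull])
  fix J :: "nat set" assume J: "J \<subseteq> {1..7}"
  show "pull P (lmul (kron i) (eform J)) = lmul (P i) (pull P (eform J))"
    using J assms(2) lmul_xform[OF finite_subset17, of J kron i]
    by (simp add: xform_kron pull_eform linear_op_zero[OF linear_op_pull] linear_op_scale[OF linear_op_pull] lmul_xform finite_subset17)
qed fact

lemma pull_lmul:
  assumes "supp7 a"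
  shows "pull P (lmul c a) = lmul (covP c P) (pull P a)"
proof -
  have "pull P (lmul c a) = (\<lambda>K. \<Sum>i\<in>{1..7}. c i * pull P (lmul (kron i) a) K)"
    by (rule linear_op_lmul_expand[OF linear_op_pull])
  also have "\<dots> = (\<lambda>K. \<Sum>i\<in>{1..7}. c i * lmul (P i) (pull P a) K)"
    by (intro ext sum.cong) (simp_all add: pull_lmul_kron[OF assms])
  also have "\<dots> = lmul (covP c P) (pull P a)"
    unfolding covP_def by (rule lmul_sum[symmetric])
  finally show ?thesis .
qed

lemma contr_eform_empty: "contr n (eform {}) = (\<lambda>K. 0)"
  by (auto simp: contr_def eform_def fun_eq_iff intro!: sum.neutral)

text \<open>Contraction sees the covectors x^i only through their values on n. Induction over
  monomials, with the Clifford relation for each new factor, takes care of the signs.\<close>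

lemma contr_pull:
  assumes "supp7 a"
  shows "contr n (pull P a) = pull P (contr (vecP P n) a)"
proof (rule lin_eqI[where a = a])
  show "linear_op (\<lambda>a. contr n (pull P a))" by (rule linear_op_comp[OF linear_op_contr linear_op_pull])
  show "linear_op (\<lambda>a. pull P (contr (vecP P n) a))" by (rule linear_op_comp[OF linear_op_pull linear_op_contr])
  fix I :: "nat set" assume I: "I \<subseteq> {1..7}"
  then have "finite I" by (rule finite_subset17)
  then show "contr n (pull P (eform I)) = pull P (contr (vecP P n) (eform I))" using I
  proof (induction I rule: finite_linorder_min_induct)
    case empty
    then show ?case by (simp add: pull_eform xform_empty contr_eform_empty linear_op_zero[OF linear_op_pull])
  next
    case (insert m I)
    then have m: "m \<in> {1..7}" and I: "I \<subseteq> {1..7}" by auto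
    have "contr n (pull P (eform (insert m I))) = contr n (lmul (P m) (pull P (eform I)))"
      using insert m I by (simp add: pull_eform xform_insert_min)
    also have "\<dots> = (\<lambda>K. pairing (P m) n * pull P (eform I) K - lmul (P m) (pull P (contr (vecP P n) (eform I))) K)"
      by (subst clifford[OF supp7_pull], subst insert.IH[OF I]) simp
    also have "lmul (P m) (pull P (contr (vecP P n) (eform I))) = pull P (lmul (kron m) (contr (vecP P n) (eform I)))"
      using m I by (intro pull_lmul_kron[symmetric] supp7_contr supp7_eform)
    also have "(\<lambda>K. pairing (P m) n * pull P (eform I) K - pull P (lmul (kron m) (contr (vecP P n) (eform I))) K)
       = pull P (\<lambda>K. pairing (P m) n * eform I K - lmul (kron m) (contr (vecP P n) (eform I)) K)"
      by (simp add: linear_op_diff[OF linear_op_pull] linear_op_scale[OF linear_op_pull])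
    also have "pairing (P m) n = pairing (kron m) (vecP P n)"
    proof -
      have "pairing (kron m) (vecP P n) = (\<Sum>j\<in>{1..7}. vecP P n j * kron j m)"
        unfolding pairing_def by (intro sum.cong) (auto simp: kron_def)
      also have "\<dots> = vecP P n m" using vec_expand[OF m, of "vecP P n"] by simp
      finally show ?thesis by (simp add: vecP_def pairing_def)
    qed
    also have "(\<lambda>K. pairing (kron m) (vecP P n) * eform I K - lmul (kron m) (contr (vecP P n) (eform I)) K)
      = contr (vecP P n) (lmul (kron m) (eform I))"
      using I by (subst clifford) (auto intro: supp7_eform)
    also have "lmul (kron m) (eform I) = eform (insert m I)"
      using insert m by (intro lmul_kron_eform_min) auto
    finally show ?case .
  qed
qed fact

lemma xform_mmul:
  assumes "I \<subseteq> {1..7}" shows "pull P (xform R I) = xform (mmul R P) I"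
proof -
  have "finite I" using assms by (rule finite_subset17)
  then show ?thesis using assms
  proof (induction I rule: finite_linorder_min_induct)
    case empty
    then show ?case by (simp add: pull_eform xform_empty)
  next
    case (insert m I)
    have "covP (R m) P = mmul R P m" by (simp add: covP_def mmul_def fun_eq_iff)
    then show ?case using insert by (simp add: xform_insert_min pull_lmul supp7_xform)
  qed
qed

lemma pull_pull: "supp7 a \<Longrightarrow> pull P (pull R a) = pull (mmul R P) a"
  by (rule lin_eqI[where a = a], rule linear_op_comp[OF linear_op_pull linear_op_pull], rule linear_op_pull)
    (auto simp: pull_eform xform_mmul)

lemma xform_cong:
  assumes "I \<subseteq> {1..7}" "\<And>i j. i \<in> {1..7} \<Longrightarrow> j \<in> {1..7} \<Longrightarrow> P i j = Q i j"
  shows "xform P I = xform Q I"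
proof -
  have "finite I" using assms(1) by (rule finite_subset17)
  then show ?thesis using assms(1)
  proof (induction I rule: finite_linorder_min_induct)
    case (insert m I)
    then have "lmul (P m) (xform Q I) = lmul (Q m) (xform Q I)" using assms(2) by (intro lmul_cong) auto
    then show ?case using insert by (simp add: xform_insert_min)
  qed (simp add: xform_empty)
qed

lemma pull_cong:
  assumes "\<And>i j. i \<in> {1..7} \<Longrightarrow> j \<in> {1..7} \<Longrightarrow> P i j = Q i j"
  shows "pull P a = pull Q a"
  unfolding pull_def using xform_cong[OF _ assms] by (intro ext sum.cong) auto

lemma pull_kron: "supp7 a \<Longrightarrow> pull kron a = a"
  by (rule lin_eqI[where a = a], rule linear_op_pull, rule linear_op_id) (auto simp: pull_eform xform_kron)

section \<open>The Hodge star of the standard frame and its transport to an arbitrary basis\<close>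

definition star :: "form \<Rightarrow> form" where
  "star a = (\<lambda>K. if K \<subseteq> {1..7} then shuffle_sign ({1..7} - K) K * a ({1..7} - K) else 0)"

lemma supp7_star: "supp7 (star a)" by (simp add: star_def supp7_def)

lemma linear_op_star: "linear_op star"
  by (auto simp: linear_op_def star_def fun_eq_iff algebra_simps)

lemma star_eform: "I \<subseteq> {1..7} \<Longrightarrow> star (eform I) = (\<lambda>K. shuffle_sign I ({1..7} - I) * eform ({1..7} - I) K)"
  by (auto simp: star_def eform_def fun_eq_iff double_diff)

lemma invertible_basis:
  assumes "is_basis P"
  shows "\<exists>Q. (\<forall>i\<in>{1..7}. \<forall>j\<in>{1..7}. mmul Q P i j = kron i j \<and> mmul P Q i j = kron i j)"
proof -
  \<comment> \<open>Matrices here are indexed by naturals; a bijection with the type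
    \<open>7\<close> makes the linear algebra of \<open>real^7^7\<close> available.\<close>
  have "card {1..7::nat} = CARD(7)" by simp
  then obtain f :: "7 \<Rightarrow> nat" where f: "bij_betw f UNIV {1..7}"
    by (metis finite_same_card_bij finite_class.finite_UNIV finite_atLeastAtMost)
  define A :: "real^7^7" where "A = (\<chi> i j. P (f i) (f j))"
  define g where "g = inv_into UNIV f"
  have gf: "g (f i) = i" for i unfolding g_def using f by (simp add: bij_betw_def)
  have fg: "f (g j) = j" if "j \<in> {1..7}" for j unfolding g_def using f that
    by (simp add: bij_betw_def f_inv_into_f)
  have frange: "f i \<in> {1..7}" for i using f by (auto simp: bij_betw_def)
  have su: "(\<Sum>k\<in>{1..7}. h k) = (\<Sum>k\<in>UNIV. h (f k))" for h :: "nat \<Rightarrow> real"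
    using sum.reindex_bij_betw[OF f, of h] by simp
  have "invertible A"
    unfolding invertible_right_inverse matrix_right_invertible_independent_rows
  proof (intro allI impI)
    fix c :: "7 \<Rightarrow> real" and i assume c: "(\<Sum>i\<in>UNIV. c i *s row i A) = 0"
    have "(\<lambda>K. \<Sum>i\<in>{1..7}. (c (g i)) * one_form (P i) K) = fzero"
    proof
      fix K
      show "(\<Sum>i\<in>{1..7}. (c (g i)) * one_form (P i) K) = fzero K"
      proof (cases "\<exists>j\<in>{1..7}. K = {j}")
        case True
        then obtain j where j: "j \<in> {1..7}" "K = {j}" by auto
        have "(\<Sum>i\<in>{1..7}. (c (g i)) * one_form (P i) K) = (\<Sum>i\<in>UNIV. c i * P (f i) j)"
          using j by (simp add: su gf one_form_def)
        also have "\<dots> = (\<Sum>i\<in>UNIV. c i *s row i A) $ (g j)"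
          using j by (simp add: row_def A_def fg)
        finally show ?thesis using c by (simp add: fzero_def)
      qed (auto simp: one_form_def fzero_def)
    qed
    then have "\<forall>i\<in>{1..7}. c (g i) = 0"
      using assms[unfolded is_basis_def, rule_format, of "\<lambda>i. c (g i)"] by blast
    then have "c (g (f i)) = 0" using frange by blast
    then show "c i = 0" by (simp add: gf)
  qed
  then obtain B where B: "A ** B = mat 1" "B ** A = mat 1" by (auto simp: invertible_def)
  define Q where "Q i j = B $ g i $ g j" for i j
  have "mmul P Q i j = kron i j" "mmul Q P i j = kron i j" if "i \<in> {1..7}" "j \<in> {1..7}" for i j
  proof -
    have e: "g i = g j \<longleftrightarrow> i = j" using fg that by metis
    have "(A ** B) $ g i $ g j = mmul P Q i j" "(B ** A) $ g i $ g j = mmul Q P i j"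
      using that by (simp_all add: matrix_matrix_mult_def mmul_def Q_def A_def su gf fg)
    then show "mmul P Q i j = kron i j" "mmul Q P i j = kron i j"
      using B e by (simp_all add: mat_def kron_def)
  qed
  then show ?thesis by blast
qed

lemma is_basisI:
  assumes "\<And>i j. i \<in> {1..7} \<Longrightarrow> j \<in> {1..7} \<Longrightarrow> mmul P Q i j = kron i j"
  shows "is_basis P"
  unfolding is_basis_def
proof (intro allI impI ballI)
  fix a :: "nat \<Rightarrow> real" and i :: nat
  assume a: "(\<lambda>K. \<Sum>i\<in>{1..7}. a i * one_form (P i) K) = fzero" and i: "i \<in> {1..7}"
  have z: "(\<Sum>k\<in>{1..7}. a k * P k j) = 0" if "j \<in> {1..7}" for j
    using fun_cong[OF a, of "{j}"] that by (simp add: one_form_def fzero_def)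
  have "a i = (\<Sum>k\<in>{1..7}. a k * mmul P Q k i)"
    using vec_expand[OF i, of a] assms i by simp
  also have "\<dots> = (\<Sum>j\<in>{1..7}. (\<Sum>k\<in>{1..7}. a k * P k j) * Q j i)"
    unfolding mmul_def sum_distrib_left sum_distrib_right by (subst sum.swap) (simp add: algebra_simps)
  finally show "a i = 0" using z by simp
qed

lemma pull_inverse:
  assumes "\<forall>i\<in>{1..7}. \<forall>j\<in>{1..7}. mmul Q P i j = kron i j" "supp7 a"
  shows "pull P (pull Q a) = a"
  using assms pull_cong[of "mmul Q P" kron a] by (simp add: pull_pull pull_kron)

lemma pull_inj:
  assumes "is_basis P" "supp7 a" "supp7 b" "pull P a = pull P b" shows "a = b"
proof -
  obtain Q where Q: "\<forall>i\<in>{1..7}. \<forall>j\<in>{1..7}. mmul P Q i j = kron i j"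
    using invertible_basis[OF assms(1)] by blast
  show ?thesis using pull_inverse[OF Q assms(2)] pull_inverse[OF Q assms(3)] assms(4) by metis
qed

text \<open>Evaluates the definite description in \<open>coords\<close>; uniqueness is injectivity
  of pulling back along a basis.\<close>

lemma coords_pull:
  assumes "is_basis P" "supp7 a" shows "coords P (pull P a) = a"
  unfolding coords_def
proof (rule the_equality)
  show "(\<forall>I. \<not> I \<subseteq> {1..7} \<longrightarrow> a I = 0) \<and> pull P a = (\<lambda>K. \<Sum>I\<in>Pow {1..7}. a I * xform P I K)"
    using assms(2) by (auto simp: supp7_def pull_def)
  fix c assume "(\<forall>I. \<not> I \<subseteq> {1..7} \<longrightarrow> c I = 0) \<and> pull P a = (\<lambda>K. \<Sum>I\<in>Pow {1..7}. c I * xform P I K)"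
  then have "supp7 c" "pull P a = pull P c" by (auto simp: supp7_def pull_def)
  then show "c = a" using pull_inj[OF assms(1)] assms(2) by metis
qed

lemma hodge_wrt_pull:
  assumes "is_basis P" "supp7 a" shows "hodge_wrt P (pull P a) = pull P (star a)"
proof -
  have "pull P (star a) = (\<lambda>K. \<Sum>I\<in>Pow {1..7}. a I * pull P (star (eform I)) K)"
    using lin_expand[OF linear_op_comp[OF linear_op_pull linear_op_star] assms(2)] .
  also have "\<dots> = (\<lambda>K. \<Sum>I\<in>Pow {1..7}. a I * shuffle_sign I ({1..7} - I) * xform P ({1..7} - I) K)"
    by (intro ext sum.cong) (simp_all add: star_eform linear_op_scale[OF linear_op_pull] pull_eform)
  finally show ?thesis by (simp add: hodge_wrt_def coords_pull[OF assms])
qed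

section \<open>Explicit computation with forms\<close>

text \<open>Index sets are represented by increasing lists, so that the simplifier can evaluate the coefficients of
  products, contractions and Hodge duals of explicit forms. The functions on lists below mirror the set operations
  and the signs of the definitions.\<close>

definition coeff :: "form \<Rightarrow> nat list \<Rightarrow> real" where "coeff a ks = a (set ks)"

definition form_of :: "(nat list \<times> real) list \<Rightarrow> form" where
  "form_of xs = (\<lambda>K. \<Sum>(I, c)\<leftarrow>xs. if K = set I then c else 0)"

fun sorted17 :: "nat list \<Rightarrow> bool" where
  "sorted17 [] = True"
| "sorted17 [x] = (1 \<le> x \<and> x \<le> 7)"
| "sorted17 (x # y # zs) = (1 \<le> x \<and> x < y \<and> sorted17 (y # zs))"

fun wf_terms :: "(nat list \<times> real) list \<Rightarrow> bool" where
  "wf_terms [] = True"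
| "wf_terms ((I, c) # xs) = (sorted17 I \<and> wf_terms xs)"

fun coeff_terms :: "(nat list \<times> real) list \<Rightarrow> nat list \<Rightarrow> real" where
  "coeff_terms [] ks = 0"
| "coeff_terms ((I, c) # xs) ks = (if I = ks then c + coeff_terms xs ks else coeff_terms xs ks)"

fun lmem :: "nat \<Rightarrow> nat list \<Rightarrow> bool" where
  "lmem x [] = False"
| "lmem x (y # ys) = (x = y \<or> lmem x ys)"

fun lsubset :: "nat list \<Rightarrow> nat list \<Rightarrow> bool" where
  "lsubset [] ks = True"
| "lsubset (x # xs) ks = (lmem x ks \<and> lsubset xs ks)"

fun ldiff :: "nat list \<Rightarrow> nat list \<Rightarrow> nat list" where
  "ldiff [] I = []"
| "ldiff (k # ks) I = (if lmem k I then ldiff ks I else k # ldiff ks I)"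

fun linsert :: "nat \<Rightarrow> nat list \<Rightarrow> nat list" where
  "linsert x [] = [x]"
| "linsert x (y # ys) = (if x < y then x # y # ys else y # linsert x ys)"

fun sign_below :: "nat list \<Rightarrow> nat \<Rightarrow> real" where
  "sign_below [] i = 1"
| "sign_below (j # J) i = (if j < i then - sign_below J i else sign_below J i)"

fun sign_lists :: "nat list \<Rightarrow> nat list \<Rightarrow> real" where
  "sign_lists [] J = 1"
| "sign_lists (i # I) J = sign_below J i * sign_lists I J"

fun wedge_terms_left :: "(nat list \<times> real) list \<Rightarrow> form \<Rightarrow> nat list \<Rightarrow> real" where
  "wedge_terms_left [] b ks = 0"
| "wedge_terms_left ((I, c) # xs) b ks =
    (if lsubset I ks then c * sign_lists I (ldiff ks I) * coeff b (ldiff ks I) + wedge_terms_left xs b ks else wedge_terms_left xs b ks)"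

fun wedge_terms_right :: "(nat list \<times> real) list \<Rightarrow> form \<Rightarrow> nat list \<Rightarrow> real" where
  "wedge_terms_right [] b ks = 0"
| "wedge_terms_right ((I, c) # xs) b ks =
    (if lsubset I ks then c * sign_lists (ldiff ks I) I * coeff b (ldiff ks I) + wedge_terms_right xs b ks else wedge_terms_right xs b ks)"

fun contr_at :: "nat list \<Rightarrow> (nat \<Rightarrow> real) \<Rightarrow> form \<Rightarrow> nat list \<Rightarrow> real" where
  "contr_at [] u a ks = 0"
| "contr_at (j # js) u a ks = (if lmem j ks then contr_at js u a ks else u j * sign_below ks j * coeff a (linsert j ks) + contr_at js u a ks)"

fun lmul_at :: "nat list \<Rightarrow> (nat \<Rightarrow> real) \<Rightarrow> form \<Rightarrow> nat list \<Rightarrow> real" where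
  "lmul_at [] u a ks = 0"
| "lmul_at (j # js) u a ks = u j * sign_below ks j * coeff a (ldiff ks [j]) + lmul_at js u a ks"

lemma sorted17_iff: "sorted17 ks \<longleftrightarrow> sorted_wrt (<) ks \<and> set ks \<subseteq> {1..7}"
proof (induction ks rule: sorted17.induct)
  case (3 x y zs)
  show ?case
  proof
    assume "sorted17 (x # y # zs)"
    then have "1 \<le> x" "x < y" "sorted17 (y # zs)" by auto
    then show "sorted_wrt (<) (x # y # zs) \<and> set (x # y # zs) \<subseteq> {1..7}" using 3 by fastforce
  next
    assume "sorted_wrt (<) (x # y # zs) \<and> set (x # y # zs) \<subseteq> {1..7}"
    then show "sorted17 (x # y # zs)" using 3 by auto
  qed
qed auto

lemma sorted17_distinct: "sorted17 ks \<Longrightarrow> distinct ks"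
  by (auto simp: sorted17_iff strict_sorted_iff)

lemma sorted17_set_eq: "sorted17 I \<Longrightarrow> sorted17 J \<Longrightarrow> set I = set J \<longleftrightarrow> I = J"
  by (metis sorted17_iff strict_sorted_equal)

lemma lmem_set: "lmem x ys \<longleftrightarrow> x \<in> set ys" by (induction ys) auto
lemma lsubset_set: "lsubset xs ys \<longleftrightarrow> set xs \<subseteq> set ys" by (induction xs) (auto simp: lmem_set)
lemma ldiff_set: "set (ldiff ks I) = set ks - set I" by (induction ks) (auto simp: lmem_set)
lemma ldiff_distinct: "distinct ks \<Longrightarrow> distinct (ldiff ks I)" by (induction ks) (auto simp: ldiff_set)
lemma linsert_set: "set (linsert x ks) = insert x (set ks)" by (induction ks) auto

lemma sign_below_sort_sign: "distinct J \<Longrightarrow> sign_below J i = sort_sign (set J) i"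
  by (induction J) (auto simp: sort_sign_insert)

lemma sign_lists_shuffle: "distinct I \<Longrightarrow> distinct J \<Longrightarrow> sign_lists I J = shuffle_sign (set I) (set J)"
  by (induction I) (auto simp: shuffle_sign_insert sign_below_sort_sign)

lemma coeff_form_of:
  assumes "wf_terms xs" "sorted17 ks" shows "coeff (form_of xs) ks = coeff_terms xs ks"
proof -
  have "(\<Sum>(I, c)\<leftarrow>xs. if set ks = set I then c else 0) = coeff_terms xs ks"
    using assms by (induction xs rule: wf_terms.induct) (auto simp: sorted17_set_eq)
  then show ?thesis by (simp add: coeff_def form_of_def)
qed

lemma form_of_Nil: "form_of [] = (\<lambda>K. 0)" by (simp add: form_of_def)

text \<open>The factor 1 gives the right-hand side the shape required by
  \<open>linear_op_comb\<close> and \<open>homog_lincomb\<close>.\<close>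

lemma form_of_Cons: "form_of ((I, c) # xs) = (\<lambda>K. c * eform (set I) K + 1 * form_of xs K)"
  by (auto simp: form_of_def eform_def)

lemma wedge_eform_left:
  assumes "finite K" shows "wedge (eform I) b K = (if I \<subseteq> K then shuffle_sign I (K - I) * b (K - I) else 0)"
proof -
  have "wedge (eform I) b K = (\<Sum>J\<in>Pow K. if J = I then shuffle_sign I (K - I) * b (K - I) else 0)"
    unfolding wedge_def by (rule sum.cong) (auto simp: eform_def)
  then show ?thesis using assms by simp
qed

lemma wedge_eform_right:
  assumes "finite K" shows "wedge a (eform I) K = (if I \<subseteq> K then shuffle_sign (K - I) I * a (K - I) else 0)"
proof -
  have "wedge a (eform I) K = (\<Sum>J\<in>Pow K. if J = K - I then (if I \<subseteq> K then shuffle_sign (K - I) I * a (K - I) else 0) else 0)"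
    unfolding wedge_def by (rule sum.cong) (auto simp: eform_def)
  then show ?thesis using assms by simp
qed

lemma coeff_wedge_left:
  assumes "wf_terms xs" "sorted17 ks" shows "coeff (wedge (form_of xs) b) ks = wedge_terms_left xs b ks"
  using assms(1)
proof (induction xs rule: wf_terms.induct)
  case 1 then show ?case by (simp add: form_of_Nil coeff_def wedge_def)
next
  case (2 I c xs)
  have "wedge (form_of ((I, c) # xs)) b (set ks) = c * wedge (eform (set I)) b (set ks) + wedge (form_of xs) b (set ks)"
    unfolding form_of_Cons linear_op_comb[OF linear_op_wedge_left] by simp
  moreover have "wedge (form_of xs) b (set ks) = wedge_terms_left xs b ks" using 2 by (simp add: coeff_def)
  moreover have "shuffle_sign (set I) (set ks - set I) = sign_lists I (ldiff ks I)"
    using 2 assms(2) by (simp add: sign_lists_shuffle sorted17_distinct ldiff_distinct ldiff_set)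
  ultimately show ?case by (simp add: coeff_def wedge_eform_left lsubset_set ldiff_set)
qed

lemma coeff_wedge_right:
  assumes "wf_terms xs" "sorted17 ks" shows "coeff (wedge a (form_of xs)) ks = wedge_terms_right xs a ks"
  using assms(1)
proof (induction xs rule: wf_terms.induct)
  case 1 then show ?case by (simp add: form_of_Nil coeff_def wedge_def)
next
  case (2 I c xs)
  have "wedge a (form_of ((I, c) # xs)) (set ks) = c * wedge a (eform (set I)) (set ks) + wedge a (form_of xs) (set ks)"
    unfolding form_of_Cons linear_op_comb[OF linear_op_wedge_right] by simp
  moreover have "wedge a (form_of xs) (set ks) = wedge_terms_right xs a ks" using 2 by (simp add: coeff_def)
  moreover have "shuffle_sign (set ks - set I) (set I) = sign_lists (ldiff ks I) I"
    using 2 assms(2) by (simp add: sign_lists_shuffle sorted17_distinct ldiff_distinct ldiff_set)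
  ultimately show ?case by (simp add: coeff_def wedge_eform_right lsubset_set ldiff_set)
qed

lemma set_list17: "set [1,2,3,4,5,6,7] = {1..7::nat}" by (simp add: set_eq_iff) presburger

lemma coeff_contr:
  assumes "sorted17 ks" shows "coeff (contr u a) ks = contr_at [1,2,3,4,5,6,7] u a ks"
proof -
  have *: "contr_at js u a ks = (\<Sum>j\<in>set js - set ks. u j * sign_below ks j * coeff a (linsert j ks))" if "distinct js" for js
    using that by (induction js) (auto simp: lmem_set insert_Diff_if)
  have "contr_at [1,2,3,4,5,6,7] u a ks = (\<Sum>j\<in>{1..7} - set ks. u j * sign_below ks j * coeff a (linsert j ks))"
    unfolding set_list17[symmetric] by (rule *) simp
  also have "\<dots> = coeff (contr u a) ks" unfolding coeff_def contr_def
    by (rule sum.cong) (use assms in \<open>auto simp: sign_below_sort_sign sorted17_distinct linsert_set\<close>)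
  finally show ?thesis by simp
qed

lemma coeff_contr_kron:
  assumes "sorted17 ks" "1 \<le> j" "j \<le> 7"
  shows "coeff (contr (kron j) a) ks = (if lmem j ks then 0 else sign_below ks j * coeff a (linsert j ks))"
  using assms by (simp add: coeff_def contr_kron lmem_set sign_below_sort_sign sorted17_distinct linsert_set)

lemma coeff_lmul_kron:
  assumes "sorted17 ks" "1 \<le> j" "j \<le> 7"
  shows "coeff (lmul (kron j) a) ks = (if lmem j ks then sign_below ks j * coeff a (ldiff ks [j]) else 0)"
  using assms by (simp add: coeff_def lmul_kron lmem_set sign_below_sort_sign sorted17_distinct ldiff_set)

lemma coeff_lmul:
  assumes "sorted17 ks" shows "coeff (lmul u a) ks = lmul_at ks u a ks"
proof -
  have *: "lmul_at js u a ks = (\<Sum>j\<in>set js. u j * sign_below ks j * coeff a (ldiff ks [j]))" if "distinct js" for js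
    using that by (induction js) auto
  have "lmul_at ks u a ks = (\<Sum>j\<in>set ks. u j * sign_below ks j * coeff a (ldiff ks [j]))"
    using assms by (intro * sorted17_distinct)
  also have "\<dots> = coeff (lmul u a) ks" unfolding coeff_def lmul_def
    using assms by (intro sum.cong) (auto simp: sign_below_sort_sign sorted17_distinct ldiff_set sorted17_iff)
  finally show ?thesis by simp
qed

lemma coeff_star:
  assumes "sorted17 ks"
  shows "coeff (star a) ks = sign_lists (ldiff [1,2,3,4,5,6,7] ks) ks * coeff a (ldiff [1,2,3,4,5,6,7] ks)"
proof -
  have "set (ldiff [1,2,3,4,5,6,7] ks) = {1..7} - set ks" by (simp only: ldiff_set set_list17)
  moreover have "sign_lists (ldiff [1,2,3,4,5,6,7] ks) ks = shuffle_sign ({1..7} - set ks) (set ks)"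
    by (subst sign_lists_shuffle) (use assms in \<open>simp_all add: sorted17_distinct ldiff_distinct del: ldiff.simps, simp only: ldiff_set set_list17\<close>)
  ultimately show ?thesis using assms by (simp add: coeff_def star_def sorted17_iff del: ldiff.simps)
qed

lemma form_eqI:
  assumes "supp7 a" "supp7 b" "list_all (\<lambda>ks. coeff a ks = coeff b ks) (subseqs [1,2,3,4,5,6,7])"
  shows "a = b"
proof (rule supp7_eqI[OF assms(1,2)])
  fix K :: "nat set" assume "K \<subseteq> {1..7}"
  then have "K \<in> set ` set (subseqs [1,2,3,4,5,6,7])"
    using subseqs_powset[of "[1,2,3,4,5,6,7::nat]"] by (simp only: set_list17) auto
  then show "a K = b K" using assms(3) by (auto simp: list_all_iff coeff_def simp del: subseqs.simps)
qed

text \<open>Knowing the degree k of a form cuts a comparison from all 128 index sets to those with k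
  elements, listed in increasing order so that the evaluation rules apply.\<close>

fun sublists_of_size :: "nat \<Rightarrow> nat list \<Rightarrow> nat list list" where
  "sublists_of_size 0 xs = [[]]"
| "sublists_of_size (Suc k) [] = []"
| "sublists_of_size (Suc k) (x # xs) = map ((#) x) (sublists_of_size k xs) @ sublists_of_size (Suc k) xs"

lemma sublists_of_size_set:
  assumes "distinct xs" "K \<subseteq> set xs" "card K = k"
  shows "K \<in> set ` set (sublists_of_size k xs)"
  using assms
proof (induction k xs arbitrary: K rule: sublists_of_size.induct)
  case (1 xs) then show ?case by (simp add: finite_subset[of K "set xs"])
next
  case (3 k x xs)
  have fin: "finite K" using 3(4) by (rule finite_subset) simp
  show ?case
  proof (cases "x \<in> K")
    case True
    have "K - {x} \<in> set ` set (sublists_of_size k xs)" using 3 True fin by (intro 3(1)) auto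
    then obtain ys where "ys \<in> set (sublists_of_size k xs)" "K - {x} = set ys" by auto
    then have "x # ys \<in> set (sublists_of_size (Suc k) (x # xs))" "K = set (x # ys)" using True by auto
    then show ?thesis by blast
  next
    case False
    then have "K \<in> set ` set (sublists_of_size (Suc k) xs)" using 3 by (intro 3(2)) auto
    then show ?thesis by auto
  qed
qed (auto simp: card_eq_0_iff)

lemma homogD: "homog k a \<Longrightarrow> \<not> (I \<subseteq> {1..7} \<and> card I = k) \<Longrightarrow> a I = 0"
  by (auto simp: homog_def)

lemma homog_supp7: "homog k a \<Longrightarrow> supp7 a" by (auto simp: homog_def supp7_def)

lemma homog_eqI:
  assumes "homog k a" "homog k b" "list_all (\<lambda>ks. coeff a ks = coeff b ks) (sublists_of_size k [1,2,3,4,5,6,7])"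
  shows "a = b"
proof (rule supp7_eqI)
  fix K :: "nat set" assume K: "K \<subseteq> {1..7}"
  show "a K = b K"
  proof (cases "card K = k")
    case True
    then have "K \<in> set ` set (sublists_of_size k [1,2,3,4,5,6,7])"
      using K by (intro sublists_of_size_set) (simp_all only: set_list17, simp)
    then show ?thesis using assms(3) by (auto simp: list_all_iff coeff_def simp del: sublists_of_size.simps)
  qed (use assms in \<open>simp add: homogD\<close>)
qed (use assms in \<open>auto intro: homog_supp7\<close>)

lemma homog_eform: "I \<subseteq> {1..7} \<Longrightarrow> homog (card I) (eform I)"
  by (auto simp: homog_def eform_def)

lemma homog_zero: "homog k (\<lambda>K. 0)" by (simp add: homog_def)

lemma homog_lincomb: "homog k a \<Longrightarrow> homog k b \<Longrightarrow> homog k (\<lambda>K. c * a K + d * b K)"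
  unfolding homog_def by (metis add.right_neutral mult_zero_right)

lemma homog_scale: "homog k a \<Longrightarrow> homog k (\<lambda>K. c * a K)"
  by (auto simp: homog_def)

lemma homog_add: "homog k a \<Longrightarrow> homog k b \<Longrightarrow> homog k (\<lambda>K. a K + b K)"
  using homog_lincomb[of k a b 1 1] by simp

lemma homog_diff: "homog k a \<Longrightarrow> homog k b \<Longrightarrow> homog k (\<lambda>K. a K - b K)"
  using homog_lincomb[of k a b 1 "-1"] by simp

lemma homog_sum: "(\<And>i. i \<in> S \<Longrightarrow> homog k (f i)) \<Longrightarrow> homog k (\<lambda>K. \<Sum>i\<in>S. f i K)"
  by (meson homog_def sum.not_neutral_contains_not_neutral)

fun terms_deg :: "nat \<Rightarrow> (nat list \<times> real) list \<Rightarrow> bool" where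
  "terms_deg k [] = True"
| "terms_deg k ((I, c) # xs) = (length I = k \<and> terms_deg k xs)"

lemma homog_form_of: "wf_terms xs \<Longrightarrow> terms_deg k xs \<Longrightarrow> homog k (form_of xs)"
proof (induction xs rule: wf_terms.induct)
  case (2 I c xs)
  then have "card (set I) = k" using sorted17_distinct distinct_card by auto
  then show ?case unfolding form_of_Cons using 2 homog_eform[of "set I"]
    by (intro homog_lincomb) (auto simp: sorted17_iff)
qed (simp add: form_of_Nil homog_zero)

section \<open>Degrees of products, contractions, duals and pullbacks\<close>

lemma homog_wedge:
  assumes "homog k a" "homog l b" shows "homog (k + l) (wedge a b)"
  unfolding homog_def
proof (intro allI impI)
  fix K assume nz: "wedge a b K \<noteq> 0"
  then have "\<exists>I\<in>Pow K. shuffle_sign I (K - I) * a I * b (K - I) \<noteq> 0"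
    unfolding wedge_def by (meson sum.not_neutral_contains_not_neutral)
  then obtain I where I: "I \<subseteq> K" "a I \<noteq> 0" "b (K - I) \<noteq> 0" by auto
  then have "I \<subseteq> {1..7}" "card I = k" "K - I \<subseteq> {1..7}" "card (K - I) = l"
    using assms by (auto simp: homog_def)
  moreover have "K = I \<union> (K - I)" using I by auto
  ultimately show "K \<subseteq> {1..7} \<and> card K = k + l"
    using card_Un_disjoint[of I "K - I"] finite_subset17 by (metis Diff_disjoint Un_least)
qed

lemma homog_lmul:
  assumes "homog k a" shows "homog (Suc k) (lmul c a)"
  unfolding homog_def
proof (intro allI impI)
  fix K assume nz: "lmul c a K \<noteq> 0"
  then have "\<exists>j\<in>K \<inter> {1..7}. c j * sort_sign K j * a (K - {j}) \<noteq> 0"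
    unfolding lmul_def by (meson sum.not_neutral_contains_not_neutral)
  then obtain j where I: "j \<in> K" "j \<in> {1..7}" "a (K - {j}) \<noteq> 0" by auto
  then have s: "K - {j} \<subseteq> {1..7}" "card (K - {j}) = k" using assms by (auto simp: homog_def)
  then have "finite (K - {j})" using finite_subset17 by blast
  then have "card (insert j (K - {j})) = Suc k" using s by (subst card_insert_disjoint) auto
  moreover have "insert j (K - {j}) = K" using I by auto
  ultimately show "K \<subseteq> {1..7} \<and> card K = Suc k" using s I by auto
qed

lemma homog_contr:
  assumes "homog (Suc k) a" shows "homog k (contr c a)"
  unfolding homog_def
proof (intro allI impI)
  fix K assume nz: "contr c a K \<noteq> 0"
  then have "\<exists>j\<in>{1..7} - K. c j * sort_sign K j * a (insert j K) \<noteq> 0"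
    unfolding contr_def by (meson sum.not_neutral_contains_not_neutral)
  then obtain j where I: "j \<notin> K" "a (insert j K) \<noteq> 0" by auto
  then have s: "insert j K \<subseteq> {1..7}" "card (insert j K) = Suc k" using assms unfolding homog_def by blast+
  then have "finite K" using finite_subset17 by blast
  then show "K \<subseteq> {1..7} \<and> card K = k" using s I by auto
qed

lemma homog_star:
  assumes "homog k a" shows "homog (7 - k) (star a)"
  unfolding homog_def
proof (intro allI impI)
  fix K assume nz: "star a K \<noteq> 0"
  then have K: "K \<subseteq> {1..7}" "a ({1..7} - K) \<noteq> 0" by (auto simp: star_def split: if_splits)
  then have "card ({1..7} - K) = k" using assms by (auto simp: homog_def)
  moreover have "card ({1..7} - K) = 7 - card K" using K by (simp add: card_Diff_subset finite_subset17)
  moreover have "card K \<le> 7" using card_mono[OF _ K(1)] by simp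
  ultimately show "K \<subseteq> {1..7} \<and> card K = 7 - k" using K by auto
qed

lemma homog_xform: "I \<subseteq> {1..7} \<Longrightarrow> homog (card I) (xform P I)"
proof -
  assume I: "I \<subseteq> {1..7}"
  then have "finite I" by (rule finite_subset17)
  then show ?thesis using I
  proof (induction I rule: finite_linorder_min_induct)
    case empty show ?case using homog_eform[of "{}"] by (simp add: xform_empty)
  next
    case (insert m I)
    then have "card (insert m I) = Suc (card I)" by (metis card_insert_disjoint less_irrefl)
    then show ?case using insert by (simp add: xform_insert_min homog_lmul)
  qed
qed

lemma homog_pull: "homog k a \<Longrightarrow> homog k (pull P a)"
  unfolding pull_def
proof (rule homog_sum)
  fix I assume a: "homog k a" and I: "I \<in> Pow {1..7::nat}"
  show "homog k (\<lambda>K. a I * xform P I K)"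
    using homog_xform[of I P] a I by (cases "a I = 0") (auto simp: homog_zero homog_def)
qed

lemma coeff_plus: "coeff (\<lambda>K. a K + b K) ks = coeff a ks + coeff b ks" by (simp add: coeff_def)
lemma coeff_minus: "coeff (\<lambda>K. a K - b K) ks = coeff a ks - coeff b ks" by (simp add: coeff_def)
lemma coeff_uminus: "coeff (\<lambda>K. - a K) ks = - coeff a ks" by (simp add: coeff_def)
lemma coeff_scale: "coeff (\<lambda>K. c * a K) ks = c * coeff a ks" by (simp add: coeff_def)
lemma coeff_div: "coeff (\<lambda>K. a K / c) ks = coeff a ks / c" by (simp add: coeff_def)
lemma coeff_zero: "coeff (\<lambda>K. 0) ks = 0" by (simp add: coeff_def)

lemmas coeff_linear = coeff_plus coeff_minus coeff_uminus coeff_scale coeff_zero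
lemmas coeff_simps = coeff_form_of coeff_wedge_left coeff_wedge_right coeff_contr_kron coeff_contr coeff_lmul coeff_star coeff_linear

section \<open>The standard G2 form, its dual and the metric it determines\<close>

definition phi0 :: form where
  "phi0 = form_of [([1,2,7],1),([3,4,7],1),([5,6,7],1),([1,3,5],1),([1,4,6],-1),([2,3,6],-1),([2,4,5],-1)]"

definition psi0 :: form where
  "psi0 = form_of [([3,4,5,6],1),([1,2,5,6],1),([1,2,3,4],1),([2,4,6,7],-1),([2,3,5,7],1),([1,4,5,7],1),([1,3,6,7],1)]"

definition vol :: form where "vol = eform {1..7}"

lemma vol_form_of: "vol = form_of [([1,2,3,4,5,6,7],1)]"
  unfolding form_of_Cons form_of_Nil vol_def set_list17 by simp

lemma sublists_1: "sublists_of_size 1 [1,2,3,4,5,6,7] = [[1],[2],[3],[4],[5],[6],[7]]" by (simp add: One_nat_def)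

lemma sublists_2: "sublists_of_size 2 [1,2,3,4,5,6,7] = [[1,2],[1,3],[1,4],[1,5],[1,6],[1,7],[2,3],[2,4],[2,5],[2,6],[2,7],
  [3,4],[3,5],[3,6],[3,7],[4,5],[4,6],[4,7],[5,6],[5,7],[6,7]]"
  by (simp add: eval_nat_numeral One_nat_def)

lemma sublists_3: "sublists_of_size 3 [1,2,3,4,5,6,7] = [[1,2,3],[1,2,4],[1,2,5],[1,2,6],[1,2,7],[1,3,4],[1,3,5],[1,3,6],[1,3,7],
  [1,4,5],[1,4,6],[1,4,7],[1,5,6],[1,5,7],[1,6,7],[2,3,4],[2,3,5],[2,3,6],[2,3,7],[2,4,5],[2,4,6],[2,4,7],
  [2,5,6],[2,5,7],[2,6,7],[3,4,5],[3,4,6],[3,4,7],[3,5,6],[3,5,7],[3,6,7],[4,5,6],[4,5,7],[4,6,7],[5,6,7]]"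
  by (simp add: eval_nat_numeral One_nat_def)

lemma sublists_5: "sublists_of_size 5 [1,2,3,4,5,6,7] = [[1,2,3,4,5],[1,2,3,4,6],[1,2,3,4,7],[1,2,3,5,6],[1,2,3,5,7],[1,2,3,6,7],
  [1,2,4,5,6],[1,2,4,5,7],[1,2,4,6,7],[1,2,5,6,7],[1,3,4,5,6],[1,3,4,5,7],[1,3,4,6,7],[1,3,5,6,7],[1,4,5,6,7],
  [2,3,4,5,6],[2,3,4,5,7],[2,3,4,6,7],[2,3,5,6,7],[2,4,5,6,7],[3,4,5,6,7]]"
  by (simp add: eval_nat_numeral One_nat_def)

lemma sublists_6: "sublists_of_size 6 [1,2,3,4,5,6,7] = [[1,2,3,4,5,6],[1,2,3,4,5,7],[1,2,3,4,6,7],[1,2,3,5,6,7],[1,2,4,5,6,7],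
  [1,3,4,5,6,7],[2,3,4,5,6,7]]"
  by (simp add: eval_nat_numeral One_nat_def)

lemma sublists_7: "sublists_of_size 7 [1,2,3,4,5,6,7] = [[1,2,3,4,5,6,7]]"
  by (simp add: eval_nat_numeral One_nat_def)

lemma sublists_4: "sublists_of_size 4 [1,2,3,4,5,6,7] = [[1,2,3,4],[1,2,3,5],[1,2,3,6],[1,2,3,7],[1,2,4,5],[1,2,4,6],[1,2,4,7],[1,2,5,6],
 [1,2,5,7],[1,2,6,7],[1,3,4,5],[1,3,4,6],[1,3,4,7],[1,3,5,6],[1,3,5,7],[1,3,6,7],[1,4,5,6],[1,4,5,7],[1,4,6,7],[1,5,6,7],
 [2,3,4,5],[2,3,4,6],[2,3,4,7],[2,3,5,6],[2,3,5,7],[2,3,6,7],[2,4,5,6],[2,4,5,7],[2,4,6,7],[2,5,6,7],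
 [3,4,5,6],[3,4,5,7],[3,4,6,7],[3,5,6,7],[4,5,6,7]]"
  by (simp add: eval_nat_numeral One_nat_def)

lemma homog_phi0: "homog 3 phi0" unfolding phi0_def by (rule homog_form_of) simp_all
lemma homog_psi0: "homog 4 psi0" unfolding psi0_def by (rule homog_form_of) simp_all
lemma homog_vol: "homog 7 vol" unfolding vol_form_of by (rule homog_form_of) simp_all

lemma star_phi0: "star phi0 = psi0"
proof (rule homog_eqI)
  show "homog 4 (star phi0)" using homog_star[OF homog_phi0] by simp
  show "list_all (\<lambda>ks. coeff (star phi0) ks = coeff psi0 ks) (sublists_of_size 4 [1,2,3,4,5,6,7])"
    unfolding sublists_4 by (simp add: coeff_simps phi0_def psi0_def)
qed (rule homog_psi0)

lemma star_star: "supp7 a \<Longrightarrow> star (star a) = a"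
  by (rule form_eqI) (simp_all add: supp7_star coeff_simps)

definition par :: "form \<Rightarrow> form" where "par a = (\<lambda>K. (-1) ^ card K * a K)"

text \<open>Under the star, right multiplication by a covector becomes contraction; the parity sign
  moves the covector from left to right. This permits induction on the degree in statements about
  the star.\<close>

lemma star_lmul: "supp7 a \<Longrightarrow> star (lmul c a) = contr c (star (par a))"
proof (rule form_eqI)
  have p: "coeff (par a) ks = (if even (length ks) then coeff a ks else - coeff a ks)" if "sorted17 ks" for ks
    using that by (simp add: coeff_def par_def sorted17_distinct distinct_card)
  show "list_all (\<lambda>ks. coeff (star (lmul c a)) ks = coeff (contr c (star (par a))) ks) (subseqs [1,2,3,4,5,6,7])"
    by (simp add: coeff_simps p)
qed (auto intro: supp7_star supp7_contr)

lemma phi0_psi0: "wedge phi0 psi0 = (\<lambda>K. 7 * vol K)"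
proof (rule homog_eqI)
  show "homog 7 (wedge phi0 psi0)" using homog_wedge[OF homog_phi0 homog_psi0] by simp
  show "homog 7 (\<lambda>K. 7 * vol K)" by (intro homog_scale homog_vol)
  show "list_all (\<lambda>ks. coeff (wedge phi0 psi0) ks = coeff (\<lambda>K. 7 * vol K) ks) (sublists_of_size 7 [1,2,3,4,5,6,7])"
    unfolding sublists_7 by (simp add: coeff_simps phi0_def psi0_def vol_form_of)
qed

lemma contr_phi0: "contr u phi0 = form_of [([1,2],u 7),([3,4],u 7),([5,6],u 7),
   ([2,7],u 1),([3,5],u 1),([4,6],-u 1), ([1,7],-u 2),([3,6],-u 2),([4,5],-u 2),
   ([4,7],u 3),([1,5],-u 3),([2,6],u 3), ([3,7],-u 4),([1,6],u 4),([2,5],u 4),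
   ([6,7],u 5),([1,3],u 5),([2,4],-u 5), ([5,7],-u 6),([1,4],-u 6),([2,3],-u 6)]"
  (is "_ = form_of ?X")
proof (rule homog_eqI)
  show "homog 2 (contr u phi0)" using homog_phi0 by (intro homog_contr) simp
  show "homog 2 (form_of ?X)" by (rule homog_form_of) simp_all
  show "list_all (\<lambda>ks. coeff (contr u phi0) ks = coeff (form_of ?X) ks) (sublists_of_size 2 [1,2,3,4,5,6,7])"
    unfolding sublists_2 by (simp add: coeff_simps phi0_def)
qed

lemma homog_contr_phi0: "homog 2 (contr u phi0)" using homog_phi0 by (intro homog_contr) simp

lemma pairing_list: "pairing u v = u 1 * v 1 + u 2 * v 2 + u 3 * v 3 + u 4 * v 4 + u 5 * v 5 + u 6 * v 6 + u 7 * v 7"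
  unfolding pairing_def set_list17[symmetric] by simp

text \<open>The classical formula by which a G2 form determines its metric and volume form
  together.\<close>

lemma bilinear_phi0:
  "wedge (wedge (contr u phi0) (contr v phi0)) phi0 = (\<lambda>K. 6 * pairing u v * vol K)"
proof (rule homog_eqI)
  show "homog 7 (wedge (wedge (contr u phi0) (contr v phi0)) phi0)"
    using homog_wedge[OF homog_wedge[OF homog_contr_phi0 homog_contr_phi0] homog_phi0, of u v] by simp
  show "homog 7 (\<lambda>K. 6 * pairing u v * vol K)" by (intro homog_scale homog_vol)
  show "list_all (\<lambda>ks. coeff (wedge (wedge (contr u phi0) (contr v phi0)) phi0) ks = coeff (\<lambda>K. 6 * pairing u v * vol K) ks)
     (sublists_of_size 7 [1,2,3,4,5,6,7])"
    unfolding sublists_7 contr_phi0 by (simp add: coeff_simps phi0_def vol_form_of pairing_list)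
qed

lemma pull_form_of:
  "wf_terms xs \<Longrightarrow> pull P (form_of xs) = (\<lambda>K. \<Sum>(I, c)\<leftarrow>xs. c * xform P (set I) K)"
proof (induction xs rule: wf_terms.induct)
  case (2 I c xs)
  have "pull P (form_of ((I, c) # xs)) = (\<lambda>K. c * pull P (eform (set I)) K + 1 * pull P (form_of xs) K)"
    unfolding form_of_Cons by (rule linear_op_comb[OF linear_op_pull])
  then show ?case using 2 by (simp add: pull_eform sorted17_iff)
qed (simp add: form_of_Nil linear_op_zero[OF linear_op_pull])

lemma std_phi_pull: "std_phi P = pull P phi0"
  unfolding std_phi_def phi0_def by (subst pull_form_of) (simp_all add: insert_commute algebra_simps)

section \<open>Invariance under changes of the adapted frame\<close>

lemma kron_sym: "kron i j = kron j i" by (simp add: kron_def)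

lemma vecP_kron: "j \<in> {1..7} \<Longrightarrow> vecP P (kron j) i = P i j"
  unfolding vecP_def kron_sym[of j] using vec_expand[of j "\<lambda>k. P i k"] by simp

lemma mmul_assoc: "mmul (mmul A B) C i j = mmul A (mmul B C) i j"
  unfolding mmul_def sum_distrib_left sum_distrib_right by (subst sum.swap) (simp add: mult.assoc)

lemma mmul_kron_left: "i \<in> {1..7} \<Longrightarrow> mmul kron A i j = A i j"
  unfolding mmul_def kron_sym[of i] using vec_expand[of i "\<lambda>k. A k j"] by (simp add: mult.commute)

lemma mmul_cong_left: "(\<And>k. k \<in> {1..7} \<Longrightarrow> A i k = B i k) \<Longrightarrow> mmul A C i j = mmul B C i j"
  by (simp add: mmul_def)

lemma mmul_cong_right: "(\<And>k. k \<in> {1..7} \<Longrightarrow> A k j = B k j) \<Longrightarrow> mmul C A i j = mmul C B i j"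
  by (simp add: mmul_def)

definition minv :: "(nat \<Rightarrow> nat \<Rightarrow> real) \<Rightarrow> (nat \<Rightarrow> nat \<Rightarrow> real) \<Rightarrow> bool" where
  "minv P Q \<longleftrightarrow> (\<forall>i\<in>{1..7}. \<forall>j\<in>{1..7}. mmul P Q i j = kron i j \<and> mmul Q P i j = kron i j)"

lemma basis_minv: "is_basis P \<Longrightarrow> \<exists>Q. minv P Q"
  using invertible_basis[of P] unfolding minv_def by blast

lemma minv_basis: "minv P Q \<Longrightarrow> is_basis P"
  by (rule is_basisI[of P Q]) (auto simp: minv_def)

lemma minv_sym: "minv P Q \<Longrightarrow> minv Q P" by (auto simp: minv_def)

lemma mmul_cancel:
  assumes "minv P P'" "minv Q Q'" "i \<in> {1..7}" "j \<in> {1..7}"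
  shows "mmul (mmul P Q) (mmul Q' P') i j = kron i j"
proof -
  have "mmul (mmul P Q) (mmul Q' P') i j = mmul P (mmul Q (mmul Q' P')) i j" by (rule mmul_assoc)
  also have "\<dots> = mmul P P' i j"
  proof (rule mmul_cong_right)
    fix k assume k: "k \<in> {1..7::nat}"
    have "mmul Q (mmul Q' P') k j = mmul (mmul Q Q') P' k j" by (rule mmul_assoc[symmetric])
    also have "\<dots> = mmul kron P' k j" by (rule mmul_cong_left) (use assms k in \<open>auto simp: minv_def\<close>)
    also have "\<dots> = P' k j" using k by (rule mmul_kron_left)
    finally show "mmul Q (mmul Q' P') k j = P' k j" .
  qed
  finally show ?thesis using assms by (simp add: minv_def)
qed

lemma minv_mmul: "minv P P' \<Longrightarrow> minv Q Q' \<Longrightarrow> minv (mmul P Q) (mmul Q' P')"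
  unfolding minv_def[of "mmul P Q"]
  using mmul_cancel[of P P' Q Q'] mmul_cancel[of Q' Q P' P] minv_sym by blast

lemma pull_minv: "minv P Q \<Longrightarrow> supp7 a \<Longrightarrow> pull P (pull Q a) = a"
  by (rule pull_inverse) (auto simp: minv_def)

lemma pull_vol: "pull R vol = (\<lambda>K. pull R vol {1..7} * vol K)"
proof (rule homog_eqI)
  show "homog 7 (pull R vol)" by (intro homog_pull homog_vol)
  show "homog 7 (\<lambda>K. pull R vol {1..7} * vol K)" by (intro homog_scale homog_vol)
  show "list_all (\<lambda>ks. coeff (pull R vol) ks = coeff (\<lambda>K. pull R vol {1..7} * vol K) ks) (sublists_of_size 7 [1,2,3,4,5,6,7])"
    unfolding sublists_7 list.pred_inject coeff_def set_list17 by (simp add: vol_def eform_def)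
qed

lemma par_homog: "homog k a \<Longrightarrow> par a = (\<lambda>K. (-1) ^ k * a K)"
  by (force simp: par_def homog_def fun_eq_iff)

text \<open>The stabiliser of \<open>phi0\<close> lies in SO(7). The volume-valued metric of
  \<open>bilinear_phi0\<close> shows that R is orthogonal up to its determinant \<delta>; comparing
  the scaling of the dual 4-form with that of the volume then forces \<delta> = 1.\<close>

lemma G2_stab:
  assumes R: "pull R phi0 = phi0" and S: "minv R S" and a: "supp7 a"
  shows "pull R (star a) = star (pull R a)"
proof -
  define \<delta> where "\<delta> = pull R vol {1..7}"
  have pv: "pull R vol = (\<lambda>K. \<delta> * vol K)" unfolding \<delta>_def by (rule pull_vol)
  have s0: "supp7 phi0" using homog_phi0 by (rule homog_supp7)
  have sc: "supp7 (contr u phi0)" for u using s0 by (rule supp7_contr)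
  have vol1: "vol {1..7} = 1" by (simp add: vol_def eform_def)
  \<comment> \<open>Pull back \<open>bilinear_phi0\<close>: \<open>phi0\<close> is fixed, the
    vectors are transformed by R, and the volume form is multiplied by \<delta>.\<close>
  have metric: "\<delta> * pairing (vecP R n) (vecP R m) = pairing n m" for n m
  proof -
    have "(\<lambda>K. 6 * pairing n m * vol K) = wedge (wedge (contr n (pull R phi0)) (contr m (pull R phi0))) (pull R phi0)"
      by (simp add: R bilinear_phi0)
    also have "\<dots> = pull R (wedge (wedge (contr (vecP R n) phi0) (contr (vecP R m) phi0)) phi0)"
      by (simp add: contr_pull[OF s0] pull_wedge s0 sc supp7_wedge)
    also have "\<dots> = (\<lambda>K. 6 * pairing (vecP R n) (vecP R m) * (\<delta> * vol K))"
      by (simp add: bilinear_phi0 linear_op_scale[OF linear_op_pull] pv)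
    finally show ?thesis using vol1 by (auto dest: fun_cong[where x = "{1..7}"])
  qed
  have pd: "pairing (kron i) (kron j) = kron i j" if "i \<in> {1..7}" "j \<in> {1..7}" for i j
    unfolding pairing_def kron_sym[of j] using vec_expand[of j "kron i"] that by simp
  have orth: "\<delta> * (\<Sum>k\<in>{1..7}. R k i * R k j) = kron i j" if "i \<in> {1..7}" "j \<in> {1..7}" for i j
    using metric[of "kron i" "kron j"] that unfolding pd[OF that] by (simp add: vecP_kron pairing_def)
  have d0: "\<delta> \<noteq> 0" using orth[of 1 1] by (auto simp: kron_def)
  \<comment> \<open>Orthogonality up to scale says that the inverse of R is \<delta> times its
    transpose.\<close>
  have SR: "S i j = \<delta> * R j i" if ij: "i \<in> {1..7}" "j \<in> {1..7}" for i j
  proof -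
    have "S i j = (\<Sum>k\<in>{1..7}. kron i k * S k j)" using mmul_kron_left[OF ij(1), of S j] by (simp add: mmul_def)
    also have "\<dots> = (\<Sum>k\<in>{1..7}. \<Sum>l\<in>{1..7}. \<delta> * R l i * (R l k * S k j))"
      using ij by (intro sum.cong) (auto simp: orth[symmetric] sum_distrib_left sum_distrib_right algebra_simps)
    also have "\<dots> = (\<Sum>l\<in>{1..7}. \<delta> * R l i * mmul R S l j)"
      by (subst sum.swap) (simp add: mmul_def sum_distrib_left)
    also have "\<dots> = (\<Sum>l\<in>{1..7}. (\<delta> * R l i) * kron l j)"
      using S ij by (intro sum.cong) (auto simp: minv_def)
    also have "\<dots> = \<delta> * R j i" using vec_expand[OF ij(2), of "\<lambda>l. \<delta> * R l i"] by simp
    finally show ?thesis .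
  qed
  have VR: "vecP R (\<lambda>j. \<delta> * R m j) i = kron m i" if "m \<in> {1..7}" "i \<in> {1..7}" for m i
  proof -
    have "vecP R (\<lambda>j. \<delta> * R m j) i = mmul R S i m"
      using that by (auto simp: vecP_def mmul_def SR intro!: sum.cong)
    then show ?thesis using S that by (auto simp: minv_def kron_def)
  qed
  \<comment> \<open>The volume form contributes one factor \<delta>. Each further covector
    contributes another one, because contraction with the m-th coordinate vector corresponds to
    \<delta> times contraction with row m of R.\<close>
  have E: "pull R (star (eform I)) = (\<lambda>K. \<delta> * \<delta> ^ card I * star (pull R (eform I)) K)" if I: "I \<subseteq> {1..7}" for I
  proof -
    have "finite I" using I by (rule finite_subset17)
    then show ?thesis using I
    proof (induction I rule: finite_linorder_min_induct)
      case empty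
      have "star (eform {}) = vol" by (simp add: star_eform vol_def)
      then show ?case by (simp add: pull_eform xform_empty pv)
    next
      case (insert m I)
      then have m: "m \<in> {1..7}" and I: "I \<subseteq> {1..7}" "m \<notin> I" by auto
      have sI: "supp7 (eform I)" using I by (intro supp7_eform)
      have e: "eform (insert m I) = lmul (kron m) (eform I)"
        using insert m by (intro lmul_kron_eform_min[symmetric]) auto
      have p1: "par (eform I) = (\<lambda>K. (-1) ^ card I * eform I K)" by (rule par_homog[OF homog_eform[OF I(1)]])
      have p2: "par (pull R (eform I)) = (\<lambda>K. (-1) ^ card I * pull R (eform I) K)"
        by (rule par_homog[OF homog_pull[OF homog_eform[OF I(1)]]])
      have "pull R (star (eform (insert m I))) = (\<lambda>K. (-1) ^ card I * pull R (contr (kron m) (star (eform I))) K)"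
        by (simp add: e star_lmul[OF sI] p1 linear_op_scale[OF linear_op_star] linear_op_scale[OF linear_op_contr] linear_op_scale[OF linear_op_pull])
      also have "contr (kron m) (star (eform I)) = contr (vecP R (\<lambda>j. \<delta> * R m j)) (star (eform I))"
        using m by (intro contr_cong) (simp add: VR)
      also have "pull R \<dots> = (\<lambda>K. \<delta> * contr (R m) (pull R (star (eform I))) K)"
        by (simp add: contr_pull[OF supp7_star, symmetric] contr_scale)
      also have "pull R (star (eform I)) = (\<lambda>K. \<delta> * \<delta> ^ card I * star (pull R (eform I)) K)"
        using insert I by simp
      finally have L: "pull R (star (eform (insert m I))) =
         (\<lambda>K. (-1) ^ card I * (\<delta> * (\<delta> * \<delta> ^ card I * contr (R m) (star (pull R (eform I))) K)))"
        by (simp add: linear_op_scale[OF linear_op_contr])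
      have "star (pull R (eform (insert m I))) = star (lmul (R m) (pull R (eform I)))"
        using m by (simp add: e pull_lmul_kron[OF sI])
      also have "\<dots> = (\<lambda>K. (-1) ^ card I * contr (R m) (star (pull R (eform I))) K)"
        by (simp add: star_lmul[OF supp7_pull] p2 linear_op_scale[OF linear_op_star] linear_op_scale[OF linear_op_contr])
      finally show ?case using I finite_subset17[of I] by (simp add: L algebra_simps)
    qed
  qed
  have H: "pull R (star b) = (\<lambda>K. \<delta> * \<delta> ^ k * star (pull R b) K)" if b: "homog k b" for b k
  proof -
    have "pull R (star b) = (\<lambda>K. \<Sum>I\<in>Pow {1..7}. b I * pull R (star (eform I)) K)"
      by (rule lin_expand[OF linear_op_comp[OF linear_op_pull linear_op_star] homog_supp7[OF b]])
    also have "\<dots> = (\<lambda>K. \<Sum>I\<in>Pow {1..7}. (\<delta> * \<delta> ^ k) * (b I * star (pull R (eform I)) K))"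
      using b by (intro ext sum.cong) (auto simp: E homog_def)
    also have "\<dots> = (\<lambda>K. (\<delta> * \<delta> ^ k) * (\<Sum>I\<in>Pow {1..7}. b I * star (pull R (eform I)) K))"
      by (simp add: sum_distrib_left)
    also have "\<dots> = (\<lambda>K. \<delta> * \<delta> ^ k * star (pull R b) K)"
      by (subst lin_expand[OF linear_op_comp[OF linear_op_star linear_op_pull] homog_supp7[OF b]]) simp
    finally show ?thesis .
  qed
  have "pull R psi0 = (\<lambda>K. \<delta> ^ 4 * psi0 K)"
    using H[OF homog_phi0] by (simp add: star_phi0 R power4_eq_xxxx power3_eq_cube mult.assoc)
  then have "pull R (wedge phi0 psi0) = (\<lambda>K. \<delta> ^ 4 * wedge phi0 psi0 K)"
    by (simp add: pull_wedge s0 homog_supp7[OF homog_psi0] R linear_op_scale[OF linear_op_wedge_right])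
  \<comment> \<open>The same 7-form scales by \<delta> as a multiple of \<open>vol\<close> and by
    \<delta>^4 through its factor \<open>psi0\<close>.\<close>
  then have "(\<lambda>K. 7 * (\<delta> * vol K)) = (\<lambda>K. \<delta> ^ 4 * (7 * vol K))"
    by (simp add: phi0_psi0 linear_op_scale[OF linear_op_pull] pv)
  then have "\<delta> = \<delta> ^ 4" using vol1 by (auto dest: fun_cong[where x = "{1..7}"])
  then have "\<delta> * (\<delta> ^ 3 - 1) = 0" by (simp add: algebra_simps power4_eq_xxxx power3_eq_cube)
  then have "\<delta> ^ 3 = 1 ^ 3" using d0 by simp
  then have "\<delta> = 1" using odd_real_root_power_cancel[of 3 \<delta>] by simp
  then show ?thesis
    by (intro lin_eqI[OF linear_op_comp[OF linear_op_pull linear_op_star] linear_op_comp[OF linear_op_star linear_op_pull] a]) (simp add: E)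
qed

lemma adapted_pull: "G2_adapted \<phi> P \<longleftrightarrow> is_basis P \<and> \<phi> = pull P phi0"
  by (simp add: G2_adapted_def std_phi_pull)

lemma supp7_phi0: "supp7 phi0" using homog_phi0 by (rule homog_supp7)
lemma supp7_psi0: "supp7 psi0" using homog_psi0 by (rule homog_supp7)

text \<open>Two adapted frames of one form differ by an element of the stabiliser of
  \<open>phi0\<close>, namely P times the inverse of Q. This makes the choice of frame in
  \<open>hodge\<close> harmless.\<close>

lemma hodge_wrt_indep:
  assumes P: "G2_adapted \<phi> P" and Q: "G2_adapted \<phi> Q" and b: "supp7 b"
  shows "hodge_wrt Q (pull P b) = pull P (star b)"
proof -
  obtain P' Q' where i: "minv P P'" "minv Q Q'" using P Q basis_minv unfolding adapted_pull by blast
  define R where "R = mmul P Q'"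
  have R: "pull R a = pull Q' (pull P a)" if "supp7 a" for a using that by (simp add: R_def pull_pull)
  have QR: "pull Q (pull R a) = pull P a" if "supp7 a" for a using that i by (simp add: R pull_minv supp7_pull)
  have "pull R phi0 = pull Q' (pull Q phi0)" using P Q by (simp add: R supp7_phi0 adapted_pull)
  also have "\<dots> = phi0" using i by (intro pull_minv[OF minv_sym] supp7_phi0)
  finally have "pull R phi0 = phi0" .
  moreover have "minv R (mmul Q P')" unfolding R_def by (rule minv_mmul[OF i(1) minv_sym[OF i(2)]])
  ultimately have "pull R (star b) = star (pull R b)" using b by (rule G2_stab)
  then have "pull P (star b) = pull Q (star (pull R b))" using QR[OF supp7_star] by metis
  also have "\<dots> = hodge_wrt Q (pull P b)"
    using Q b by (subst QR[symmetric], simp, subst hodge_wrt_pull) (auto simp: adapted_pull supp7_pull)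
  finally show ?thesis by simp
qed

lemma hodge_pull:
  assumes "G2_adapted \<phi> P" "supp7 b" shows "hodge \<phi> (pull P b) = pull P (star b)"
  unfolding hodge_def using someI[of "G2_adapted \<phi>", OF assms(1)] assms by (intro hodge_wrt_indep)

lemma psi_of_pull: "G2_adapted \<phi> P \<Longrightarrow> psi_of \<phi> = pull P psi0"
  using hodge_pull[of \<phi> P phi0] by (simp add: psi_of_def adapted_pull supp7_phi0 star_phi0)

lemma adapted_mmul:
  assumes P: "G2_adapted \<phi> P" and R: "pull R phi0 = phi0" "minv R S"
  shows "G2_adapted \<phi> (mmul R P)"
proof -
  obtain P' where "minv P P'" using P basis_minv unfolding adapted_pull by blast
  then have "is_basis (mmul R P)" using R by (intro minv_basis[OF minv_mmul])
  moreover have "pull (mmul R P) phi0 = \<phi>" using P R by (simp add: pull_pull[symmetric] supp7_phi0 adapted_pull)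
  ultimately show ?thesis by (simp add: adapted_pull)
qed

section \<open>Rotations in G2 and frames aligned with the centre\<close>

definition rotm :: "nat \<Rightarrow> nat \<Rightarrow> nat \<Rightarrow> nat \<Rightarrow> real \<Rightarrow> real \<Rightarrow> nat \<Rightarrow> nat \<Rightarrow> real" where
  "rotm i j k l c s a b =
     (if a = i then (if b = i then c else if b = j then s else 0)
      else if a = j then (if b = i then - s else if b = j then c else 0)
      else if a = k then (if b = k then c else if b = l then - s else 0)
      else if a = l then (if b = k then s else if b = l then c else 0)
      else kron a b)"

lemma xform3:
  assumes "i < j" "j < k"
  shows "xform P {i, j, k} = lmul (P i) (lmul (P j) (lmul (P k) (form_of [([], 1)])))"
proof -
  have "form_of [([], 1)] = eform {}" by (auto simp: form_of_def eform_def)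
  then show ?thesis using assms by (simp add: xform_insert_min xform_empty)
qed

lemma pull_phi0: "pull P phi0 = (\<lambda>K. xform P {1,2,7} K + xform P {3,4,7} K + xform P {5,6,7} K
      + xform P {1,3,5} K - xform P {1,4,6} K - xform P {2,3,6} K - xform P {2,4,5} K)"
  using std_phi_pull[of P] by (simp add: std_phi_def)

text \<open>Rewrite rules that eliminate squares of c; the second catches them inside right-nested
  products.\<close>

lemma rot_algebra:
  assumes "c * c + s * s = (1::real)"
  shows "c * c = 1 - s * s" "c * (c * x) = x - s * (s * x)"
  using assms by (auto simp: algebra_simps) (metis add.commute add_diff_cancel_left' assms distrib_right mult.assoc mult_1)

lemma mmul_list: "mmul A B i j = A i 1 * B 1 j + A i 2 * B 2 j + A i 3 * B 3 j + A i 4 * B 4 j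
    + A i 5 * B 5 j + A i 6 * B 6 j + A i 7 * B 7 j"
  unfolding mmul_def set_list17[symmetric] by simp

lemma phi0_invariantI:
  "list_all (\<lambda>ks. coeff (pull P phi0) ks = coeff phi0 ks) (sublists_of_size 3 [1,2,3,4,5,6,7]) \<Longrightarrow> pull P phi0 = phi0"
  by (intro homog_eqI[of 3] homog_pull homog_phi0)

text \<open>The planes 12 and 34 turn in opposite senses, and the fixed covectors 5, 6, 7 form an
  associative triple, i.e. index a term of \<open>phi0\<close>. The rotations after this one follow
  the same pattern with fixed triples 127, 127, 567, 347 and 245.\<close>

lemma rot_1234:
  assumes "c * c + s * s = 1"
  shows "pull (rotm 1 2 3 4 c s) phi0 = phi0" "minv (rotm 1 2 3 4 c s) (rotm 1 2 3 4 c (- s))"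
proof -
  show "pull (rotm 1 2 3 4 c s) phi0 = phi0"
    by (rule phi0_invariantI)
      (unfold sublists_3 pull_phi0, simp add: xform3 coeff_simps phi0_def rotm_def kron_def rot_algebra[OF assms])
  show "minv (rotm 1 2 3 4 c s) (rotm 1 2 3 4 c (- s))"
    unfolding minv_def set_list17[symmetric]
    by (simp add: mmul_list rotm_def kron_def rot_algebra[OF assms])
qed

lemma rot_3456:
  assumes "c * c + s * s = 1"
  shows "pull (rotm 3 4 5 6 c s) phi0 = phi0" "minv (rotm 3 4 5 6 c s) (rotm 3 4 5 6 c (- s))"
proof -
  show "pull (rotm 3 4 5 6 c s) phi0 = phi0"
    by (rule phi0_invariantI)
      (unfold sublists_3 pull_phi0, simp add: xform3 coeff_simps phi0_def rotm_def kron_def rot_algebra[OF assms])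
  show "minv (rotm 3 4 5 6 c s) (rotm 3 4 5 6 c (- s))"
    unfolding minv_def set_list17[symmetric]
    by (simp add: mmul_list rotm_def kron_def rot_algebra[OF assms])
qed

lemma rot_5634:
  assumes "c * c + s * s = 1"
  shows "pull (rotm 5 6 3 4 c s) phi0 = phi0" "minv (rotm 5 6 3 4 c s) (rotm 5 6 3 4 c (- s))"
proof -
  show "pull (rotm 5 6 3 4 c s) phi0 = phi0"
    by (rule phi0_invariantI)
      (unfold sublists_3 pull_phi0, simp add: xform3 coeff_simps phi0_def rotm_def kron_def rot_algebra[OF assms])
  show "minv (rotm 5 6 3 4 c s) (rotm 5 6 3 4 c (- s))"
    unfolding minv_def set_list17[symmetric]
    by (simp add: mmul_list rotm_def kron_def rot_algebra[OF assms])
qed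

lemma rot_1342:
  assumes "c * c + s * s = 1"
  shows "pull (rotm 1 3 4 2 c s) phi0 = phi0" "minv (rotm 1 3 4 2 c s) (rotm 1 3 4 2 c (- s))"
proof -
  show "pull (rotm 1 3 4 2 c s) phi0 = phi0"
    by (rule phi0_invariantI)
      (unfold sublists_3 pull_phi0, simp add: xform3 coeff_simps phi0_def rotm_def kron_def rot_algebra[OF assms])
  show "minv (rotm 1 3 4 2 c s) (rotm 1 3 4 2 c (- s))"
    unfolding minv_def set_list17[symmetric]
    by (simp add: mmul_list rotm_def kron_def rot_algebra[OF assms])
qed

lemma rot_1562:
  assumes "c * c + s * s = 1"
  shows "pull (rotm 1 5 6 2 c s) phi0 = phi0" "minv (rotm 1 5 6 2 c s) (rotm 1 5 6 2 c (- s))"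
proof -
  show "pull (rotm 1 5 6 2 c s) phi0 = phi0"
    by (rule phi0_invariantI)
      (unfold sublists_3 pull_phi0, simp add: xform3 coeff_simps phi0_def rotm_def kron_def rot_algebra[OF assms])
  show "minv (rotm 1 5 6 2 c s) (rotm 1 5 6 2 c (- s))"
    unfolding minv_def set_list17[symmetric]
    by (simp add: mmul_list rotm_def kron_def rot_algebra[OF assms])
qed

lemma rot_7163:
  assumes "c * c + s * s = 1"
  shows "pull (rotm 7 1 6 3 c s) phi0 = phi0" "minv (rotm 7 1 6 3 c s) (rotm 7 1 6 3 c (- s))"
proof -
  show "pull (rotm 7 1 6 3 c s) phi0 = phi0"
    by (rule phi0_invariantI)
      (unfold sublists_3 pull_phi0, simp add: xform3 coeff_simps phi0_def rotm_def kron_def rot_algebra[OF assms])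
  show "minv (rotm 7 1 6 3 c s) (rotm 7 1 6 3 c (- s))"
    unfolding minv_def set_list17[symmetric]
    by (simp add: mmul_list rotm_def kron_def rot_algebra[OF assms])
qed

text \<open>The values x^i(e_7) of some adapted frame. Seven separate reals, with the frame hidden
  behind a quantifier, let each rotation act on the column by rewriting.\<close>

definition frame_col ::
    "form \<Rightarrow> real \<Rightarrow> real \<Rightarrow> real \<Rightarrow> real \<Rightarrow> real \<Rightarrow> real \<Rightarrow> real \<Rightarrow> bool" where
  "frame_col \<phi> a1 a2 a3 a4 a5 a6 a7 \<longleftrightarrow> (\<exists>P. G2_adapted \<phi> P \<and> P 1 7 = a1 \<and> P 2 7 = a2 \<and> P 3 7 = a3
     \<and> P 4 7 = a4 \<and> P 5 7 = a5 \<and> P 6 7 = a6 \<and> P 7 7 = a7)"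

lemma frame_col_step:
  assumes "frame_col \<phi> a1 a2 a3 a4 a5 a6 a7" "pull R phi0 = phi0" "minv R S"
  defines "b i \<equiv> R i 1 * a1 + R i 2 * a2 + R i 3 * a3 + R i 4 * a4 + R i 5 * a5 + R i 6 * a6 + R i 7 * a7"
  shows "frame_col \<phi> (b 1) (b 2) (b 3) (b 4) (b 5) (b 6) (b 7)"
proof -
  obtain P where P: "G2_adapted \<phi> P" "P 1 7 = a1" "P 2 7 = a2" "P 3 7 = a3"
     "P 4 7 = a4" "P 5 7 = a5" "P 6 7 = a6" "P 7 7 = a7"
    using assms(1) unfolding frame_col_def by blast
  have "G2_adapted \<phi> (mmul R P)" using P(1) assms(2,3) by (rule adapted_mmul)
  moreover have "mmul R P i 7 = b i" for i by (simp add: mmul_list P b_def)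
  ultimately show ?thesis unfolding frame_col_def by blast
qed

lemma frame_col_rot:
  assumes "frame_col \<phi> a1 a2 a3 a4 a5 a6 a7" "c * c + s * s = 1"
  shows "frame_col \<phi> (c * a1 + s * a2) (- s * a1 + c * a2) (c * a3 - s * a4) (s * a3 + c * a4) a5 a6 a7"
    "frame_col \<phi> a1 a2 (c * a3 + s * a4) (- s * a3 + c * a4) (c * a5 - s * a6) (s * a5 + c * a6) a7"
    "frame_col \<phi> a1 a2 (c * a3 - s * a4) (s * a3 + c * a4) (c * a5 + s * a6) (- s * a5 + c * a6) a7"
    "frame_col \<phi> (c * a1 + s * a3) (s * a4 + c * a2) (- s * a1 + c * a3) (c * a4 - s * a2) a5 a6 a7"
    "frame_col \<phi> (c * a1 + s * a5) (s * a6 + c * a2) a3 a4 (- s * a1 + c * a5) (c * a6 - s * a2) a7"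
    "frame_col \<phi> (- s * a7 + c * a1) a2 (s * a6 + c * a3) a4 a5 (c * a6 - s * a3) (c * a7 + s * a1)"
  using frame_col_step[OF assms(1) rot_1234[OF assms(2)]] frame_col_step[OF assms(1) rot_3456[OF assms(2)]]
    frame_col_step[OF assms(1) rot_5634[OF assms(2)]] frame_col_step[OF assms(1) rot_1342[OF assms(2)]]
    frame_col_step[OF assms(1) rot_1562[OF assms(2)]] frame_col_step[OF assms(1) rot_7163[OF assms(2)]]
  by (simp_all add: rotm_def kron_def algebra_simps)

lemma planar_rotation: "\<exists>c s. c * c + s * s = 1 \<and> c * x + s * y = sqrt (x\<^sup>2 + y\<^sup>2) \<and> - s * x + c * y = (0::real)"
proof (cases "x = 0 \<and> y = 0")
  case True then show ?thesis by (intro exI[of _ 1] exI[of _ 0]) simp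
next
  case False
  define r where "r = sqrt (x\<^sup>2 + y\<^sup>2)"
  have r: "r > 0" "r * r = x * x + y * y"
    using False sum_power2_gt_zero_iff[of x y] by (auto simp: r_def) (auto simp: power2_eq_square)
  have "x / r * (x / r) + y / r * (y / r) = (x * x + y * y) / (r * r)" "x / r * x + y / r * y = (x * x + y * y) / r"
    by (simp_all add: add_divide_distrib)
  then have "x / r * (x / r) + y / r * (y / r) = 1" "x / r * x + y / r * y = r"
    using r(1) unfolding r(2)[symmetric] by simp_all
  then show ?thesis unfolding r_def[symmetric] by (intro exI[of _ "x / r"] exI[of _ "y / r"]) simp
qed

definition special_frame :: "form \<Rightarrow> (nat \<Rightarrow> nat \<Rightarrow> real) \<Rightarrow> real \<Rightarrow> bool" where
  "special_frame \<phi> P h \<longleftrightarrow> G2_adapted \<phi> P \<and> h > 0 \<and> (\<forall>i\<in>{1..7}. P i 7 = h * kron 7 i)"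

text \<open>Transitivity of G2 on the sphere, made explicit. The entries 2, 4, 3, 6, 5, 1 are
  cleared in this order; from the third rotation on, the second plane that turns along has both
  entries already zero, so nothing cleared is spoiled.\<close>

lemma special_frame_exists:
  assumes "is_G2_form \<phi>" shows "\<exists>P h. special_frame \<phi> P h"
proof -
  obtain P where "G2_adapted \<phi> P" using assms by (auto simp: is_G2_form_def)
  then have "\<exists>a1 a2 a3 a4 a5 a6 a7. frame_col \<phi> a1 a2 a3 a4 a5 a6 a7" unfolding frame_col_def by blast
  then obtain a1 a2 a3 a4 a5 a6 a7 where "frame_col \<phi> a1 a2 a3 a4 a5 a6 a7" by blast
  then have "\<exists>a1 a3 a4 a5 a6. frame_col \<phi> a1 0 a3 a4 a5 a6 a7"
    using frame_col_rot(1) planar_rotation[of a1 a2] by metis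
  then obtain a1 a3 a4 a5 a6 where "frame_col \<phi> a1 0 a3 a4 a5 a6 a7" by blast
  then have "\<exists>a3 a5 a6. frame_col \<phi> a1 0 a3 0 a5 a6 a7"
    using frame_col_rot(2) planar_rotation[of a3 a4] by metis
  then obtain a3 a5 a6 where 2: "frame_col \<phi> a1 0 a3 0 a5 a6 a7" by blast
  obtain c s where cs: "c * c + s * s = 1" "- s * a1 + c * a3 = 0" using planar_rotation[of a1 a3] by blast
  have "\<exists>a1. frame_col \<phi> a1 0 0 0 a5 a6 a7" using frame_col_rot(4)[OF 2 cs(1)] cs(2) by auto
  then obtain a1 where 3: "frame_col \<phi> a1 0 0 0 a5 a6 a7" by blast
  obtain c s where cs: "c * c + s * s = 1" "- s * a5 + c * a6 = 0" using planar_rotation[of a5 a6] by blast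
  have "\<exists>a5. frame_col \<phi> a1 0 0 0 a5 0 a7" using frame_col_rot(3)[OF 3 cs(1)] cs(2) by auto
  then obtain a5 where 4: "frame_col \<phi> a1 0 0 0 a5 0 a7" by blast
  obtain c s where cs: "c * c + s * s = 1" "- s * a1 + c * a5 = 0" using planar_rotation[of a1 a5] by blast
  have "\<exists>a1. frame_col \<phi> a1 0 0 0 0 0 a7" using frame_col_rot(5)[OF 4 cs(1)] cs(2) by auto
  then obtain a1 where 5: "frame_col \<phi> a1 0 0 0 0 0 a7" by blast
  obtain c s where cs: "c * c + s * s = 1" "c * a7 + s * a1 = sqrt (a7\<^sup>2 + a1\<^sup>2)" "- s * a7 + c * a1 = 0"
    using planar_rotation[of a7 a1] by blast
  have "\<exists>h\<ge>0. frame_col \<phi> 0 0 0 0 0 0 h" using frame_col_rot(6)[OF 5 cs(1)] cs(2,3)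
    by (intro exI[of _ "sqrt (a7\<^sup>2 + a1\<^sup>2)"]) auto
  then obtain h P where h: "h \<ge> 0" "G2_adapted \<phi> P" "P 1 7 = 0" "P 2 7 = 0" "P 3 7 = 0" "P 4 7 = 0" "P 5 7 = 0"
      "P 6 7 = 0" "P 7 7 = h"
    unfolding frame_col_def by blast
  \<comment> \<open>An invertible matrix has no zero column, so the nonnegative h is
    positive.\<close>
  obtain P' where "minv P P'" using h(2) basis_minv unfolding adapted_pull by blast
  then have "mmul P' P 7 7 = 1" by (auto simp: minv_def kron_def)
  then have "h > 0" using h by (auto simp: mmul_list less_le)
  moreover have "\<forall>i\<in>{1..7}. P i 7 = h * kron 7 i"
    unfolding set_list17[symmetric] using h by (simp add: kron_def)
  ultimately show ?thesis using h(2) unfolding special_frame_def by blast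
qed

section \<open>The flow equation on the Heisenberg algebra\<close>

definition omega :: form where "omega = form_of [([1,2],1),([3,4],1),([5,6],1)]"

definition rho0 :: form where "rho0 = form_of [([2,4,6],1),([2,3,5],-1),([1,4,5],-1),([1,3,6],-1)]"

lemma homog_omega: "homog 2 omega" unfolding omega_def by (rule homog_form_of) simp_all
lemma homog_rho0: "homog 3 rho0" unfolding rho0_def by (rule homog_form_of) simp_all
lemma supp7_omega: "supp7 omega" using homog_omega by (rule homog_supp7)
lemma supp7_rho0: "supp7 rho0" using homog_rho0 by (rule homog_supp7)

lemma contr7_omega: "contr (kron 7) omega = (\<lambda>K. 0)"
proof (rule homog_eqI[of 1])
  show "homog 1 (contr (kron 7) omega)" using homog_omega by (intro homog_contr) (simp add: numeral_2_eq_2 One_nat_def)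
  show "list_all (\<lambda>ks. coeff (contr (kron 7) omega) ks = coeff (\<lambda>K. 0) ks) (sublists_of_size 1 [1,2,3,4,5,6,7])"
    unfolding sublists_1 by (simp add: coeff_simps omega_def kron_def)
qed (rule homog_zero)

lemma contr7_phi0: "contr (kron 7) phi0 = omega"
proof (rule homog_eqI)
  show "homog 2 (contr (kron 7) phi0)" by (rule homog_contr_phi0)
  show "list_all (\<lambda>ks. coeff (contr (kron 7) phi0) ks = coeff omega ks) (sublists_of_size 2 [1,2,3,4,5,6,7])"
    unfolding sublists_2 by (simp add: coeff_simps phi0_def omega_def kron_def)
qed (rule homog_omega)

lemma contr7_psi0: "contr (kron 7) psi0 = rho0"
proof (rule homog_eqI)
  show "homog 3 (contr (kron 7) psi0)" using homog_psi0 by (intro homog_contr) simp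
  show "list_all (\<lambda>ks. coeff (contr (kron 7) psi0) ks = coeff rho0 ks) (sublists_of_size 3 [1,2,3,4,5,6,7])"
    unfolding sublists_3 by (simp add: coeff_simps psi0_def rho0_def kron_def)
qed (rule homog_rho0)

lemma linear_op_dext: "linear_op dext"
  by (simp add: linear_op_def dext_def fun_eq_iff algebra_simps sum.distrib sum_distrib_left)

text \<open>As only e^7 has a nonzero differential, the Leibniz sum reduces to the term that removes
  7, whose sign is that of the contraction.\<close>

lemma dext_eq:
  assumes a: "supp7 a"
  shows "dext a = (\<lambda>K. sqrt 6 / 6 * wedge omega (contr (kron 7) a) K)"
proof (rule lin_eqI[where a = a])
  show "linear_op (\<lambda>a K. sqrt 6 / 6 * wedge omega (contr (kron 7) a) K)"
    using linear_op_lincomb[OF linear_op_comp[OF linear_op_wedge_right linear_op_contr] linear_op_comp[OF linear_op_wedge_right linear_op_contr], of "sqrt 6 / 6" omega "kron 7" 0]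
    by simp
  fix I :: "nat set" assume I: "I \<subseteq> {1..7}"
  have de7: "de 7 = (\<lambda>K. sqrt 6 / 6 * omega K)"
    by (simp add: de_def omega_def form_of_Cons form_of_Nil fscale_def add.assoc)
  have w7: "wedge (de 7) b = (\<lambda>K. sqrt 6 / 6 * wedge omega b K)" for b
    unfolding de7 by (rule linear_op_scale[OF linear_op_wedge_left])
  have dez: "wedge (de j) b = (\<lambda>K. 0)" if "j \<noteq> 7" for j b
    using that by (simp add: de_def fzero_def linear_op_zero[OF linear_op_wedge_left])
  have "dext (eform I) = (\<lambda>K. \<Sum>J\<in>Pow {1..7}. if J = I then
      \<Sum>j\<in>I. (-1) ^ card {i\<in>I. i < j} * wedge (de j) (eform (I - {j})) K else 0)"
    unfolding dext_def by (intro ext sum.cong refl) (simp add: eform_def)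
  also have "\<dots> = (\<lambda>K. \<Sum>j\<in>I. (-1) ^ card {i\<in>I. i < j} * wedge (de j) (eform (I - {j})) K)"
    using I by (simp add: sum.delta)
  also have "\<dots> = (\<lambda>K. \<Sum>j\<in>I. if j = 7 then sort_sign I 7 * wedge (de 7) (eform (I - {7})) K else 0)"
    by (intro ext sum.cong refl) (simp add: dez sort_sign_def)
  also have "\<dots> = (\<lambda>K. if 7 \<in> I then sqrt 6 / 6 * (sort_sign I 7 * wedge omega (eform (I - {7})) K) else 0)"
    using finite_subset17[OF I] by (simp add: w7 fun_eq_iff)
  also have "\<dots> = (\<lambda>K. sqrt 6 / 6 * wedge omega (contr (kron 7) (eform I)) K)"
  proof -
    have 1: "7 \<notin> K \<and> insert 7 K = I \<longleftrightarrow> 7 \<in> I \<and> K = I - {7::nat}" for K by auto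
    have "contr (kron 7) (eform I) = (\<lambda>K. (if 7 \<in> I then sort_sign I 7 else 0) * eform (I - {7}) K)"
    proof
      fix K
      show "contr (kron 7) (eform I) K = (if 7 \<in> I then sort_sign I 7 else 0) * eform (I - {7}) K"
        using 1[of K] sort_sign_remove[OF finite_subset17[OF I], of 7 7] by (auto simp: contr_kron eform_def)
    qed
    then show ?thesis by (auto simp: linear_op_scale[OF linear_op_wedge_right])
  qed
  finally show "dext (eform I) = (\<lambda>K. sqrt 6 / 6 * wedge omega (contr (kron 7) (eform I)) K)" .
qed (use a linear_op_dext in auto)

lemma homog_dext: "homog k a \<Longrightarrow> homog (Suc k) (dext a)"
proof -
  assume a: "homog k a"
  show ?thesis
  proof (cases k)
    \<comment> \<open>Degree zero is treated apart because \<open>homog_contr\<close> starts from a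
      successor degree.\<close>
    case 0
    have "contr (kron 7) a = (\<lambda>K. 0)"
    proof
      fix K show "contr (kron 7) a K = 0"
      proof (cases "insert 7 K \<subseteq> {1..7}")
        case True
        then have "card (insert 7 K) \<noteq> 0" using finite_subset17 by (metis card_0_eq insert_not_empty)
        then show ?thesis using a 0 by (auto simp: contr_kron intro!: homogD)
      qed (use a in \<open>auto simp: contr_kron intro!: homogD\<close>)
    qed
    then show ?thesis using a by (simp add: dext_eq homog_supp7 linear_op_zero[OF linear_op_wedge_right] homog_zero)
  next
    case (Suc l)
    then have "homog (2 + l) (wedge omega (contr (kron 7) a))" using a by (intro homog_wedge homog_omega homog_contr) simp
    then have "homog (Suc k) (wedge omega (contr (kron 7) a))" using Suc by simp
    then show ?thesis unfolding dext_eq[OF homog_supp7[OF a]] by (rule homog_scale)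
  qed
qed

text \<open>In a special frame e_7 has the single component h, in direction 7, so contraction with
  e_7 commutes with the pullback up to h.\<close>

lemma contr7_pull:
  assumes "special_frame \<phi> P h" "supp7 a"
  shows "contr (kron 7) (pull P a) = (\<lambda>K. h * pull P (contr (kron 7) a) K)"
proof -
  have "contr (vecP P (kron 7)) a = contr (\<lambda>j. h * kron 7 j) a"
    using assms(1) by (intro contr_cong) (simp add: vecP_kron special_frame_def)
  then show ?thesis using assms(2) by (simp add: contr_pull contr_scale linear_op_scale[OF linear_op_pull])
qed

text \<open>The trace of a 2-form with respect to the standard Kaehler form
  \<open>omega\<close>.\<close>

definition ltr :: "form \<Rightarrow> real" where
  "ltr a = coeff a [1,2] + coeff a [3,4] + coeff a [5,6]"

text \<open>Two-forms on the quotient by the centre which are of type (1,1), i.e. annihilate the 3-form.\<close>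

locale form11 =
  fixes \<alpha> :: form
  assumes h2: "homog 2 \<alpha>" and c7: "contr (kron 7) \<alpha> = (\<lambda>K. 0)" and r0: "wedge \<alpha> rho0 = (\<lambda>K. 0)"
begin

lemma no7: "coeff \<alpha> [1,7] = 0" "coeff \<alpha> [2,7] = 0" "coeff \<alpha> [3,7] = 0" "coeff \<alpha> [4,7] = 0" "coeff \<alpha> [5,7] = 0" "coeff \<alpha> [6,7] = 0"
proof -
  have "coeff (contr (kron 7) \<alpha>) [i] = 0" for i by (simp add: c7 coeff_zero)
  from this[of 1] this[of 2] this[of 3] this[of 4] this[of 5] this[of 6]
  show "coeff \<alpha> [1,7] = 0" "coeff \<alpha> [2,7] = 0" "coeff \<alpha> [3,7] = 0" "coeff \<alpha> [4,7] = 0" "coeff \<alpha> [5,7] = 0" "coeff \<alpha> [6,7] = 0"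
    by (simp_all add: coeff_contr_kron)
qed

lemma type11: "coeff \<alpha> [2,4] = coeff \<alpha> [1,3]" "coeff \<alpha> [2,3] = - coeff \<alpha> [1,4]" "coeff \<alpha> [2,6] = coeff \<alpha> [1,5]"
  "coeff \<alpha> [2,5] = - coeff \<alpha> [1,6]" "coeff \<alpha> [4,6] = coeff \<alpha> [3,5]" "coeff \<alpha> [4,5] = - coeff \<alpha> [3,6]"
proof -
  have "coeff (wedge \<alpha> rho0) ks = 0" for ks by (simp add: r0 coeff_zero)
  from this[of "[1,2,3,4,5]"] this[of "[1,2,3,4,6]"] this[of "[1,2,3,5,6]"] this[of "[1,2,4,5,6]"]
    this[of "[1,3,4,5,6]"] this[of "[2,3,4,5,6]"]
  show "coeff \<alpha> [2,4] = coeff \<alpha> [1,3]" "coeff \<alpha> [2,3] = - coeff \<alpha> [1,4]" "coeff \<alpha> [2,6] = coeff \<alpha> [1,5]"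
    "coeff \<alpha> [2,5] = - coeff \<alpha> [1,6]" "coeff \<alpha> [4,6] = coeff \<alpha> [3,5]" "coeff \<alpha> [4,5] = - coeff \<alpha> [3,6]"
    by (simp_all add: coeff_wedge_right rho0_def)
qed

lemma homog_star_alpha_omega: "homog 3 (star (wedge \<alpha> omega))"
  using homog_star[OF homog_wedge[OF h2 homog_omega]] by simp

text \<open>The six-dimensional identity *(a wedge omega) = (tr a) omega - a for (1,1)-forms. Its
  trace part will cancel against the torsion trace, and the other part is the quadratic term of the
  flow.\<close>

lemma contr7_star: "contr (kron 7) (star (wedge \<alpha> omega)) = (\<lambda>K. ltr \<alpha> * omega K - \<alpha> K)"
proof (rule homog_eqI)
  show "homog 2 (contr (kron 7) (star (wedge \<alpha> omega)))"
    using homog_star_alpha_omega by (intro homog_contr) simp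
  show "homog 2 (\<lambda>K. ltr \<alpha> * omega K - \<alpha> K)" by (intro homog_diff homog_scale homog_omega h2)
  show "list_all (\<lambda>ks. coeff (contr (kron 7) (star (wedge \<alpha> omega))) ks = coeff (\<lambda>K. ltr \<alpha> * omega K - \<alpha> K) ks)
      (sublists_of_size 2 [1,2,3,4,5,6,7])"
    unfolding sublists_2 by (simp add: coeff_simps omega_def no7 type11 ltr_def kron_def)
qed

text \<open>The product with \<open>phi0\<close> detects the 7-dimensional component of a 3-form.
  Its absence lets this 3-form split into a multiple of \<open>phi0\<close> and an admissible
  tau_3.\<close>

lemma star_wedge_phi0: "wedge (star (wedge \<alpha> omega)) phi0 = (\<lambda>K. 0)"
proof (rule homog_eqI)
  show "homog 6 (wedge (star (wedge \<alpha> omega)) phi0)"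
    using homog_wedge[OF homog_star_alpha_omega homog_phi0] by simp
  show "list_all (\<lambda>ks. coeff (wedge (star (wedge \<alpha> omega)) phi0) ks = coeff (\<lambda>K. 0) ks) (sublists_of_size 6 [1,2,3,4,5,6,7])"
    unfolding sublists_6 by (simp add: coeff_simps omega_def phi0_def no7 type11)
qed (rule homog_zero)

lemma star_wedge_psi0: "wedge (star (wedge \<alpha> omega)) psi0 = (\<lambda>K. 2 * ltr \<alpha> * vol K)"
proof (rule homog_eqI)
  show "homog 7 (wedge (star (wedge \<alpha> omega)) psi0)"
    using homog_wedge[OF homog_star_alpha_omega homog_psi0] by simp
  show "homog 7 (\<lambda>K. 2 * ltr \<alpha> * vol K)" by (intro homog_scale homog_vol)
  show "list_all (\<lambda>ks. coeff (wedge (star (wedge \<alpha> omega)) psi0) ks = coeff (\<lambda>K. 2 * ltr \<alpha> * vol K) ks) (sublists_of_size 7 [1,2,3,4,5,6,7])"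
    unfolding sublists_7 by (simp add: coeff_simps omega_def psi0_def vol_form_of ltr_def no7 type11)
qed

lemma wedge_wedge_phi0: "wedge (wedge \<alpha> omega) phi0 = (\<lambda>K. 2 * ltr \<alpha> * vol K)"
proof (rule homog_eqI)
  show "homog 7 (wedge (wedge \<alpha> omega) phi0)"
    using homog_wedge[OF homog_wedge[OF h2 homog_omega] homog_phi0] by simp
  show "homog 7 (\<lambda>K. 2 * ltr \<alpha> * vol K)" by (intro homog_scale homog_vol)
  show "list_all (\<lambda>ks. coeff (wedge (wedge \<alpha> omega) phi0) ks = coeff (\<lambda>K. 2 * ltr \<alpha> * vol K) ks) (sublists_of_size 7 [1,2,3,4,5,6,7])"
    unfolding sublists_7 by (simp add: coeff_simps omega_def phi0_def vol_form_of ltr_def no7 type11)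
qed

end

lemma phi0_phi0: "wedge phi0 phi0 = (\<lambda>K. 0)"
proof (rule homog_eqI)
  show "homog 6 (wedge phi0 phi0)" using homog_wedge[OF homog_phi0 homog_phi0] by simp
  show "list_all (\<lambda>ks. coeff (wedge phi0 phi0) ks = coeff (\<lambda>K. 0) ks) (sublists_of_size 6 [1,2,3,4,5,6,7])"
    unfolding sublists_6 by (simp add: coeff_simps phi0_def)
qed (rule homog_zero)

lemma psi0_phi0: "wedge psi0 phi0 = (\<lambda>K. 7 * vol K)"
proof (rule homog_eqI)
  show "homog 7 (wedge psi0 phi0)" using homog_wedge[OF homog_psi0 homog_phi0] by simp
  show "homog 7 (\<lambda>K. 7 * vol K)" by (intro homog_scale homog_vol)
  show "list_all (\<lambda>ks. coeff (wedge psi0 phi0) ks = coeff (\<lambda>K. 7 * vol K) ks) (sublists_of_size 7 [1,2,3,4,5,6,7])"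
    unfolding sublists_7 by (simp add: coeff_simps phi0_def psi0_def vol_form_of)
qed

lemma star_phi0_pairing:
  assumes "homog 3 t" shows "wedge (star t) phi0 = wedge t psi0"
proof (rule homog_eqI)
  show "homog 7 (wedge (star t) phi0)" using homog_wedge[OF homog_star[OF assms] homog_phi0] by simp
  show "homog 7 (wedge t psi0)" using homog_wedge[OF assms homog_psi0] by simp
  show "list_all (\<lambda>ks. coeff (wedge (star t) phi0) ks = coeff (wedge t psi0) ks) (sublists_of_size 7 [1,2,3,4,5,6,7])"
    unfolding sublists_7 by (simp add: coeff_simps phi0_def psi0_def)
qed

lemma star_psi0: "star psi0 = phi0"
  using star_star[OF supp7_phi0] by (simp add: star_phi0)

text \<open>Everything is computed in the special frame, where both d phi and d d^* psi involve only
  the (1,1)-form alpha. The codifferential of d psi vanishes by closedness, and no derivative of h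
  occurs because all forms are left invariant.\<close>

lemma coflow_rhs:
  assumes fr: "special_frame \<phi> P h" and closed: "dext (psi_of \<phi>) = fzero"
  shows "fadd (laplacian \<phi> (psi_of \<phi>)) (fscale 2 (dext (fscale (A - torsion_trace \<phi>) \<phi>))) =
    (\<lambda>K. 2 * A * (sqrt 6 / 6) * wedge omega (contr (kron 7) \<phi>) K - h\<^sup>2 / 6 * wedge omega omega K)"
proof -
  define c where "c = sqrt 6 / (6::real)"
  have cc: "c * c = 1 / 6" by (simp add: c_def)
  have ad: "G2_adapted \<phi> P" and h: "h > 0" using fr by (auto simp: special_frame_def)
  have phi: "\<phi> = pull P phi0" and bP: "is_basis P" using ad by (auto simp: adapted_pull)
  have psi: "psi_of \<phi> = pull P psi0" using ad by (rule psi_of_pull)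
  obtain P' where P': "minv P P'" using bP basis_minv by blast
  \<comment> \<open>\<alpha> lists the coefficients of the fixed form \<open>omega\<close> in the
    frame, so \<open>omega\<close> in later lines plays two roles: unpulled it drives d, and under
    \<open>pull P\<close> it is the Kaehler form of phi.\<close>
  define \<alpha> where "\<alpha> = pull P' omega"
  have pa: "pull P \<alpha> = omega" unfolding \<alpha>_def by (rule pull_minv[OF P' supp7_omega])
  have h2: "homog 2 \<alpha>" unfolding \<alpha>_def by (intro homog_pull homog_omega)
  have sa: "supp7 \<alpha>" using h2 by (rule homog_supp7)
  have dpull: "dext (pull P b) = (\<lambda>K. c * h * pull P (wedge \<alpha> (contr (kron 7) b)) K)" if "supp7 b" for b
    using that by (simp add: dext_eq supp7_pull contr7_pull[OF fr] linear_op_scale[OF linear_op_wedge_right] pull_wedge sa supp7_contr pa c_def mult.assoc)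
  have pz: "b = (\<lambda>K. 0)" if "supp7 b" "(\<lambda>K. h * pull P b K) = (\<lambda>K. 0)" for b
  proof (rule pull_inj[OF bP that(1) supp7_zero])
    have "pull P b K = 0" for K using fun_cong[OF that(2), of K] h by simp
    then show "pull P b = pull P (\<lambda>K. 0)" by (auto simp: linear_op_zero[OF linear_op_pull])
  qed
  have c7: "contr (kron 7) \<alpha> = (\<lambda>K. 0)"
    using contr7_pull[OF fr sa] contr7_omega by (intro pz[OF supp7_contr[OF sa]]) (simp add: pa)
  \<comment> \<open>In the frame, d psi is c h times \<alpha> wedge \<open>rho0\<close>; closedness
    therefore says that \<alpha> is of type (1,1).\<close>
  have r0: "wedge \<alpha> rho0 = (\<lambda>K. 0)"
  proof (rule pz)
    have "(\<lambda>K. c * h * pull P (wedge \<alpha> rho0) K) = (\<lambda>K. 0)"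
      using closed dpull[OF supp7_psi0] by (simp add: psi contr7_psi0 fzero_def)
    then have "c * h * pull P (wedge \<alpha> rho0) K = 0" for K by (rule fun_cong)
    then show "(\<lambda>K. h * pull P (wedge \<alpha> rho0) K) = (\<lambda>K. 0)" by (auto simp: c_def)
  qed (intro supp7_wedge sa supp7_rho0)
  interpret form11 \<alpha> by (rule form11.intro[OF h2 c7 r0])
  define X where "X = star (wedge \<alpha> omega)"
  define L where "L = ltr \<alpha>"
  have sX: "supp7 X" by (simp add: X_def supp7_star)
  have sW: "supp7 (wedge \<alpha> omega)" by (intro supp7_wedge sa supp7_omega)
  have sXW: "star X = wedge \<alpha> omega" unfolding X_def by (rule star_star[OF sW])
  have dphi: "dext \<phi> = (\<lambda>K. c * h * pull P (wedge \<alpha> omega) K)"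
    using dpull[OF supp7_phi0] by (simp add: phi contr7_phi0)
  \<comment> \<open>Wedging d phi with phi kills tau_3 and leaves 2 c h L = 7 tau_0.\<close>
  define r where "r = 2 / 7 * c * h * L"
  have tau: "tau0 \<phi> = r"
    unfolding tau0_def
  proof (rule the_equality)
    define t where "t = (\<lambda>K. c * h * X K - r * phi0 K)"
    have ht: "homog 3 t" unfolding t_def X_def by (intro homog_diff homog_scale homog_star_alpha_omega homog_phi0)
    have st: "supp7 t" using ht by (rule homog_supp7)
    have "dext \<phi> = fadd (fscale r (psi_of \<phi>)) (hodge \<phi> (pull P t))"
      unfolding hodge_pull[OF ad st] dphi psi
      by (simp add: t_def linear_op_diff[OF linear_op_star] linear_op_diff[OF linear_op_pull] linear_op_scale[OF linear_op_star]
        linear_op_scale[OF linear_op_pull] sXW star_phi0 fadd_def fscale_def)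
    moreover have "wedge t phi0 = (\<lambda>K. 0)" unfolding t_def X_def
      by (simp add: linear_op_diff[OF linear_op_wedge_left] linear_op_scale[OF linear_op_wedge_left] star_wedge_phi0 phi0_phi0)
    then have "wedge (pull P t) \<phi> = fzero"
      by (simp add: phi pull_wedge[symmetric] st supp7_phi0 linear_op_zero[OF linear_op_pull] fzero_def)
    moreover have "wedge t psi0 = (\<lambda>K. 0)" unfolding t_def X_def
      by (simp add: linear_op_diff[OF linear_op_wedge_left] linear_op_scale[OF linear_op_wedge_left] star_wedge_psi0 phi0_psi0)
        (simp add: L_def r_def)
    then have "wedge (pull P t) (psi_of \<phi>) = fzero"
      by (simp add: psi pull_wedge[symmetric] st supp7_psi0 linear_op_zero[OF linear_op_pull] fzero_def)
    ultimately show "\<exists>\<tau>3. homog 3 \<tau>3 \<and> dext \<phi> = fadd (fscale r (psi_of \<phi>)) (hodge \<phi> \<tau>3)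
        \<and> wedge \<tau>3 \<phi> = fzero \<and> wedge \<tau>3 (psi_of \<phi>) = fzero"
      using homog_pull[OF ht] by blast
  next
    fix q assume "\<exists>\<tau>3. homog 3 \<tau>3 \<and> dext \<phi> = fadd (fscale q (psi_of \<phi>)) (hodge \<phi> \<tau>3)
        \<and> wedge \<tau>3 \<phi> = fzero \<and> wedge \<tau>3 (psi_of \<phi>) = fzero"
    then obtain u where u: "homog 3 u" "dext \<phi> = fadd (fscale q (psi_of \<phi>)) (hodge \<phi> u)"
       "wedge u (psi_of \<phi>) = fzero" by blast
    define t where "t = pull P' u"
    have ht: "homog 3 t" unfolding t_def by (intro homog_pull u)
    have st: "supp7 t" using ht by (rule homog_supp7)
    have pt: "pull P t = u" unfolding t_def by (rule pull_minv[OF P' homog_supp7[OF u(1)]])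
    have "pull P (wedge t psi0) = (\<lambda>K. 0)" using u(3) by (simp add: pull_wedge st supp7_psi0 pt psi fzero_def)
    then have z: "wedge t psi0 = (\<lambda>K. 0)" by (intro pz[OF supp7_wedge[OF st supp7_psi0]]) simp
    have eq: "pull P (\<lambda>K. c * h * wedge \<alpha> omega K) = pull P (\<lambda>K. q * psi0 K + star t K)"
      using u(2) unfolding pt[symmetric] hodge_pull[OF ad st] dphi psi
      by (simp add: linear_op_add[OF linear_op_pull] linear_op_scale[OF linear_op_pull] fadd_def fscale_def)
    have "(\<lambda>K. c * h * wedge \<alpha> omega K) = (\<lambda>K. q * psi0 K + star t K)"
      by (rule pull_inj[OF bP _ _ eq]) (intro supp7_scale supp7_add sW supp7_psi0 supp7_star)+
    \<comment> \<open>For uniqueness of tau_0, the term of tau_3 disappears here because star t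
      wedge \<open>phi0\<close> equals t wedge \<open>psi0\<close>, which is zero.\<close>
    then have "wedge (\<lambda>K. c * h * wedge \<alpha> omega K) phi0 = wedge (\<lambda>K. q * psi0 K + star t K) phi0" by simp
    then have "(\<lambda>K. c * h * (2 * L * vol K)) = (\<lambda>K. q * (7 * vol K))"
      by (simp add: linear_op_add[OF linear_op_wedge_left] linear_op_scale[OF linear_op_wedge_left] wedge_wedge_phi0 psi0_phi0
         star_phi0_pairing[OF ht] z L_def)
    then have "c * h * (2 * L * vol {1..7}) = q * (7 * vol {1..7})" by (rule fun_cong)
    then show "q = r" by (simp add: r_def vol_def eform_def)
  qed
  have tt: "torsion_trace \<phi> = c * h * L / 2" by (simp add: torsion_trace_def tau r_def)
  have ww: "wedge omega omega = pull P (wedge \<alpha> \<alpha>)" by (simp add: pull_wedge sa pa)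
  have wp: "wedge omega (contr (kron 7) \<phi>) = (\<lambda>K. h * pull P (wedge \<alpha> omega) K)"
    by (simp add: phi contr7_pull[OF fr supp7_phi0] contr7_phi0 linear_op_scale[OF linear_op_wedge_right] pull_wedge sa supp7_omega pa)
  have par4: "(\<lambda>I. (- 1) ^ card I * psi_of \<phi> I) = psi_of \<phi>"
    using par_homog[OF homog_pull[OF homog_psi0], of P] by (simp add: psi par_def)
  have cod: "codiff \<phi> (psi_of \<phi>) = (\<lambda>K. c * h * pull P X K)"
    unfolding codiff_def par4 unfolding psi hodge_pull[OF ad supp7_psi0] star_psi0 phi[symmetric] dphi
    using hodge_pull[OF ad supp7_scale[OF sW], of "c * h"]
    by (simp add: linear_op_scale[OF linear_op_pull] linear_op_scale[OF linear_op_star] X_def)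
  have zz: "codiff \<phi> fzero = (\<lambda>K. 0)"
    using hodge_pull[OF ad supp7_zero] linear_op_zero[OF linear_op_dext]
    by (simp add: codiff_def fzero_def linear_op_zero[OF linear_op_pull] linear_op_zero[OF linear_op_star])
  have "dext (codiff \<phi> (psi_of \<phi>)) = (\<lambda>K. c * h * (c * h * pull P (wedge \<alpha> (contr (kron 7) X)) K))"
    unfolding cod linear_op_scale[OF linear_op_dext] dpull[OF sX] by simp
  also have "contr (kron 7) X = (\<lambda>K. L * omega K - \<alpha> K)" unfolding X_def L_def by (rule contr7_star)
  also have "pull P (wedge \<alpha> (\<lambda>K. L * omega K - \<alpha> K)) =
      (\<lambda>K. L * pull P (wedge \<alpha> omega) K - wedge omega omega K)"
    by (simp add: linear_op_diff[OF linear_op_wedge_right] linear_op_scale[OF linear_op_wedge_right] linear_op_diff[OF linear_op_pull]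
       linear_op_scale[OF linear_op_pull] ww)
  finally have lap: "laplacian \<phi> (psi_of \<phi>) =
      (\<lambda>K. c * h * (c * h * (L * pull P (wedge \<alpha> omega) K - wedge omega omega K)))"
    by (simp add: laplacian_def closed zz fadd_def)
  have d2: "dext (fscale (A - torsion_trace \<phi>) \<phi>) = (\<lambda>K. (A - c * h * L / 2) * (c * h * pull P (wedge \<alpha> omega) K))"
    unfolding fscale_def linear_op_scale[OF linear_op_dext] dphi tt by simp
  have hc: "h\<^sup>2 / 6 = c * h * (c * h)" using cc by (simp add: power2_eq_square algebra_simps)
  \<comment> \<open>The flow doubles the trace c h L / 2, and the resulting multiple of L cancels
    the one in the Laplacian.\<close>
  show ?thesis unfolding lap d2 wp hc c_def[symmetric]
    by (simp add: fadd_def fscale_def fun_eq_iff algebra_simps)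
qed

section \<open>The diagonal solution\<close>

text \<open>The negative entries at 4 and 6 turn the signs of \<open>phi0\<close> into those of
  \<open>phi2\<close>; the last entry 1 / (y z^2) is the value h of this special frame.\<close>

definition diag_frame :: "real \<Rightarrow> real \<Rightarrow> nat \<Rightarrow> nat \<Rightarrow> real" where
  "diag_frame y z i j = (if i \<noteq> j then 0 else if i \<le> 2 then y else if i = 3 \<or> i = 5 then z
     else if i = 4 \<or> i = 6 then - z else 1 / (y * z\<^sup>2))"

text \<open>The four terms containing e^7 do not depend on y and z, in accordance with the constancy
  of the contraction of psi with e_7.\<close>

definition psi_yz :: "real \<Rightarrow> real \<Rightarrow> form" where
  "psi_yz y z = form_of [([3,4,5,6], z ^ 4), ([1,2,5,6], - (y\<^sup>2 * z\<^sup>2)), ([1,2,3,4], - (y\<^sup>2 * z\<^sup>2)),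
     ([2,4,6,7], -1), ([2,3,5,7], 1), ([1,4,5,7], -1), ([1,3,6,7], -1)]"

lemma phi_yz_form_of: "phi_yz y z = form_of [([1,2,7], y / z\<^sup>2), ([3,4,7], - inverse y), ([5,6,7], - inverse y),
     ([1,3,5], y * z\<^sup>2), ([1,4,6], - (y * z\<^sup>2)), ([2,3,6], y * z\<^sup>2), ([2,4,5], y * z\<^sup>2)]"
  by (simp add: phi_yz_def form_of_Cons form_of_Nil fun_eq_iff algebra_simps)

lemma phi2_eq_phi_yz: "phi2 = phi_yz 1 1"
  by (simp add: phi2_def phi_yz_def fun_eq_iff)

lemma homog_phi_yz: "homog 3 (phi_yz y z)" unfolding phi_yz_form_of by (rule homog_form_of) simp_all
lemma homog_psi_yz: "homog 4 (psi_yz y z)" unfolding psi_yz_def by (rule homog_form_of) simp_all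

lemma xform_diag:
  assumes "I \<subseteq> {1..7}" "\<And>i j. i \<in> {1..7} \<Longrightarrow> P i j = d i * kron i j"
  shows "xform P I = (\<lambda>K. (\<Prod>i\<in>I. d i) * eform I K)"
proof -
  have "finite I" using assms(1) by (rule finite_subset17)
  then show ?thesis using assms(1)
  proof (induction I rule: finite_linorder_min_induct)
    case empty
    then show ?case by (simp add: xform_empty)
  next
    case (insert m I)
    then have m: "m \<in> {1..7}" "m \<notin> I" and I: "I \<subseteq> {1..7}" by auto
    have "P m = (\<lambda>j. d m * kron m j)" using assms(2)[OF m(1)] by auto
    moreover have "lmul (kron m) (eform I) = eform (insert m I)"
      using insert m by (intro lmul_kron_eform_min) auto
    ultimately show ?case using insert m I
      by (simp add: xform_insert_min lmul_scale linear_op_scale[OF linear_op_lmul] mult.assoc)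
  qed
qed

lemma xform_diag_frame:
  "I \<subseteq> {1..7} \<Longrightarrow> xform (diag_frame y z) I = (\<lambda>K. (\<Prod>i\<in>I. diag_frame y z i i) * eform I K)"
  by (rule xform_diag) (auto simp: diag_frame_def kron_def)

lemma pull_psi0: "pull P psi0 = (\<lambda>K. xform P {3,4,5,6} K + (xform P {1,2,5,6} K + (xform P {1,2,3,4} K
      + (- xform P {2,4,6,7} K + (xform P {2,3,5,7} K + (xform P {1,4,5,7} K + xform P {1,3,6,7} K))))))"
  unfolding psi0_def by (subst pull_form_of) simp_all

lemma diag_frame_minv:
  assumes "y \<noteq> 0" "z \<noteq> 0"
  shows "minv (diag_frame y z) (\<lambda>i j. if i = j then 1 / diag_frame y z i i else 0)"
  unfolding minv_def set_list17[symmetric] using assms by (simp add: mmul_list diag_frame_def kron_def)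

lemma diag_frame_phi:
  assumes "y \<noteq> 0" "z \<noteq> 0" shows "pull (diag_frame y z) phi0 = phi_yz y z"
  unfolding pull_phi0 phi_yz_form_of form_of_Cons form_of_Nil using assms
  by (simp add: xform_diag_frame diag_frame_def power2_eq_square inverse_eq_divide fun_eq_iff)

lemma diag_frame_psi:
  assumes "y \<noteq> 0" "z \<noteq> 0" shows "pull (diag_frame y z) psi0 = psi_yz y z"
  unfolding pull_psi0 psi_yz_def form_of_Cons form_of_Nil using assms
  by (simp add: xform_diag_frame diag_frame_def power2_eq_square power4_eq_xxxx mult.assoc)

lemma diag_frame_special:
  assumes "y > 0" "z > 0" shows "special_frame (phi_yz y z) (diag_frame y z) (1 / (y * z\<^sup>2))"
proof -
  have "is_basis (diag_frame y z)" using assms by (intro minv_basis[OF diag_frame_minv]) auto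
  moreover have "diag_frame y z i 7 = 1 / (y * z\<^sup>2) * kron 7 i" for i
    by (simp add: diag_frame_def kron_def)
  ultimately show ?thesis using assms diag_frame_phi[of y z] by (simp add: special_frame_def adapted_pull)
qed

lemma psi_of_yz: "y > 0 \<Longrightarrow> z > 0 \<Longrightarrow> psi_of (phi_yz y z) = psi_yz y z"
  using psi_of_pull[of "phi_yz y z" "diag_frame y z"] diag_frame_special[of y z] diag_frame_psi[of y z]
  by (simp add: special_frame_def)

lemma closed_psi_yz: "dext (psi_yz y z) = fzero"
proof -
  have "dext (psi_yz y z) = (\<lambda>K. 0)"
  proof (rule homog_eqI)
    show "homog 5 (dext (psi_yz y z))" using homog_dext[OF homog_psi_yz] by simp
    show "list_all (\<lambda>ks. coeff (dext (psi_yz y z)) ks = coeff (\<lambda>K. 0) ks) (sublists_of_size 5 [1,2,3,4,5,6,7])"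
      unfolding sublists_5 dext_eq[OF homog_supp7[OF homog_psi_yz]]
      by (simp add: coeff_simps coeff_div omega_def psi_yz_def kron_def)
  qed (rule homog_zero)
  then show ?thesis by (simp add: fzero_def)
qed

lemma flow_rhs_yz:
  assumes "y > 0" "z > 0"
  shows "fadd (laplacian (phi_yz y z) (psi_of (phi_yz y z)))
      (fscale 2 (dext (fscale (A - torsion_trace (phi_yz y z)) (phi_yz y z)))) =
    (\<lambda>K. - (4 * A * sqrt 6 / (6 * y) + 1 / (3 * y\<^sup>2 * z ^ 4)) * form_of [([3,4,5,6], 1)] K +
      (2 * A * sqrt 6 / 6 * (y / z\<^sup>2 - 1 / y) - 1 / (3 * y\<^sup>2 * z ^ 4)) * form_of [([1,2,5,6], 1), ([1,2,3,4], 1)] K)"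
    (is "?L = ?R")
proof -
  have L: "?L = (\<lambda>K. 2 * A * (sqrt 6 / 6) * wedge omega (contr (kron 7) (phi_yz y z)) K
      - (1 / (y * z\<^sup>2))\<^sup>2 / 6 * wedge omega omega K)"
    using assms by (intro coflow_rhs[OF diag_frame_special]) (simp_all add: psi_of_yz closed_psi_yz)
  have hc: "homog 2 (contr (kron 7) (phi_yz y z))" using homog_phi_yz by (intro homog_contr) simp
  have f: "homog 4 (form_of [([3,4,5,6], 1)])" "homog 4 (form_of [([1,2,5,6], 1), ([1,2,3,4], 1)])"
    by (rule homog_form_of; simp)+
  show ?thesis unfolding L
  proof (rule homog_eqI)
    show "homog 4 (\<lambda>K. 2 * A * (sqrt 6 / 6) * wedge omega (contr (kron 7) (phi_yz y z)) K
      - (1 / (y * z\<^sup>2))\<^sup>2 / 6 * wedge omega omega K)"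
      using homog_wedge[OF homog_omega hc] homog_wedge[OF homog_omega homog_omega]
      by (intro homog_diff homog_scale) simp_all
    show "homog 4 ?R" by (intro homog_add homog_scale f)
    show "list_all (\<lambda>ks. coeff (\<lambda>K. 2 * A * (sqrt 6 / 6) * wedge omega (contr (kron 7) (phi_yz y z)) K
      - (1 / (y * z\<^sup>2))\<^sup>2 / 6 * wedge omega omega K) ks = coeff ?R ks) (sublists_of_size 4 [1,2,3,4,5,6,7])"
      unfolding sublists_4 phi_yz_form_of using assms
      by (simp add: coeff_simps coeff_div omega_def kron_def) (simp add: field_simps power2_eq_square power4_eq_xxxx)
  qed
qed

lemma psi_yz_split: "psi_yz y z = (\<lambda>K. z ^ 4 * form_of [([3,4,5,6], 1)] K
   - y\<^sup>2 * z\<^sup>2 * form_of [([1,2,5,6], 1), ([1,2,3,4], 1)] K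
   + form_of [([2,4,6,7], -1), ([2,3,5,7], 1), ([1,4,5,7], -1), ([1,3,6,7], -1)] K)"
  by (simp add: psi_yz_def form_of_Cons form_of_Nil fun_eq_iff algebra_simps)

lemma coflow_yz:
  assumes J: "is_interval J" "open J" "0 \<in> J" and init: "y 0 = 1" "z 0 = 1"
    and pos: "\<And>t. t \<in> J \<Longrightarrow> y t > 0" "\<And>t. t \<in> J \<Longrightarrow> z t > 0"
    and dy: "\<And>t. t \<in> J \<Longrightarrow> (y has_real_derivative
          (2 * A * sqrt 6 * y t * z t ^ 6 + 2 * z t ^ 2 + y t ^ 2) / (12 * y t ^ 3 * z t ^ 8)) (at t)"
    and dz: "\<And>t. t \<in> J \<Longrightarrow> (z has_real_derivative
          - ((2 * A * sqrt 6 * y t * z t ^ 4 + 1) / (12 * y t ^ 2 * z t ^ 7))) (at t)"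
  shows "coflow_solution A J (\<lambda>t. phi_yz (y t) (z t))"
  unfolding coflow_solution_def
proof (intro conjI ballI allI)
  show "phi_yz (y 0) (z 0) = phi2" by (simp add: init phi2_eq_phi_yz)
  fix I
  have cy: "continuous_on J y" "continuous_on J z"
    using dy dz by (meson DERIV_isCont continuous_at_imp_continuous_on)+
  show "continuous_on J (\<lambda>t. phi_yz (y t) (z t) I)"
    unfolding phi_yz_def by (intro continuous_intros cy) (use pos in force)+
  fix t assume t: "t \<in> J"
  show "is_G2_form (phi_yz (y t) (z t))"
    using diag_frame_special[OF pos[OF t]] unfolding special_frame_def is_G2_form_def by blast
  show "dext (psi_of (phi_yz (y t) (z t))) = fzero"
    using pos[OF t] by (simp add: psi_of_yz closed_psi_yz)
  let ?E = "form_of [([3,4,5,6], 1)] I" and ?F = "form_of [([1,2,5,6], 1), ([1,2,3,4], 1)] I"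
  let ?y = "y t" and ?z = "z t"
  define y' where "y' = (2 * A * sqrt 6 * ?y * ?z ^ 6 + 2 * ?z ^ 2 + ?y ^ 2) / (12 * ?y ^ 3 * ?z ^ 8)"
  define z' where "z' = - ((2 * A * sqrt 6 * ?y * ?z ^ 4 + 1) / (12 * ?y ^ 2 * ?z ^ 7))"
  have d: "(y has_real_derivative y') (at t)" "(z has_real_derivative z') (at t)"
    unfolding y'_def z'_def using dy[OF t] dz[OF t] by auto
  have D0: "((\<lambda>s. psi_yz (y s) (z s) I) has_real_derivative
      4 * ?z ^ 3 * z' * ?E - (2 * ?y * y' * ?z\<^sup>2 + ?y\<^sup>2 * (2 * ?z * z')) * ?F) (at t)"
    unfolding psi_yz_split by (auto intro!: derivative_eq_intros d simp: algebra_simps)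
  \<comment> \<open>Writing even powers of z through q keeps the rational identities small enough
    for \<open>field_simps\<close>.\<close>
  define q where "q = ?z\<^sup>2"
  have zq: "?z ^ 2 = q" "?z ^ 3 = ?z * q" "?z ^ 4 = q * q" "?z ^ 6 = q * q * q" "?z ^ 7 = ?z * q * q * q"
      "?z ^ 8 = q * q * q * q" "?y ^ 2 = ?y * ?y" "?y ^ 3 = ?y * ?y * ?y"
    by (simp_all add: q_def power_numeral_reduce)
  have q0: "q > 0" "?y > 0" "?z > 0" using pos[OF t] by (simp_all add: q_def)
  \<comment> \<open>The flow has two independent components, the equations for z^4 and for - y^2
    z^2; the two differential equations give exactly these.\<close>
  have m1: "4 * ?z ^ 3 * z' = - (4 * A * sqrt 6 / (6 * ?y) + 1 / (3 * ?y\<^sup>2 * ?z ^ 4))"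
    using q0 unfolding z'_def zq by (simp add: field_simps)
  have m2: "- (2 * ?y * y' * ?z\<^sup>2 + ?y\<^sup>2 * (2 * ?z * z')) =
      2 * A * sqrt 6 / 6 * (?y / ?z\<^sup>2 - 1 / ?y) - 1 / (3 * ?y\<^sup>2 * ?z ^ 4)"
    using q0 unfolding y'_def z'_def zq by (simp add: field_simps)
  have e: "4 * ?z ^ 3 * z' * ?E - (2 * ?y * y' * ?z\<^sup>2 + ?y\<^sup>2 * (2 * ?z * z')) * ?F =
      - (4 * A * sqrt 6 / (6 * ?y) + 1 / (3 * ?y\<^sup>2 * ?z ^ 4)) * ?E +
      (2 * A * sqrt 6 / 6 * (?y / ?z\<^sup>2 - 1 / ?y) - 1 / (3 * ?y\<^sup>2 * ?z ^ 4)) * ?F"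
    unfolding m1[symmetric] m2[symmetric] by (simp add: left_diff_distrib distrib_right)
  have D: "((\<lambda>s. psi_yz (y s) (z s) I) has_real_derivative
      - (4 * A * sqrt 6 / (6 * ?y) + 1 / (3 * ?y\<^sup>2 * ?z ^ 4)) * ?E +
      (2 * A * sqrt 6 / 6 * (?y / ?z\<^sup>2 - 1 / ?y) - 1 / (3 * ?y\<^sup>2 * ?z ^ 4)) * ?F) (at t)"
    using D0 unfolding e .
  \<comment> \<open>The explicit formula for psi holds only while y and z are positive, so it
    replaces \<open>psi_of\<close> locally on the open set J.\<close>
  show "((\<lambda>s. psi_of (phi_yz (y s) (z s)) I) has_real_derivative
      fadd (laplacian (phi_yz ?y ?z) (psi_of (phi_yz ?y ?z)))
        (fscale 2 (dext (fscale (A - torsion_trace (phi_yz ?y ?z)) (phi_yz ?y ?z)))) I) (at t)"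
    unfolding flow_rhs_yz[OF pos[OF t]]
    by (rule has_field_derivative_transform_within_open[OF D J(2) t]) (simp add: psi_of_yz pos)
qed (use J in auto)

section \<open>Structure of the solutions\<close>

text \<open>The contraction of the initial 4-form with e_7. Below, \<open>rhohat\<close> and
  \<open>rho1\<close> are the parts without e^7 of \<open>phi2\<close> and
  \<open>phi0\<close>.\<close>

definition rhoe :: form where "rhoe = form_of [([2,4,6],1),([2,3,5],-1),([1,4,5],1),([1,3,6],1)]"
definition rhohat :: form where "rhohat = form_of [([1,3,5],1),([1,4,6],-1),([2,3,6],1),([2,4,5],1)]"
definition rho1 :: form where "rho1 = form_of [([1,3,5],1),([1,4,6],-1),([2,3,6],-1),([2,4,5],-1)]"
definition vol6 :: form where "vol6 = form_of [([1,2,3,4,5,6],1)]"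

lemma homog_rhoe: "homog 3 rhoe" unfolding rhoe_def by (rule homog_form_of) simp_all
lemma homog_rhohat: "homog 3 rhohat" unfolding rhohat_def by (rule homog_form_of) simp_all
lemma homog_rho1: "homog 3 rho1" unfolding rho1_def by (rule homog_form_of) simp_all
lemma homog_vol6: "homog 6 vol6" unfolding vol6_def by (rule homog_form_of) simp_all
lemma supp7_vol6: "supp7 vol6" using homog_vol6 by (rule homog_supp7)

lemma contr_vol6:
  assumes "b 1 = 0" "b 2 = 0" "b 3 = 0" "b 4 = 0" "b 5 = 0" "b 6 = 0"
  shows "contr b vol6 = (\<lambda>K. 0)"
proof (rule homog_eqI[of 5])
  show "homog 5 (contr b vol6)" using homog_vol6 by (intro homog_contr) simp
  show "list_all (\<lambda>ks. coeff (contr b vol6) ks = coeff (\<lambda>K. 0) ks) (sublists_of_size 5 [1,2,3,4,5,6,7])"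
    unfolding sublists_5 using assms by (simp add: coeff_simps vol6_def)
qed (rule homog_zero)

text \<open>Hitchin's construction: a stable 3-form on a 6-dimensional space determines a complex structure,
  here recorded through the bilinear form \<open>(a, b) \<mapsto> a \<and> \<rho> \<and> \<iota>\<^sub>b \<rho>\<close>.\<close>

lemma hitchin_rho0:
  assumes "a 7 = 0"
  shows "lmul a (wedge rho0 (contr b rho0)) =
    (\<lambda>K. 2 * (a 1 * b 2 - a 2 * b 1 + a 3 * b 4 - a 4 * b 3 + a 5 * b 6 - a 6 * b 5) * vol6 K)"
proof (rule homog_eqI[of 6])
  have "homog 2 (contr b rho0)" using homog_rho0 by (intro homog_contr) simp
  then show "homog 6 (lmul a (wedge rho0 (contr b rho0)))"
    using homog_lmul[OF homog_wedge[OF homog_rho0, of 2 "contr b rho0"]] by simp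
  show "list_all (\<lambda>ks. coeff (lmul a (wedge rho0 (contr b rho0))) ks = coeff (\<lambda>K. 2 * (a 1 * b 2 - a 2 * b 1
      + a 3 * b 4 - a 4 * b 3 + a 5 * b 6 - a 6 * b 5) * vol6 K) ks) (sublists_of_size 6 [1,2,3,4,5,6,7])"
    unfolding sublists_6 using assms by (simp add: coeff_simps rho0_def vol6_def)
qed (intro homog_scale homog_vol6)

lemma hitchin_rhoe:
  assumes "a 7 = 0"
  shows "lmul a (wedge rhoe (contr b rhoe)) =
    (\<lambda>K. 2 * (a 1 * b 2 - a 2 * b 1 - a 3 * b 4 + a 4 * b 3 - a 5 * b 6 + a 6 * b 5) * vol6 K)"
proof (rule homog_eqI[of 6])
  have "homog 2 (contr b rhoe)" using homog_rhoe by (intro homog_contr) simp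
  then show "homog 6 (lmul a (wedge rhoe (contr b rhoe)))"
    using homog_lmul[OF homog_wedge[OF homog_rhoe, of 2 "contr b rhoe"]] by simp
  show "list_all (\<lambda>ks. coeff (lmul a (wedge rhoe (contr b rhoe))) ks = coeff (\<lambda>K. 2 * (a 1 * b 2 - a 2 * b 1
      - a 3 * b 4 + a 4 * b 3 - a 5 * b 6 + a 6 * b 5) * vol6 K) ks) (sublists_of_size 6 [1,2,3,4,5,6,7])"
    unfolding sublists_6 using assms by (simp add: coeff_simps rhoe_def vol6_def)
qed (intro homog_scale homog_vol6)

text \<open>What is known about an arbitrary solution at a single time, once the contraction of psi
  with e_7 has been shown constant.\<close>

locale fixed_rho =
  fixes \<phi> P h
  assumes fr: "special_frame \<phi> P h" and rho: "contr (kron 7) (psi_of \<phi>) = rhoe"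
begin

lemma hpos: "h > 0" using fr by (simp add: special_frame_def)
lemma ad: "G2_adapted \<phi> P" using fr by (simp add: special_frame_def)
lemma basis: "is_basis P" using ad by (simp add: adapted_pull)
lemma phi: "\<phi> = pull P phi0" using ad by (simp add: adapted_pull)
lemma psi: "psi_of \<phi> = pull P psi0" using ad by (rule psi_of_pull)

lemma col7: "P 1 7 = 0" "P 2 7 = 0" "P 3 7 = 0" "P 4 7 = 0" "P 5 7 = 0" "P 6 7 = 0" "P 7 7 = h"
  using fr by (auto simp: special_frame_def kron_def)

lemma hrho: "rhoe = (\<lambda>K. h * pull P rho0 K)"
  using contr7_pull[OF fr supp7_psi0] rho by (simp add: psi contr7_psi0)

definition D where "D = coeff (pull P vol6) [1,2,3,4,5,6]"

lemma pull_vol6: "pull P vol6 = (\<lambda>K. D * vol6 K)"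
proof (rule homog_eqI)
  show "homog 6 (pull P vol6)" by (intro homog_pull homog_vol6)
  show "homog 6 (\<lambda>K. D * vol6 K)" by (intro homog_scale homog_vol6)
  have "contr (kron 7) (pull P vol6) = (\<lambda>K. 0)"
    by (simp add: contr7_pull[OF fr supp7_vol6] contr_vol6 kron_def linear_op_zero[OF linear_op_pull])
  then have z: "coeff (contr (kron 7) (pull P vol6)) ks = 0" for ks by (simp add: coeff_zero)
  show "list_all (\<lambda>ks. coeff (pull P vol6) ks = coeff (\<lambda>K. D * vol6 K) ks) (sublists_of_size 6 [1,2,3,4,5,6,7])"
    unfolding sublists_6 using z[of "[1,2,3,4,5]"] z[of "[1,2,3,4,6]"] z[of "[1,2,3,5,6]"] z[of "[1,2,4,5,6]"]
      z[of "[1,3,4,5,6]"] z[of "[2,3,4,5,6]"]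
    by (simp add: D_def coeff_contr_kron) (simp add: coeff_simps vol6_def)
qed

lemma D0: "D \<noteq> 0"
proof
  assume "D = 0"
  then have "pull P vol6 = pull P (\<lambda>K. 0)" by (simp add: pull_vol6 linear_op_zero[OF linear_op_pull])
  then have "vol6 = (\<lambda>K. 0)" by (intro pull_inj[OF basis supp7_vol6 supp7_zero])
  then have "coeff vol6 [1,2,3,4,5,6] = coeff (\<lambda>K. 0) [1,2,3,4,5,6]" by (rule arg_cong)
  then show False by (simp add: vol6_def coeff_form_of coeff_zero)
qed

text \<open>Hitchin's bilinear form is natural under pullback. Evaluate it on a = x^i and b = e_j,
  once for \<open>rhoe\<close> and once for h times the pulled back \<open>rho0\<close>, and compare
  the multiples of \<open>vol6\<close>.\<close>

lemma hitchin:
  assumes i: "i \<in> {1..6}" and j: "j \<in> {1..7}"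
  shows "P i 1 * kron j 2 - P i 2 * kron j 1 - P i 3 * kron j 4 + P i 4 * kron j 3 - P i 5 * kron j 6 + P i 6 * kron j 5
    = h\<^sup>2 * D * (kron i 1 * P 2 j - kron i 2 * P 1 j + kron i 3 * P 4 j - kron i 4 * P 3 j + kron i 5 * P 6 j - kron i 6 * P 5 j)"
proof -
  have i7: "P i 7 = 0" "kron i 7 = 0" using i fr by (auto simp: special_frame_def kron_def)
  let ?b = "vecP P (kron j)"
  have sc: "supp7 (contr b rho0)" for b by (intro supp7_contr supp7_rho0)
  have "lmul (P i) (wedge rhoe (contr (kron j) rhoe)) =
      (\<lambda>K. h * (h * lmul (P i) (wedge (pull P rho0) (contr (kron j) (pull P rho0))) K))"
    by (simp add: hrho linear_op_scale[OF linear_op_wedge_left] linear_op_scale[OF linear_op_wedge_right] linear_op_scale[OF linear_op_contr]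
       linear_op_scale[OF linear_op_lmul])
  also have "lmul (P i) (wedge (pull P rho0) (contr (kron j) (pull P rho0))) =
      pull P (lmul (kron i) (wedge rho0 (contr ?b rho0)))"
    using i by (simp add: contr_pull supp7_rho0 pull_wedge[symmetric] sc pull_lmul_kron supp7_wedge)
  also have "\<dots> = (\<lambda>K. 2 * (kron i 1 * ?b 2 - kron i 2 * ?b 1 + kron i 3 * ?b 4 - kron i 4 * ?b 3 + kron i 5 * ?b 6
      - kron i 6 * ?b 5) * (D * vol6 K))"
    by (simp add: hitchin_rho0[where a = "kron i", OF i7(2)] linear_op_scale[OF linear_op_pull] pull_vol6)
  finally have eq: "(\<lambda>K. 2 * (P i 1 * kron j 2 - P i 2 * kron j 1 - P i 3 * kron j 4 + P i 4 * kron j 3 - P i 5 * kron j 6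
        + P i 6 * kron j 5) * vol6 K) =
    (\<lambda>K. h * (h * (2 * (kron i 1 * ?b 2 - kron i 2 * ?b 1 + kron i 3 * ?b 4 - kron i 4 * ?b 3 + kron i 5 * ?b 6
      - kron i 6 * ?b 5) * (D * vol6 K))))"
    by (simp only: hitchin_rhoe[of "P i", OF i7(1)])
  have v: "vol6 (set [1,2,3,4,5,6]) = 1" using coeff_form_of[of "[([1,2,3,4,5,6],1)]" "[1,2,3,4,5,6]"]
    by (simp add: coeff_def vol6_def)
  show ?thesis
    using fun_cong[OF eq, of "set [1,2,3,4,5,6]"] unfolding v vecP_kron[OF j]
    by (simp add: power2_eq_square algebra_simps)
qed

definition s where "s = h\<^sup>2 * D"

text \<open>Cauchy-Riemann equations for the 6 by 6 block of P: up to the factor s it intertwines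
  the complex structures of \<open>rhoe\<close> and \<open>rho0\<close>.\<close>

lemma cr_raw:
  "P 1 1 = s * P 2 2" "P 1 2 = - s * P 2 1" "P 1 3 = - s * P 2 4" "P 1 4 = s * P 2 3" "P 1 5 = - s * P 2 6" "P 1 6 = s * P 2 5"
  "P 2 1 = - s * P 1 2" "P 2 2 = s * P 1 1" "P 2 3 = s * P 1 4" "P 2 4 = - s * P 1 3" "P 2 5 = s * P 1 6" "P 2 6 = - s * P 1 5"
  "P 3 1 = s * P 4 2" "P 3 2 = - s * P 4 1" "P 3 3 = - s * P 4 4" "P 3 4 = s * P 4 3" "P 3 5 = - s * P 4 6" "P 3 6 = s * P 4 5"
  "P 4 1 = - s * P 3 2" "P 4 2 = s * P 3 1" "P 4 3 = s * P 3 4" "P 4 4 = - s * P 3 3" "P 4 5 = s * P 3 6" "P 4 6 = - s * P 3 5"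
  "P 5 1 = s * P 6 2" "P 5 2 = - s * P 6 1" "P 5 3 = - s * P 6 4" "P 5 4 = s * P 6 3" "P 5 5 = - s * P 6 6" "P 5 6 = s * P 6 5"
  "P 6 1 = - s * P 5 2" "P 6 2 = s * P 5 1" "P 6 3 = s * P 5 4" "P 6 4 = - s * P 5 3" "P 6 5 = s * P 5 6" "P 6 6 = - s * P 5 5"
proof -
  note H = hitchin[folded s_def]
  have n: "1 \<in> {1..7::nat}" "2 \<in> {1..7::nat}" "3 \<in> {1..7::nat}" "4 \<in> {1..7::nat}" "5 \<in> {1..7::nat}" "6 \<in> {1..7::nat}"
    by simp_all
  have m: "1 \<in> {1..6::nat}" "2 \<in> {1..6::nat}" "3 \<in> {1..6::nat}" "4 \<in> {1..6::nat}" "5 \<in> {1..6::nat}" "6 \<in> {1..6::nat}"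
    by simp_all
  have H1: "\<And>j. j \<in> {1..7} \<Longrightarrow> P 1 1 * kron j 2 - P 1 2 * kron j 1 - P 1 3 * kron j 4 + P 1 4 * kron j 3 - P 1 5 * kron j 6 + P 1 6 * kron j 5 = s * P 2 j"
    "\<And>j. j \<in> {1..7} \<Longrightarrow> P 2 1 * kron j 2 - P 2 2 * kron j 1 - P 2 3 * kron j 4 + P 2 4 * kron j 3 - P 2 5 * kron j 6 + P 2 6 * kron j 5 = - s * P 1 j"
    "\<And>j. j \<in> {1..7} \<Longrightarrow> P 3 1 * kron j 2 - P 3 2 * kron j 1 - P 3 3 * kron j 4 + P 3 4 * kron j 3 - P 3 5 * kron j 6 + P 3 6 * kron j 5 = s * P 4 j"
    "\<And>j. j \<in> {1..7} \<Longrightarrow> P 4 1 * kron j 2 - P 4 2 * kron j 1 - P 4 3 * kron j 4 + P 4 4 * kron j 3 - P 4 5 * kron j 6 + P 4 6 * kron j 5 = - s * P 3 j"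
    "\<And>j. j \<in> {1..7} \<Longrightarrow> P 5 1 * kron j 2 - P 5 2 * kron j 1 - P 5 3 * kron j 4 + P 5 4 * kron j 3 - P 5 5 * kron j 6 + P 5 6 * kron j 5 = s * P 6 j"
    "\<And>j. j \<in> {1..7} \<Longrightarrow> P 6 1 * kron j 2 - P 6 2 * kron j 1 - P 6 3 * kron j 4 + P 6 4 * kron j 3 - P 6 5 * kron j 6 + P 6 6 * kron j 5 = - s * P 5 j"
    using H[OF m(1)] H[OF m(2)] H[OF m(3)] H[OF m(4)] H[OF m(5)] H[OF m(6)]
    by (simp_all add: kron_def[of 1] kron_def[of 2] kron_def[of 3] kron_def[of 4] kron_def[of 5] kron_def[of 6])
  show "P 1 1 = s * P 2 2" "P 1 2 = - s * P 2 1" "P 1 3 = - s * P 2 4" "P 1 4 = s * P 2 3" "P 1 5 = - s * P 2 6" "P 1 6 = s * P 2 5"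
    using n[THEN H1(1)] by (simp_all add: kron_def)
  show "P 2 1 = - s * P 1 2" "P 2 2 = s * P 1 1" "P 2 3 = s * P 1 4" "P 2 4 = - s * P 1 3" "P 2 5 = s * P 1 6" "P 2 6 = - s * P 1 5"
    using n[THEN H1(2)] by (simp_all add: kron_def)
  show "P 3 1 = s * P 4 2" "P 3 2 = - s * P 4 1" "P 3 3 = - s * P 4 4" "P 3 4 = s * P 4 3" "P 3 5 = - s * P 4 6" "P 3 6 = s * P 4 5"
    using n[THEN H1(3)] by (simp_all add: kron_def)
  show "P 4 1 = - s * P 3 2" "P 4 2 = s * P 3 1" "P 4 3 = s * P 3 4" "P 4 4 = - s * P 3 3" "P 4 5 = s * P 3 6" "P 4 6 = - s * P 3 5"
    using n[THEN H1(4)] by (simp_all add: kron_def)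
  show "P 5 1 = s * P 6 2" "P 5 2 = - s * P 6 1" "P 5 3 = - s * P 6 4" "P 5 4 = s * P 6 3" "P 5 5 = - s * P 6 6" "P 5 6 = s * P 6 5"
    using n[THEN H1(5)] by (simp_all add: kron_def)
  show "P 6 1 = - s * P 5 2" "P 6 2 = s * P 5 1" "P 6 3 = s * P 5 4" "P 6 4 = - s * P 5 3" "P 6 5 = s * P 5 6" "P 6 6 = - s * P 5 5"
    using n[THEN H1(6)] by (simp_all add: kron_def)
qed

text \<open>A vanishing column would make the pulled back \<open>vol6\<close> contract to zero with
  e_j, against D being nonzero.\<close>

lemma col_nonzero:
  assumes j: "j \<in> {1..6}"
  shows "\<not> (P 1 j = 0 \<and> P 2 j = 0 \<and> P 3 j = 0 \<and> P 4 j = 0 \<and> P 5 j = 0 \<and> P 6 j = 0)"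
proof
  assume z: "P 1 j = 0 \<and> P 2 j = 0 \<and> P 3 j = 0 \<and> P 4 j = 0 \<and> P 5 j = 0 \<and> P 6 j = 0"
  have j7: "j \<in> {1..7}" using j by simp
  have "contr (kron j) (pull P vol6) = pull P (contr (vecP P (kron j)) vol6)" by (rule contr_pull[OF supp7_vol6])
  also have "contr (vecP P (kron j)) vol6 = (\<lambda>K. 0)" using z j7 by (intro contr_vol6) (simp_all add: vecP_kron)
  finally have "contr (kron j) (\<lambda>K. D * vol6 K) = (\<lambda>K. 0)" by (simp add: pull_vol6 linear_op_zero[OF linear_op_pull])
  then have "D * contr (kron j) vol6 (set [1,2,3,4,5,6] - {j}) = 0"
    by (auto simp: linear_op_scale[OF linear_op_contr] dest: fun_cong)
  then have "contr (kron j) vol6 (set [1,2,3,4,5,6] - {j}) = 0" using D0 by simp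
  moreover have "insert j (set [1,2,3,4,5,6] - {j}) = set [1,2,3,4,5,6]"
    using j by (intro insert_Diff) (simp add: numeral_eq_Suc, presburger)
  ultimately have "sort_sign (set [1,2,3,4,5,6] - {j}) j * coeff vol6 [1,2,3,4,5,6] = 0"
    by (simp add: contr_kron[OF j7] coeff_def del: list.set)
  then have "sort_sign (set [1,2,3,4,5,6] - {j}) j = 0" by (simp add: vol6_def coeff_form_of del: list.set)
  then show False using sort_sign_sq[of "set [1,2,3,4,5,6] - {j}" j] by (simp del: list.set sort_sign_sq)
qed

text \<open>Applying the equations twice multiplies each entry by s^2, and the first column is not
  zero.\<close>

lemma s_sq: "s * s = 1"
proof -
  have *: "x = 0" if "x = s * y" "y = s * x" "s * s \<noteq> 1" for x y
  proof -
    have "(s * s - 1) * x = 0" using that(1,2) by (simp add: algebra_simps)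
    then show ?thesis using that(3) by simp
  qed
  have **: "x = 0" if "x = - s * y" "y = - s * x" "s * s \<noteq> 1" for x y
  proof (rule *[OF _ _ that(3)])
    show "x = s * (- y)" using that(1) by simp
    show "- y = s * x" using that(2) by simp
  qed
  show ?thesis
  proof (rule ccontr)
    assume "s * s \<noteq> 1"
    then have "P 1 1 = 0" "P 2 1 = 0" "P 3 1 = 0" "P 4 1 = 0" "P 5 1 = 0" "P 6 1 = 0"
      using *[OF cr_raw(1,8)] **[OF cr_raw(7,2)] *[OF cr_raw(13,20)] **[OF cr_raw(19,14)]
        *[OF cr_raw(25,32)] **[OF cr_raw(31,26)] by auto
    then show False using col_nonzero[of 1] by simp
  qed
qed

definition W where "W = pull P omega"

lemma homog_W: "homog 2 W" unfolding W_def by (intro homog_pull homog_omega)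
lemma contr7_phi: "contr (kron 7) \<phi> = (\<lambda>K. h * W K)"
  using contr7_pull[OF fr supp7_phi0] by (simp add: phi contr7_phi0 W_def)

lemma contr7_W: "contr (kron 7) W = (\<lambda>K. 0)"
  by (simp add: W_def contr7_pull[OF fr supp7_omega] contr7_omega linear_op_zero[OF linear_op_pull])

lemma W_minor:
  assumes "i < j" "1 \<le> i" "j \<le> 7"
  shows "coeff W [i,j] = P 1 i * P 2 j - P 1 j * P 2 i + (P 3 i * P 4 j - P 3 j * P 4 i) + (P 5 i * P 6 j - P 5 j * P 6 i)"
proof -
  have x: "xform P {a, b} = lmul (P a) (lmul (P b) (form_of [([], 1)]))" if "a < b" for a b
  proof -
    have "form_of [([], 1)] = eform {}" by (auto simp: form_of_def eform_def)
    then show ?thesis using that by (simp add: xform_insert_min xform_empty)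
  qed
  have "W = (\<lambda>K. xform P {1,2} K + (xform P {3,4} K + xform P {5,6} K))"
    unfolding W_def omega_def by (subst pull_form_of) simp_all
  then show ?thesis using assms by (simp add: x coeff_simps)
qed

text \<open>The Cauchy-Riemann equations turn the three minors into a sum of squares, so the sign of
  this coefficient is the sign of s.\<close>

lemma W12: "coeff W [1,2] = s * ((P 1 1)\<^sup>2 + (P 2 1)\<^sup>2 + (P 3 1)\<^sup>2 + (P 4 1)\<^sup>2 + (P 5 1)\<^sup>2 + (P 6 1)\<^sup>2)"
proof -
  have "coeff W [1,2] = P 1 1 * P 2 2 - P 1 2 * P 2 1 + (P 3 1 * P 4 2 - P 3 2 * P 4 1) + (P 5 1 * P 6 2 - P 5 2 * P 6 1)"
    by (rule W_minor) simp_all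
  then show ?thesis unfolding cr_raw(8) cr_raw(2) cr_raw(20) cr_raw(14) cr_raw(32) cr_raw(26)
    by (simp add: power2_eq_square algebra_simps)
qed

lemma phi127: "coeff \<phi> [1,2,7] = h * coeff W [1,2]"
proof -
  have "coeff (contr (kron 7) \<phi>) [1,2] = coeff \<phi> [1,2,7]" by (simp add: coeff_contr_kron)
  then show ?thesis by (simp add: contr7_phi coeff_scale)
qed

text \<open>Together with continuity this keeps the coefficient, and hence s, positive along a whole
  solution.\<close>

lemma phi127_nonzero: "coeff \<phi> [1,2,7] \<noteq> 0"
proof -
  have "(P 1 1)\<^sup>2 + (P 2 1)\<^sup>2 + (P 3 1)\<^sup>2 + (P 4 1)\<^sup>2 + (P 5 1)\<^sup>2 + (P 6 1)\<^sup>2 \<noteq> 0"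
    using col_nonzero[of 1] by (simp add: add_nonneg_eq_0_iff)
  moreover have "s \<noteq> 0" using s_sq by auto
  ultimately show ?thesis using hpos by (simp add: phi127 W12)
qed

end

section \<open>Identities of the standard SU(3) structure\<close>

lemma omega_rho0: "wedge omega rho0 = (\<lambda>K. 0)"
proof (rule homog_eqI[of 5])
  show "homog 5 (wedge omega rho0)" using homog_wedge[OF homog_omega homog_rho0] by simp
  show "list_all (\<lambda>ks. coeff (wedge omega rho0) ks = coeff (\<lambda>K. 0) ks) (sublists_of_size 5 [1,2,3,4,5,6,7])"
    unfolding sublists_5 by (simp add: coeff_simps omega_def rho0_def)
qed (rule homog_zero)

lemma omega_cube: "wedge omega (wedge omega omega) = (\<lambda>K. 6 * vol6 K)"
proof (rule homog_eqI[of 6])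
  show "homog 6 (wedge omega (wedge omega omega))"
    using homog_wedge[OF homog_omega homog_wedge[OF homog_omega homog_omega]] by simp
  show "homog 6 (\<lambda>K. 6 * vol6 K)" by (intro homog_scale homog_vol6)
  show "list_all (\<lambda>ks. coeff (wedge omega (wedge omega omega)) ks = coeff (\<lambda>K. 6 * vol6 K) ks) (sublists_of_size 6 [1,2,3,4,5,6,7])"
    unfolding sublists_6 by (simp add: coeff_simps omega_def vol6_def)
qed

lemma psi0_split: "psi0 = (\<lambda>K. 1 / 2 * wedge omega omega K + lmul (kron 7) rho0 K)"
proof (rule homog_eqI[OF homog_psi0])
  show "homog 4 (\<lambda>K. 1 / 2 * wedge omega omega K + lmul (kron 7) rho0 K)"
    using homog_wedge[OF homog_omega homog_omega] homog_lmul[OF homog_rho0, of "kron 7"]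
    by (intro homog_add homog_scale) simp_all
  show "list_all (\<lambda>ks. coeff psi0 ks = coeff (\<lambda>K. 1 / 2 * wedge omega omega K + lmul (kron 7) rho0 K) ks) (sublists_of_size 4 [1,2,3,4,5,6,7])"
    unfolding sublists_4 by (simp add: coeff_simps coeff_div omega_def psi0_def rho0_def kron_def)
qed

lemma phi0_split: "phi0 = (\<lambda>K. lmul (kron 7) omega K + rho1 K)"
proof (rule homog_eqI[OF homog_phi0])
  show "homog 3 (\<lambda>K. lmul (kron 7) omega K + rho1 K)"
    using homog_lmul[OF homog_omega, of "kron 7"] homog_rho1 by (intro homog_add) simp_all
  show "list_all (\<lambda>ks. coeff phi0 ks = coeff (\<lambda>K. lmul (kron 7) omega K + rho1 K) ks) (sublists_of_size 3 [1,2,3,4,5,6,7])"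
    unfolding sublists_3 by (simp add: coeff_simps omega_def phi0_def rho1_def kron_def)
qed

text \<open>The derivations of the exterior algebra induced by the two complex structures; they send the
  imaginary part of a complex volume form to a multiple of its real part.\<close>

definition dJ0 :: "form \<Rightarrow> form" where
  "dJ0 a = (\<lambda>K. lmul (kron 1) (contr (kron 2) a) K - lmul (kron 2) (contr (kron 1) a) K
     + lmul (kron 3) (contr (kron 4) a) K - lmul (kron 4) (contr (kron 3) a) K
     + lmul (kron 5) (contr (kron 6) a) K - lmul (kron 6) (contr (kron 5) a) K)"

definition dJe :: "form \<Rightarrow> form" where
  "dJe a = (\<lambda>K. lmul (kron 1) (contr (kron 2) a) K - lmul (kron 2) (contr (kron 1) a) K
     - lmul (kron 3) (contr (kron 4) a) K + lmul (kron 4) (contr (kron 3) a) K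
     - lmul (kron 5) (contr (kron 6) a) K + lmul (kron 6) (contr (kron 5) a) K)"

lemma homog_lmul_contr: "homog 3 a \<Longrightarrow> homog 3 (lmul b (contr c a))"
  using homog_lmul[OF homog_contr[of 2 a c], of b] by simp

lemma dJ0_rho0: "dJ0 rho0 = (\<lambda>K. - 3 * rho1 K)"
proof (rule homog_eqI[of 3])
  show "homog 3 (dJ0 rho0)" unfolding dJ0_def
    by (intro homog_add homog_diff homog_lmul_contr homog_rho0)
  show "homog 3 (\<lambda>K. - 3 * rho1 K)" by (intro homog_scale homog_rho1)
  show "list_all (\<lambda>ks. coeff (dJ0 rho0) ks = coeff (\<lambda>K. - 3 * rho1 K) ks) (sublists_of_size 3 [1,2,3,4,5,6,7])"
    unfolding sublists_3 dJ0_def by (simp add: coeff_linear coeff_form_of coeff_lmul_kron coeff_contr_kron rho0_def rho1_def)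
qed

lemma dJe_rhoe: "dJe rhoe = (\<lambda>K. - 3 * rhohat K)"
proof (rule homog_eqI[of 3])
  show "homog 3 (dJe rhoe)" unfolding dJe_def
    by (intro homog_add homog_diff homog_lmul_contr homog_rhoe)
  show "homog 3 (\<lambda>K. - 3 * rhohat K)" by (intro homog_scale homog_rhohat)
  show "list_all (\<lambda>ks. coeff (dJe rhoe) ks = coeff (\<lambda>K. - 3 * rhohat K) ks) (sublists_of_size 3 [1,2,3,4,5,6,7])"
    unfolding sublists_3 dJe_def by (simp add: coeff_linear coeff_form_of coeff_lmul_kron coeff_contr_kron rhoe_def rhohat_def)
qed

lemma lmul_list: "lmul c a K = c 1 * lmul (kron 1) a K + c 2 * lmul (kron 2) a K + c 3 * lmul (kron 3) a K
    + c 4 * lmul (kron 4) a K + c 5 * lmul (kron 5) a K + c 6 * lmul (kron 6) a K + c 7 * lmul (kron 7) a K"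
  using fun_cong[OF lmul_expand[of c a], of K] unfolding set_list17[symmetric] by simp

lemma contr_list: "contr c a = (\<lambda>K. c 1 * contr (kron 1) a K + c 2 * contr (kron 2) a K + c 3 * contr (kron 3) a K
    + c 4 * contr (kron 4) a K + c 5 * contr (kron 5) a K + c 6 * contr (kron 6) a K + c 7 * contr (kron 7) a K)"
  using contr_expand[of c a] unfolding set_list17[symmetric] by (simp add: add.assoc)

section \<open>The Hermitian form of a solution at a fixed time\<close>

definition flow_form :: "real \<Rightarrow> form \<Rightarrow> real \<Rightarrow> form" where
  "flow_form A \<phi> h = (\<lambda>K. 2 * A * (sqrt 6 / 6) * wedge omega (contr (kron 7) \<phi>) K - h\<^sup>2 / 6 * wedge omega omega K)"

locale positive_frame = fixed_rho +
  assumes pos: "coeff \<phi> [1,2,7] > 0"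
begin

lemma s1: "s = 1"
proof (rule ccontr)
  assume "s \<noteq> 1"
  then have "s = - 1" using s_sq by (metis square_eq_1_iff)
  moreover have "0 \<le> (P 1 1)\<^sup>2 + (P 2 1)\<^sup>2 + (P 3 1)\<^sup>2 + (P 4 1)\<^sup>2 + (P 5 1)\<^sup>2 + (P 6 1)\<^sup>2"
    by (intro add_nonneg_nonneg) simp_all
  ultimately have "coeff W [1,2] \<le> 0" unfolding W12 by (intro mult_nonpos_nonneg) simp_all
  then show False using pos hpos by (simp add: phi127 zero_less_mult_iff)
qed

lemmas cr = cr_raw[unfolded s1, simplified]

lemma hD: "h\<^sup>2 * D = 1" using s1 by (simp add: s_def)

lemma W_rhoe: "wedge W rhoe = (\<lambda>K. 0)"
  by (simp add: hrho W_def linear_op_scale[OF linear_op_wedge_right] pull_wedge[symmetric] supp7_omega supp7_rho0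
      omega_rho0 linear_op_zero[OF linear_op_pull])

text \<open>Entries of a Hermitian 3 by 3 matrix: w on the diagonal, the pairs p, q, r as real and
  imaginary parts off it. The complex structure of \<open>rhoe\<close> reverses the planes 34 and
  56, hence the minus signs in w2 and w3.\<close>

definition "w1 = coeff W [1,2]" definition "w2 = - coeff W [3,4]" definition "w3 = - coeff W [5,6]"
definition "p1 = coeff W [1,3]" definition "p2 = coeff W [1,4]"
definition "q1 = coeff W [1,5]" definition "q2 = coeff W [1,6]"
definition "r1 = coeff W [3,5]" definition "r2 = coeff W [3,6]"

lemmas W_coeffs = w1_def w2_def w3_def p1_def p2_def q1_def q2_def r1_def r2_def

lemma W_no7: "coeff W [1,7] = 0" "coeff W [2,7] = 0" "coeff W [3,7] = 0" "coeff W [4,7] = 0" "coeff W [5,7] = 0" "coeff W [6,7] = 0"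
proof -
  have "coeff (contr (kron 7) W) [i] = 0" for i by (simp add: contr7_W coeff_zero)
  from this[of 1] this[of 2] this[of 3] this[of 4] this[of 5] this[of 6]
  show "coeff W [1,7] = 0" "coeff W [2,7] = 0" "coeff W [3,7] = 0" "coeff W [4,7] = 0" "coeff W [5,7] = 0" "coeff W [6,7] = 0"
    by (simp_all add: coeff_contr_kron)
qed

lemma W_type: "coeff W [2,4] = - coeff W [1,3]" "coeff W [2,3] = coeff W [1,4]" "coeff W [2,6] = - coeff W [1,5]"
  "coeff W [2,5] = coeff W [1,6]" "coeff W [4,6] = coeff W [3,5]" "coeff W [4,5] = - coeff W [3,6]"
proof -
  have "coeff (wedge W rhoe) ks = 0" for ks by (simp add: W_rhoe coeff_zero)
  from this[of "[1,2,3,4,5]"] this[of "[1,2,3,4,6]"] this[of "[1,2,3,5,6]"] this[of "[1,2,4,5,6]"]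
    this[of "[1,3,4,5,6]"] this[of "[2,3,4,5,6]"]
  show "coeff W [2,4] = - coeff W [1,3]" "coeff W [2,3] = coeff W [1,4]" "coeff W [2,6] = - coeff W [1,5]"
    "coeff W [2,5] = coeff W [1,6]" "coeff W [4,6] = coeff W [3,5]" "coeff W [4,5] = - coeff W [3,6]"
    by (simp_all add: coeff_wedge_right rhoe_def)
qed

lemma W_form_of: "W = form_of [([1,2],w1),([3,4],-w2),([5,6],-w3),([1,3],p1),([2,4],-p1),([1,4],p2),([2,3],p2),
   ([1,5],q1),([2,6],-q1),([1,6],q2),([2,5],q2),([3,5],r1),([4,6],r1),([3,6],r2),([4,5],-r2)]" (is "_ = form_of ?X")
proof (rule homog_eqI[OF homog_W])
  show "homog 2 (form_of ?X)" by (rule homog_form_of) simp_all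
  show "list_all (\<lambda>ks. coeff W ks = coeff (form_of ?X) ks) (sublists_of_size 2 [1,2,3,4,5,6,7])"
    unfolding sublists_2 by (simp add: coeff_form_of W_no7 W_type W_coeffs)
qed

text \<open>By the Cauchy-Riemann equations w2 and w3 are sums of squares of entries of P, and zero
  would mean a zero column.\<close>

lemma w_pos: "w1 > 0" "w2 > 0" "w3 > 0"
proof -
  show "w1 > 0" using pos hpos by (simp add: phi127 w1_def zero_less_mult_iff)
  have "coeff W [3,4] = P 1 3 * P 2 4 - P 1 4 * P 2 3 + (P 3 3 * P 4 4 - P 3 4 * P 4 3) + (P 5 3 * P 6 4 - P 5 4 * P 6 3)"
    by (rule W_minor) simp_all
  then have "w2 = (P 1 3)\<^sup>2 + (P 1 4)\<^sup>2 + (P 3 3)\<^sup>2 + (P 3 4)\<^sup>2 + (P 5 3)\<^sup>2 + (P 5 4)\<^sup>2"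
    unfolding w2_def cr(10) cr(9) cr(22) cr(21) cr(34) cr(33) by (simp add: power2_eq_square)
  moreover have "\<not> (P 1 3 = 0 \<and> P 1 4 = 0 \<and> P 3 3 = 0 \<and> P 3 4 = 0 \<and> P 5 3 = 0 \<and> P 5 4 = 0)"
    using col_nonzero[of 3] cr(9,21,33) by auto
  ultimately show "w2 > 0" by (simp add: less_le add_nonneg_eq_0_iff)
  have "coeff W [5,6] = P 1 5 * P 2 6 - P 1 6 * P 2 5 + (P 3 5 * P 4 6 - P 3 6 * P 4 5) + (P 5 5 * P 6 6 - P 5 6 * P 6 5)"
    by (rule W_minor) simp_all
  then have "w3 = (P 1 5)\<^sup>2 + (P 1 6)\<^sup>2 + (P 3 5)\<^sup>2 + (P 3 6)\<^sup>2 + (P 5 5)\<^sup>2 + (P 5 6)\<^sup>2"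
    unfolding w3_def cr(12) cr(11) cr(24) cr(23) cr(36) cr(35) by (simp add: power2_eq_square)
  moreover have "\<not> (P 1 5 = 0 \<and> P 1 6 = 0 \<and> P 3 5 = 0 \<and> P 3 6 = 0 \<and> P 5 5 = 0 \<and> P 5 6 = 0)"
    using col_nonzero[of 5] cr(11,23,35) by auto
  ultimately show "w3 > 0" by (simp add: less_le add_nonneg_eq_0_iff)
qed

text \<open>The coefficient of W^3 / 6, equal to the determinant of the Hermitian matrix.\<close>

definition "pfaffian = w1 * w2 * w3 - p1 * p1 * w3 - p2 * p2 * w3 - q1 * q1 * w2 - q2 * q2 * w2 - r1 * r1 * w1 - r2 * r2 * w1
   + 2 * (p1 * q2 * r1 - p2 * q1 * r1 - p1 * q1 * r2 - p2 * q2 * r2)"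

text \<open>W^3 is 6 times the pulled back \<open>vol6\<close>, so the determinant equals D, and h^2
  D is s = 1.\<close>

lemma pfaffian_h: "h\<^sup>2 * pfaffian = 1"
proof -
  have "wedge W (wedge W W) = (\<lambda>K. 6 * (D * vol6 K))"
    by (simp add: W_def pull_wedge[symmetric] supp7_omega supp7_wedge omega_cube linear_op_scale[OF linear_op_pull] pull_vol6)
  then have "coeff (wedge W (wedge W W)) [1,2,3,4,5,6] = 6 * D" by (simp add: coeff_scale vol6_def coeff_form_of)
  moreover have "coeff (wedge W (wedge W W)) [1,2,3,4,5,6] = 6 * pfaffian"
    unfolding W_form_of by (simp add: coeff_wedge_left coeff_form_of pfaffian_def) (simp add: algebra_simps)
  ultimately show ?thesis using hD by simp
qed

lemma psi_W: "psi_of \<phi> = (\<lambda>K. 1 / 2 * wedge W W K + 1 / h * lmul (P 7) rhoe K)"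
proof -
  have "psi_of \<phi> = (\<lambda>K. 1 / 2 * wedge W W K + lmul (P 7) (pull P rho0) K)"
    unfolding psi psi0_split linear_op_add[OF linear_op_pull] linear_op_scale[OF linear_op_pull]
    by (simp add: W_def pull_wedge supp7_omega pull_lmul_kron supp7_rho0)
  moreover have "lmul (P 7) rhoe = (\<lambda>K. h * lmul (P 7) (pull P rho0) K)"
    by (subst hrho) (rule linear_op_scale[OF linear_op_lmul])
  ultimately show ?thesis using hpos by simp
qed

text \<open>W^2 / 2 consists of the 2 by 2 minors of the Hermitian matrix. Each off-diagonal minor
  occurs in two coefficients, and the row \<open>P 7\<close> enters them with opposite relative
  sign, so suitable sums and differences separate the two.\<close>

lemma psi_coeffs:
  "coeff (psi_of \<phi>) [1,2,3,4] = p1 * p1 + p2 * p2 - w1 * w2"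
  "coeff (psi_of \<phi>) [1,2,5,6] = q1 * q1 + q2 * q2 - w1 * w3"
  "coeff (psi_of \<phi>) [3,4,5,6] = w2 * w3 - r1 * r1 - r2 * r2"
  "coeff (psi_of \<phi>) [1,2,3,5] = r1 * w1 - p1 * q2 + p2 * q1 - P 7 1 / h"
  "coeff (psi_of \<phi>) [1,2,4,6] = r1 * w1 - p1 * q2 + p2 * q1 + P 7 1 / h"
  "coeff (psi_of \<phi>) [1,2,3,6] = r2 * w1 + p1 * q1 + p2 * q2 - P 7 2 / h"
  "coeff (psi_of \<phi>) [1,2,4,5] = - (r2 * w1 + p1 * q1 + p2 * q2) - P 7 2 / h"
  "coeff (psi_of \<phi>) [1,3,4,5] = - (q1 * w2 + p1 * r2 + p2 * r1) - P 7 3 / h"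
  "coeff (psi_of \<phi>) [2,3,4,6] = q1 * w2 + p1 * r2 + p2 * r1 - P 7 3 / h"
  "coeff (psi_of \<phi>) [1,3,4,6] = p1 * r1 - q2 * w2 - p2 * r2 + P 7 4 / h"
  "coeff (psi_of \<phi>) [2,3,4,5] = p1 * r1 - q2 * w2 - p2 * r2 - P 7 4 / h"
  "coeff (psi_of \<phi>) [1,3,5,6] = q2 * r1 - p1 * w3 - q1 * r2 + P 7 5 / h"
  "coeff (psi_of \<phi>) [2,4,5,6] = - (q2 * r1 - p1 * w3 - q1 * r2) + P 7 5 / h"
  "coeff (psi_of \<phi>) [1,4,5,6] = - (p2 * w3 + q1 * r1 + q2 * r2) - P 7 6 / h"
  "coeff (psi_of \<phi>) [2,3,5,6] = - (p2 * w3 + q1 * r1 + q2 * r2) + P 7 6 / h"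
  unfolding psi_W W_form_of by (simp_all add: coeff_simps coeff_div rhoe_def)

lemma rhs_coeffs:
  fixes A defines "k \<equiv> 2 * A * (sqrt 6 / 6) * h"
  shows "coeff (flow_form A \<phi> h) [1,2,3,4] = k * (w1 - w2) - h\<^sup>2 / 3"
  "coeff (flow_form A \<phi> h) [1,2,5,6] = k * (w1 - w3) - h\<^sup>2 / 3"
  "coeff (flow_form A \<phi> h) [3,4,5,6] = - k * (w2 + w3) - h\<^sup>2 / 3"
  "coeff (flow_form A \<phi> h) [1,2,3,5] = k * r1" "coeff (flow_form A \<phi> h) [1,2,4,6] = k * r1"
  "coeff (flow_form A \<phi> h) [1,2,3,6] = k * r2" "coeff (flow_form A \<phi> h) [1,2,4,5] = - k * r2"
  "coeff (flow_form A \<phi> h) [1,3,4,5] = k * q1" "coeff (flow_form A \<phi> h) [2,3,4,6] = - k * q1"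
  "coeff (flow_form A \<phi> h) [1,3,4,6] = k * q2" "coeff (flow_form A \<phi> h) [2,3,4,5] = k * q2"
  "coeff (flow_form A \<phi> h) [1,3,5,6] = k * p1" "coeff (flow_form A \<phi> h) [2,4,5,6] = - k * p1"
  "coeff (flow_form A \<phi> h) [1,4,5,6] = k * p2" "coeff (flow_form A \<phi> h) [2,3,5,6] = k * p2"
  unfolding flow_form_def contr7_phi W_form_of linear_op_scale[OF linear_op_wedge_right] omega_def
  by (simp_all add: coeff_simps coeff_div k_def) (simp_all add: algebra_simps)

text \<open>The hypotheses are conserved by the flow and hold initially; they make e_7 orthogonal to
  the other basis vectors.\<close>

lemma no_theta:
  assumes "coeff (psi_of \<phi>) [1,2,3,5] = coeff (psi_of \<phi>) [1,2,4,6]" "coeff (psi_of \<phi>) [1,2,3,6] = - coeff (psi_of \<phi>) [1,2,4,5]"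
   "coeff (psi_of \<phi>) [1,3,4,5] = - coeff (psi_of \<phi>) [2,3,4,6]" "coeff (psi_of \<phi>) [1,3,4,6] = coeff (psi_of \<phi>) [2,3,4,5]"
   "coeff (psi_of \<phi>) [1,3,5,6] = - coeff (psi_of \<phi>) [2,4,5,6]" "coeff (psi_of \<phi>) [1,4,5,6] = coeff (psi_of \<phi>) [2,3,5,6]"
  shows "P 7 1 = 0" "P 7 2 = 0" "P 7 3 = 0" "P 7 4 = 0" "P 7 5 = 0" "P 7 6 = 0"
  using assms hpos unfolding psi_coeffs by simp_all

text \<open>The part of phi without e^7 is determined by \<open>rhoe\<close>: the derivation of the
  complex structure sends \<open>rhoe\<close> to -3 \<open>rhohat\<close> and its model
  \<open>rho0\<close> to -3 \<open>rho1\<close>.\<close>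

lemma phi_W:
  assumes z: "P 7 1 = 0" "P 7 2 = 0" "P 7 3 = 0" "P 7 4 = 0" "P 7 5 = 0" "P 7 6 = 0"
  shows "\<phi> = (\<lambda>K. h * lmul (kron 7) W K + 1 / h * rhohat K)"
proof -
  have row7: "lmul (P 7) W = (\<lambda>K. h * lmul (kron 7) W K)"
    using z by (simp add: lmul_list[of "P 7"] col7 fun_eq_iff)
  \<comment> \<open>The Cauchy-Riemann equations and the vanishing of the mixed entries of P make
    the two derivations correspond under the frame.\<close>
  have "dJe (pull P a) = pull P (dJ0 a)" if a: "supp7 a" for a
  proof
    fix K
    have c: "supp7 (contr c a)" for c using a by (rule supp7_contr)
    have C: "contr (kron j) (pull P a) = (\<lambda>K. P 1 j * pull P (contr (kron 1) a) K + P 2 j * pull P (contr (kron 2) a) K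
       + P 3 j * pull P (contr (kron 3) a) K + P 4 j * pull P (contr (kron 4) a) K + P 5 j * pull P (contr (kron 5) a) K
       + P 6 j * pull P (contr (kron 6) a) K + P 7 j * pull P (contr (kron 7) a) K)" if "j \<in> {1..7}" for j
      by (simp add: contr_pull[OF a] contr_list[of "vecP P (kron j)"] vecP_kron[OF that] linear_op_add[OF linear_op_pull] linear_op_scale[OF linear_op_pull])
    have R: "pull P (lmul (kron i) b) K = P i 1 * lmul (kron 1) (pull P b) K + P i 2 * lmul (kron 2) (pull P b) K
      + P i 3 * lmul (kron 3) (pull P b) K + P i 4 * lmul (kron 4) (pull P b) K + P i 5 * lmul (kron 5) (pull P b) K
      + P i 6 * lmul (kron 6) (pull P b) K + P i 7 * lmul (kron 7) (pull P b) K" if "i \<in> {1..7}" "supp7 b" for i b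
      using that by (simp only: pull_lmul_kron lmul_list[of "P i"])
    show "dJe (pull P a) K = pull P (dJ0 a) K"
      unfolding dJe_def dJ0_def linear_op_add[OF linear_op_pull] linear_op_diff[OF linear_op_pull]
      by (simp add: R c C linear_op_add[OF linear_op_lmul] linear_op_scale[OF linear_op_lmul] col7 z)
        (simp add: cr(7-12) cr(19-24) cr(31-36) algebra_simps)
  qed
  then have "dJe (pull P rho0) = pull P (\<lambda>K. - 3 * rho1 K)" by (simp add: supp7_rho0 dJ0_rho0)
  then have "dJe (pull P rho0) = (\<lambda>K. - 3 * pull P rho1 K)" by (simp only: linear_op_scale[OF linear_op_pull])
  moreover have "dJe rhoe = (\<lambda>K. h * dJe (pull P rho0) K)"
    by (subst hrho) (simp add: dJe_def linear_op_scale[OF linear_op_contr] linear_op_scale[OF linear_op_lmul] algebra_simps)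
  ultimately have "(\<lambda>K. - 3 * rhohat K) = (\<lambda>K. h * (- 3 * pull P rho1 K))" by (simp only: dJe_rhoe)
  then have "rhohat K = h * pull P rho1 K" for K by (auto dest: fun_cong[where x = K])
  then have R: "pull P rho1 K = 1 / h * rhohat K" for K using hpos by simp
  have "\<phi> = (\<lambda>K. lmul (P 7) W K + pull P rho1 K)"
    unfolding phi phi0_split linear_op_add[OF linear_op_pull] by (simp add: W_def pull_lmul_kron supp7_omega)
  then show ?thesis by (simp only: row7 R)
qed

end

section \<open>Ordinary differential equations\<close>

text \<open>A two-sided Gronwall argument: exp (- B s) E decreases forwards from 0 and exp (B s) E
  increases towards 0 from the left.\<close>

lemma gronwall_zero:
  fixes E E' C :: "real \<Rightarrow> real"
  assumes J: "is_interval J" "0 \<in> J" "t \<in> J"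
    and E: "\<And>s. s \<in> J \<Longrightarrow> (E has_real_derivative E' s) (at s)"
    and bd: "\<And>s. s \<in> J \<Longrightarrow> \<bar>E' s\<bar> \<le> C s * E s"
    and C: "continuous_on J C" and E0: "E 0 = 0" and pos: "\<And>s. s \<in> J \<Longrightarrow> 0 \<le> E s"
  shows "E t = 0"
proof -
  \<comment> \<open>C may be unbounded on J, but it is bounded on the compact interval between 0 and
    t.\<close>
  define a b where "a = min 0 t" and "b = max 0 t"
  have sub: "s \<in> J" if "a \<le> s" "s \<le> b" for s
    using that mem_is_interval_1_I[OF J(1) J(2) J(3), of s] mem_is_interval_1_I[OF J(1) J(3) J(2), of s]
    by (cases "0 \<le> t") (auto simp: a_def b_def)
  have "compact (C ` {a..b})"
    by (intro compact_continuous_image continuous_on_subset[OF C]) (auto intro: sub)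
  then obtain B where B: "\<And>s. s \<in> {a..b} \<Longrightarrow> \<bar>C s\<bar> \<le> B"
    using compact_imp_bounded[of "C ` {a..b}"] unfolding bounded_iff by force
  have bd': "\<bar>E' s\<bar> \<le> B * E s" if "a \<le> s" "s \<le> b" for s
  proof -
    have "\<bar>E' s\<bar> \<le> C s * E s" using that by (intro bd sub)
    also have "\<dots> \<le> B * E s" using B[of s] that pos[OF sub] by (intro mult_right_mono) auto
    finally show ?thesis .
  qed
  have "E t \<le> 0"
  proof (cases "0 \<le> t")
    case True
    have "exp (- B * t) * E t \<le> exp (- B * 0) * E 0"
    proof (rule DERIV_nonpos_imp_nonincreasing[OF True])
      fix s assume s: "0 \<le> s" "s \<le> t"
      then have s': "a \<le> s" "s \<le> b" by (auto simp: a_def b_def)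
      have "((\<lambda>s. exp (- B * s) * E s) has_real_derivative exp (- B * s) * (E' s - B * E s)) (at s)"
        by (auto intro!: derivative_eq_intros E sub s' simp: algebra_simps)
      moreover have "exp (- B * s) * (E' s - B * E s) \<le> 0"
        using bd'[OF s'] by (intro mult_nonneg_nonpos) auto
      ultimately show "\<exists>y. ((\<lambda>s. exp (- B * s) * E s) has_real_derivative y) (at s) \<and> y \<le> 0" by blast
    qed
    then show ?thesis using E0 by (simp add: mult_le_0_iff)
  next
    case False
    then have t: "t \<le> 0" by simp
    have "exp (B * t) * E t \<le> exp (B * 0) * E 0"
    proof (rule DERIV_nonneg_imp_nondecreasing[OF t])
      fix s assume s: "t \<le> s" "s \<le> 0"
      then have s': "a \<le> s" "s \<le> b" by (auto simp: a_def b_def)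
      have "((\<lambda>s. exp (B * s) * E s) has_real_derivative exp (B * s) * (E' s + B * E s)) (at s)"
        by (auto intro!: derivative_eq_intros E sub s' simp: algebra_simps)
      moreover have "0 \<le> exp (B * s) * (E' s + B * E s)"
        using bd'[OF s'] by (intro mult_nonneg_nonneg) auto
      ultimately show "\<exists>y. ((\<lambda>s. exp (B * s) * E s) has_real_derivative y) (at s) \<and> 0 \<le> y" by blast
    qed
    then show ?thesis using E0 by (simp add: mult_le_0_iff)
  qed
  with pos[OF J(3)] show ?thesis by simp
qed

lemma linear_ode_zero:
  fixes u :: "'i \<Rightarrow> real \<Rightarrow> real" and M :: "'i \<Rightarrow> 'i \<Rightarrow> real \<Rightarrow> real"
  assumes J: "is_interval J" "0 \<in> J" "t \<in> J" and I: "finite I" "k \<in> I"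
    and u: "\<And>i s. i \<in> I \<Longrightarrow> s \<in> J \<Longrightarrow> (u i has_real_derivative (\<Sum>j\<in>I. M i j s * u j s)) (at s)"
    and M: "\<And>i j. i \<in> I \<Longrightarrow> j \<in> I \<Longrightarrow> continuous_on J (M i j)"
    and u0: "\<And>i. i \<in> I \<Longrightarrow> u i 0 = 0"
  shows "u k t = 0"
proof -
  \<comment> \<open>The energy; 2 |v w| <= v^2 + w^2 bounds its derivative by the sum of the
    coefficients times the energy itself.\<close>
  define E where "E s = (\<Sum>i\<in>I. (u i s)\<^sup>2)" for s
  define E' where "E' s = (\<Sum>i\<in>I. 2 * u i s * (\<Sum>j\<in>I. M i j s * u j s))" for s
  define C where "C s = (\<Sum>i\<in>I. \<Sum>j\<in>I. 2 * \<bar>M i j s\<bar>)" for s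
  have "E t = 0"
  proof (rule gronwall_zero[OF J, of E E' C])
    fix s assume s: "s \<in> J"
    show "(E has_real_derivative E' s) (at s)" unfolding E_def E'_def
      by (auto intro!: derivative_eq_intros u s sum.cong)
    show "0 \<le> E s" by (simp add: E_def sum_nonneg)
    have le: "(u i s)\<^sup>2 \<le> E s" if "i \<in> I" for i
      unfolding E_def using I(1) that by (intro member_le_sum) auto
    have "\<bar>E' s\<bar> \<le> (\<Sum>i\<in>I. \<Sum>j\<in>I. 2 * \<bar>M i j s\<bar> * E s)"
      unfolding E'_def
    proof (rule order.trans[OF sum_abs], rule sum_mono)
      fix i assume i: "i \<in> I"
      have "\<bar>2 * u i s * (\<Sum>j\<in>I. M i j s * u j s)\<bar> \<le> (\<Sum>j\<in>I. \<bar>2 * u i s * (M i j s * u j s)\<bar>)"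
        unfolding sum_distrib_left by (rule sum_abs)
      also have "\<dots> \<le> (\<Sum>j\<in>I. 2 * \<bar>M i j s\<bar> * E s)"
      proof (rule sum_mono)
        fix j assume j: "j \<in> I"
        have "2 * (\<bar>u i s\<bar> * \<bar>u j s\<bar>) \<le> (u i s)\<^sup>2 + (u j s)\<^sup>2"
          using sum_squares_bound[of "\<bar>u i s\<bar>" "\<bar>u j s\<bar>"] by (simp add: mult.assoc)
        then have "\<bar>u i s\<bar> * \<bar>u j s\<bar> \<le> E s" using le[OF i] le[OF j] by simp
        then have "2 * \<bar>M i j s\<bar> * (\<bar>u i s\<bar> * \<bar>u j s\<bar>) \<le> 2 * \<bar>M i j s\<bar> * E s"
          by (intro mult_left_mono) auto
        then show "\<bar>2 * u i s * (M i j s * u j s)\<bar> \<le> 2 * \<bar>M i j s\<bar> * E s"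
          by (simp add: abs_mult algebra_simps)
      qed
      finally show "\<bar>2 * u i s * (\<Sum>j\<in>I. M i j s * u j s)\<bar> \<le> (\<Sum>j\<in>I. 2 * \<bar>M i j s\<bar> * E s)" .
    qed
    then show "\<bar>E' s\<bar> \<le> C s * E s" by (simp add: C_def sum_distrib_right)
  qed (use M u0 in \<open>auto simp: C_def E_def intro!: continuous_intros\<close>)
  then show ?thesis using I by (simp add: E_def sum_nonneg_eq_0_iff)
qed

text \<open>Compare f with g on the half line for all four choices of the sign of f and of the side
  of 0; this replaces estimating an integral.\<close>

lemma derivative_domination:
  fixes f g f' g' :: "real \<Rightarrow> real"
  assumes f: "\<And>s. (f has_real_derivative f' s) (at s)"
    and g: "\<And>s. s \<ge> 0 \<Longrightarrow> (g has_real_derivative g' s) (at s)"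
    and bd: "\<And>s. \<bar>f' s\<bar> \<le> g' \<bar>s\<bar>" and f0: "f 0 = 0"
  shows "\<bar>f x\<bar> \<le> g \<bar>x\<bar> - g 0"
proof -
  have *: "\<sigma> * f (\<rho> * \<bar>x\<bar>) \<le> g \<bar>x\<bar> - g 0" if "\<sigma> = 1 \<or> \<sigma> = - 1" "\<rho> = 1 \<or> \<rho> = - 1" for \<sigma> \<rho>
  proof -
    have "g 0 - \<sigma> * f (\<rho> * 0) \<le> g \<bar>x\<bar> - \<sigma> * f (\<rho> * \<bar>x\<bar>)"
    proof (rule DERIV_nonneg_imp_nondecreasing[of 0 "\<bar>x\<bar>" "\<lambda>s. g s - \<sigma> * f (\<rho> * s)"])
      fix s :: real assume s: "0 \<le> s"
      have "((\<lambda>s. f (\<rho> * s)) has_real_derivative f' (\<rho> * s) * \<rho>) (at s)"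
        by (rule DERIV_chain2[OF f]) (auto intro!: derivative_eq_intros)
      then have d: "((\<lambda>s. g s - \<sigma> * f (\<rho> * s)) has_real_derivative g' s - \<sigma> * (f' (\<rho> * s) * \<rho>)) (at s)"
        using g[OF s] by (auto intro!: derivative_eq_intros)
      have "\<bar>\<rho> * s\<bar> = s" using that s by auto
      then have "\<bar>f' (\<rho> * s)\<bar> \<le> g' s" using bd[of "\<rho> * s"] by simp
      then have "0 \<le> g' s - \<sigma> * (f' (\<rho> * s) * \<rho>)" using that by auto
      with d show "\<exists>y. ((\<lambda>s. g s - \<sigma> * f (\<rho> * s)) has_real_derivative y) (at s) \<and> 0 \<le> y" by blast
    qed simp
    then show ?thesis using f0 by simp
  qed
  show ?thesis using *[of 1 1] *[of 1 "-1"] *[of "-1" 1] *[of "-1" "-1"] by (cases "0 \<le> x") auto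
qed

lemma antiderivative_UNIV:
  fixes f :: "real \<Rightarrow> real"
  assumes "continuous_on UNIV f"
  shows "\<exists>F. F 0 = 0 \<and> (\<forall>x. (F has_real_derivative f x) (at x))"
proof -
  have "\<exists>F. \<forall>x::real. - \<infinity> < ereal x \<longrightarrow> ereal x < \<infinity> \<longrightarrow> (F has_vector_derivative f x) (at x)"
    by (rule einterval_antiderivative) (use assms in \<open>auto simp: continuous_on_eq_continuous_at\<close>)
  then obtain F where "\<And>x. (F has_real_derivative f x) (at x)"
    by (auto simp: has_real_derivative_iff_has_vector_derivative)
  then show ?thesis
    by (intro exI[of _ "\<lambda>x. F x - F 0"]) (auto intro!: derivative_eq_intros)
qed

text \<open>Picard iteration in the exponentially weighted space of functions, where it is a contraction on
  the whole real line.\<close>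

lemma global_picard:
  fixes G :: "real \<Rightarrow> real \<Rightarrow> real"
  assumes cont: "continuous_on UNIV (\<lambda>p. G (fst p) (snd p))"
    and lip: "\<And>x l m. \<bar>G x l - G x m\<bar> \<le> \<bar>l - m\<bar>" and bd: "\<And>x l. \<bar>G x l\<bar> \<le> 1"
  shows "\<exists>L. L 0 = l0 \<and> (\<forall>x. (L has_real_derivative G x (L x)) (at x))"
proof -
  \<comment> \<open>M stands for the weighted function exp (- 2 |s|) L(s), which is bounded although
    L may grow linearly.\<close>
  define rhs where "rhs M s = G s (exp (2 * \<bar>s\<bar>) * apply_bcontfun M s)" for M :: "real \<Rightarrow>\<^sub>C real" and s :: real
  have crhs: "continuous_on UNIV (rhs M)" for M
  proof -
    have "continuous_on UNIV (\<lambda>s. (s, exp (2 * \<bar>s\<bar>) * apply_bcontfun M s))"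
      by (intro continuous_intros) auto
    from continuous_on_compose2[OF cont this] show ?thesis by (simp add: rhs_def[abs_def])
  qed
  define F where "F M = (SOME F. F 0 = 0 \<and> (\<forall>x. (F has_real_derivative rhs M x) (at x)))" for M
  have F: "F M 0 = 0" "(F M has_real_derivative rhs M x) (at x)" for M x
    using someI_ex[OF antiderivative_UNIV[OF crhs[of M]]] unfolding F_def by auto
  have Fb: "\<bar>F M x\<bar> \<le> \<bar>x\<bar>" for M x
    using derivative_domination[of "F M" "rhs M" "\<lambda>s. s" "\<lambda>_. 1" x] F bd by (auto simp: rhs_def)
  define \<Phi> where "\<Phi> M x = exp (- 2 * \<bar>x\<bar>) * (l0 + F M x)" for M x
  have bc: "\<Phi> M \<in> bcontfun" for M
  proof (rule bcontfun_normI)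
    have "isCont (F M) x" for x using F(2) DERIV_isCont by blast
    then have "continuous_on UNIV (F M)" by (simp add: continuous_on_eq_continuous_at)
    then show "continuous_on UNIV (\<Phi> M)" unfolding \<Phi>_def by (intro continuous_intros)
    fix x :: real
    have "\<bar>x\<bar> \<le> exp (2 * \<bar>x\<bar>)" using exp_ge_add_one_self[of "2 * \<bar>x\<bar>"] by linarith
    then have "exp (- 2 * \<bar>x\<bar>) * \<bar>x\<bar> \<le> 1" by (simp add: exp_minus field_simps)
    moreover have "exp (- 2 * \<bar>x\<bar>) * \<bar>l0\<bar> \<le> 1 * \<bar>l0\<bar>" by (intro mult_right_mono) auto
    moreover have "exp (- 2 * \<bar>x\<bar>) * \<bar>l0 + F M x\<bar> \<le> exp (- 2 * \<bar>x\<bar>) * (\<bar>l0\<bar> + \<bar>x\<bar>)"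
      using Fb[of M x] by (intro mult_left_mono) auto
    ultimately show "norm (\<Phi> M x) \<le> \<bar>l0\<bar> + 1"
      unfolding \<Phi>_def real_norm_def abs_mult abs_exp_cancel by (simp only: distrib_left mult_1)
  qed
  have app: "apply_bcontfun (Bcontfun (\<Phi> M)) = \<Phi> M" for M
    by (rule Bcontfun_inverse[OF bc])
  have "\<exists>!M. Bcontfun (\<Phi> M) = M"
  proof (rule banach_fix_type[of "1/2"])
    show "\<forall>M N. dist (Bcontfun (\<Phi> M)) (Bcontfun (\<Phi> N)) \<le> 1 / 2 * dist M N"
    proof (intro allI dist_bound)
      fix M N :: "real \<Rightarrow>\<^sub>C real" and x :: real
      let ?d = "dist M N"
      \<comment> \<open>Integrating the weight exp (2 s) yields the factor 1/2 that becomes the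
        contraction constant.\<close>
      have "\<bar>F M x - F N x\<bar> \<le> ?d / 2 * exp (2 * \<bar>x\<bar>) - ?d / 2 * exp (2 * 0)"
      proof (rule derivative_domination[where f' = "\<lambda>s. rhs M s - rhs N s" and g' = "\<lambda>s. ?d * exp (2 * s)"
            and f = "\<lambda>x. F M x - F N x" and g = "\<lambda>s. ?d / 2 * exp (2 * s)"])
        fix s
        show "((\<lambda>x. F M x - F N x) has_real_derivative rhs M s - rhs N s) (at s)"
          by (intro derivative_intros F)
        show "((\<lambda>s. ?d / 2 * exp (2 * s)) has_real_derivative ?d * exp (2 * s)) (at s)"
          by (auto intro!: derivative_eq_intros)
        have "\<bar>rhs M s - rhs N s\<bar> \<le> \<bar>exp (2 * \<bar>s\<bar>) * apply_bcontfun M s - exp (2 * \<bar>s\<bar>) * apply_bcontfun N s\<bar>"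
          unfolding rhs_def by (rule lip)
        also have "\<dots> = exp (2 * \<bar>s\<bar>) * \<bar>apply_bcontfun M s - apply_bcontfun N s\<bar>"
          by (simp add: right_diff_distrib[symmetric] abs_mult)
        also have "\<dots> \<le> exp (2 * \<bar>s\<bar>) * ?d"
          using dist_bounded[of M s N] by (intro mult_left_mono) (auto simp: dist_real_def)
        finally show "\<bar>rhs M s - rhs N s\<bar> \<le> ?d * exp (2 * \<bar>s\<bar>)" by (simp add: mult.commute)
      qed (simp_all add: F)
      moreover have "0 \<le> ?d / 2 * exp (2 * 0)" by simp
      ultimately have "\<bar>F M x - F N x\<bar> \<le> ?d / 2 * exp (2 * \<bar>x\<bar>)" by linarith
      then have "exp (- 2 * \<bar>x\<bar>) * \<bar>F M x - F N x\<bar> \<le> exp (- 2 * \<bar>x\<bar>) * (?d / 2 * exp (2 * \<bar>x\<bar>))"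
        by (intro mult_left_mono) auto
      also have "\<dots> = 1 / 2 * ?d" by (simp add: exp_minus)
      finally show "dist (apply_bcontfun (Bcontfun (\<Phi> M)) x) (apply_bcontfun (Bcontfun (\<Phi> N)) x) \<le> 1 / 2 * ?d"
        by (simp add: app \<Phi>_def dist_real_def right_diff_distrib[symmetric] abs_mult)
    qed
  qed auto
  then obtain M where M: "Bcontfun (\<Phi> M) = M" by blast
  define L where "L x = l0 + F M x" for x
  have "exp (2 * \<bar>x\<bar>) * apply_bcontfun M x = L x" for x
    using app[of M] unfolding M by (simp add: \<Phi>_def L_def exp_minus)
  then have "(L has_real_derivative G x (L x)) (at x)" for x
    using F(2)[of M x] unfolding L_def rhs_def by (auto intro!: derivative_eq_intros)
  moreover have "L 0 = l0" by (simp add: L_def F)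
  ultimately show ?thesis by blast
qed

text \<open>The planar system in the variables \<open>la = ln y\<^sup>2\<close> and \<open>lb = ln z\<^sup>2\<close>.\<close>

definition logu :: "real \<Rightarrow> real \<Rightarrow> real \<Rightarrow> real" where
  "logu c la lb = c * exp (- la / 2 - 2 * lb)"

text \<open>Logarithmic variables build in the positivity of y and z. With c = sqrt 6 / 6 the
  quantity u is c / (y z^4).\<close>

definition log_system :: "real \<Rightarrow> real \<Rightarrow> real set \<Rightarrow> (real \<Rightarrow> real) \<Rightarrow> (real \<Rightarrow> real) \<Rightarrow> bool" where
  "log_system A c J la lb \<longleftrightarrow> la 0 = 0 \<and> lb 0 = 0 \<and> (\<forall>t\<in>J. let u = logu c (la t) (lb t) in
     (la has_real_derivative u\<^sup>2 + 2 * (u\<^sup>2 + A * u) * exp (lb t - la t)) (at t) \<and>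
     (lb has_real_derivative - (u\<^sup>2) - 2 * A * u) (at t))"

text \<open>With w = exp (q - 5 l / 4) the derivative in l is (5/4) d A w / (A + w)^2, and A w / (A
  + w)^2 is at most 1/4 by the arithmetic-geometric mean inequality.\<close>

lemma rational_lipschitz:
  fixes A q :: real
  assumes "A > 0" and d: "0 \<le> d" "d \<le> 1"
  shows "\<bar>d * A / (A + exp (q - 5 / 4 * l)) - d * A / (A + exp (q - 5 / 4 * m))\<bar> \<le> \<bar>l - m\<bar>"
proof -
  define f where "f l = d * A / (A + exp (q - 5 / 4 * l))" for l
  define f' where "f' l = d * (5 / 4 * (A * exp (q - 5 / 4 * l) / (A + exp (q - 5 / 4 * l))\<^sup>2))" for l
  have pos: "A + exp x > 0" for x using assms by (simp add: add_pos_pos)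
  have "norm (f l - f m) \<le> 1 * norm (l - m)"
  proof (rule field_differentiable_bound[of UNIV f f'])
    fix x
    show "(f has_field_derivative f' x) (at x within UNIV)"
      unfolding f_def f'_def using pos[of "q - 5 / 4 * x"]
      by (auto intro!: derivative_eq_intros simp: power2_eq_square)
    define w where "w = exp (q - 5 / 4 * x)"
    have w: "w > 0" by (simp add: w_def)
    have "A * w / (A + w)\<^sup>2 \<le> 1 / 4"
    proof -
      have "4 * (A * w) \<le> (A + w)\<^sup>2" using sum_squares_bound[of A w] by (simp add: power2_sum)
      then show ?thesis using w assms by (simp add: divide_simps add_pos_pos)
    qed
    moreover have "0 \<le> A * w / (A + w)\<^sup>2" using w assms by simp
    moreover define r where "r = A * w / (A + w)\<^sup>2"
    ultimately have r: "0 \<le> r" "r \<le> 1 / 4" by simp_all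
    then have "d * (5 / 4 * r) \<le> 1 * (5 / 4 * r)" using d by (intro mult_right_mono) auto
    moreover have "0 \<le> d * (5 / 4 * r)" using d r by simp
    moreover have "f' x = d * (5 / 4 * r)" by (simp add: f'_def w_def r_def)
    ultimately show "norm (f' x) \<le> 1" using r by simp
  qed auto
  then show ?thesis by (simp add: f_def)
qed

lemma exp_neg_add: "1 + exp (- x) = (1 + exp x) * exp (- x :: real)"
  by (simp add: distrib_right exp_minus_inverse[symmetric] exp_minus)

lemma ln_exp_shift: "ln (1 + exp x) = x + ln (1 + exp (- x :: real))"
proof -
  have "1 + exp x = exp x * (1 + exp (- x))" by (simp add: distrib_left exp_minus)
  moreover have p: "0 < 1 + exp (- x)" by (simp add: add_pos_pos)
  have "ln (exp x * (1 + exp (- x))) = ln (exp x) + ln (1 + exp (- x))"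
    using less_imp_neq[OF p] unfolding ln_mult by (metis exp_not_eq_zero)
  ultimately show ?thesis by simp
qed

text \<open>The chain rule dl/dt = (dl/dx) x' along an orbit, with e = 1 + exp x and w the value of
  u.\<close>

lemma orbit_slope_cancel:
  fixes A w e :: real
  assumes "A > 0" "w > 0" "e > 0"
  shows "A / ((A + w) * e) * (- 2 * (w\<^sup>2 + A * w) * e) = - 2 * A * w"
proof -
  have "w\<^sup>2 + A * w = (A + w) * w" by (simp add: power2_eq_square algebra_simps)
  moreover have "A + w \<noteq> 0" using assms by linarith
  ultimately show ?thesis using assms by simp
qed

text \<open>With \<open>x = lb - la\<close> as independent variable the orbit equation becomes a scalar equation with globally
  Lipschitz right hand side; the elapsed time is then a bounded function of \<open>x\<close>.\<close>

lemma log_system_solution: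
  fixes A c :: real
  assumes A: "A > 0" and c: "c > 0"
  shows "\<exists>tm tp la lb. tm < 0 \<and> 0 < tp \<and> log_system A c {tm<..<tp} la lb \<and>
    (\<forall>J ka kb. is_interval J \<and> open J \<and> 0 \<in> J \<and> log_system A c J ka kb \<longrightarrow>
        J \<subseteq> {tm<..<tp} \<and> (\<forall>t\<in>J. ka t = la t \<and> kb t = lb t))"
proof -
  \<comment> \<open>Substituting l = 2 lb + ln (1 + exp (- x)) and x = lb - la into
    \<open>logu\<close> gives exp (q x - 5 l / 4). This l has derivative - 2 A u, the u^2 terms
    cancelling against those of x'.\<close>
  define q where "q x = ln c + 5 / 4 * ln (1 + exp (- x)) + x / 2" for x :: real
  define d where "d x = 1 / (1 + exp x)" for x :: real
  define U where "U x l = exp (q x - 5 / 4 * l)" for x l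
  define G where "G x l = d x * A / (A + U x l)" for x l
  have e1: "1 + exp x > 0" for x :: real by (simp add: add_pos_pos)
  have e2: "1 + exp x \<noteq> 0" for x :: real using e1[of x] by simp
  have d01: "0 < d x" "d x \<le> 1" for x using e1[of x] by (auto simp: d_def)
  have U0: "U x l > 0" "A + U x l > 0" "A + U x l \<noteq> 0" for x l
    using A by (auto simp: U_def add_pos_pos add_pos_pos[THEN less_imp_neq, THEN not_sym])
  have contq: "continuous_on UNIV q" unfolding q_def by (intro continuous_intros) (auto simp: e2)
  have "continuous_on UNIV (\<lambda>p. G (fst p) (snd p))"
    unfolding G_def d_def U_def
    by (intro continuous_intros continuous_on_compose2[OF contq]) (use U0 e2 in \<open>auto simp: U_def\<close>)
  moreover have "\<bar>G x l - G x m\<bar> \<le> \<bar>l - m\<bar>" for x l m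
    unfolding G_def U_def using A d01[of x] by (intro rational_lipschitz) auto
  moreover have "\<bar>G x l\<bar> \<le> 1" for x l
  proof -
    have "d x * A \<le> 1 * A" using d01[of x] A by (intro mult_right_mono) auto
    then have "d x * A \<le> A + U x l" using U0(1)[of x l] by linarith
    then show ?thesis using A U0[of x l] d01[of x] by (simp add: G_def abs_mult)
  qed
  \<comment> \<open>The initial point la = lb = 0 has x = 0 and l = ln 2.\<close>
  ultimately obtain L where L0: "L 0 = ln 2" and L: "\<And>x. (L has_real_derivative G x (L x)) (at x)"
    using global_picard[of G "ln 2"] by blast
  have contL: "continuous_on UNIV L" using L by (meson DERIV_isCont continuous_at_imp_continuous_on)
  define u where "u x = U x (L x)" for x
  have u0: "u x > 0" for x by (simp add: u_def U_def)
  have contu: "continuous_on UNIV u" unfolding u_def U_def by (intro continuous_intros contq contL)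
  \<comment> \<open>This is - dt/dx: along solutions x' = - 2 (u^2 + A u) (1 + exp x) is negative,
    so x can serve as a clock running backwards.\<close>
  define \<tau> where "\<tau> x = d x / (2 * ((u x)\<^sup>2 + A * u x))" for x
  have p0: "(u x)\<^sup>2 + A * u x > 0" for x using u0[of x] A by (intro add_pos_pos) auto
  have pnz: "2 * ((u x)\<^sup>2 + A * u x) \<noteq> 0" for x using p0[of x] by (metis less_irrefl mult_eq_0_iff zero_neq_numeral)
  have tau0: "\<tau> x > 0" for x using d01[of x] p0[of x] by (simp add: \<tau>_def)
  have contt: "continuous_on UNIV \<tau>" unfolding \<tau>_def d_def
    by (intro continuous_intros contu) (use e2 pnz in blast)+
  obtain T0 where T00: "T0 0 = 0" and T0: "\<And>x. (T0 has_real_derivative \<tau> x) (at x)"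
    using antiderivative_UNIV[OF contt] by blast
  define T where "T x = - T0 x" for x
  have T: "T 0 = 0" "(T has_real_derivative - \<tau> x) (at x)" for x
    using T00 T0[of x] by (auto simp: T_def[abs_def] intro!: derivative_eq_intros)
  have contT: "isCont T x" for x using T(2) DERIV_isCont by blast
  have decr: "T y < T x" if "x < y" for x y
    by (rule DERIV_neg_imp_decreasing[OF that]) (use T(2) tau0 in \<open>meson neg_less_0_iff_less\<close>)

  \<comment> \<open>The slope G is at most d, the derivative of - ln (1 + exp (- x)), whose total
    increase on the positive half line is ln 2.\<close>
  have Lpos: "L x \<le> 2 * ln 2" if "0 \<le> x" for x
  proof -
    have "L x - ln 2 \<le> (- ln (1 + exp (- x))) - (- ln (1 + exp (- 0)))"
    proof -
      have "L 0 - (- ln (1 + exp (- 0))) \<ge> L x - (- ln (1 + exp (- x)))"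
      proof (rule DERIV_nonpos_imp_nonincreasing[OF that, of "\<lambda>x. L x - (- ln (1 + exp (- x)))"])
        fix s
        have D: "((\<lambda>x. L x - (- ln (1 + exp (- x)))) has_real_derivative G s (L s) - exp (- s) / (1 + exp (- s))) (at s)"
          using e1[of "- s"] by (auto intro!: derivative_eq_intros L)
        have "exp (- s) / (1 + exp (- s)) = d s" unfolding exp_neg_add d_def by simp
        moreover have "G s (L s) \<le> d s"
          unfolding G_def using A U0[of s "L s"] d01[of s] by (simp add: divide_simps)
        ultimately show "\<exists>y. ((\<lambda>x. L x - (- ln (1 + exp (- x)))) has_real_derivative y) (at s) \<and> y \<le> 0"
          using D by force
      qed
      then show ?thesis using L0 by simp
    qed
    then have "L x \<le> 2 * ln 2 - ln (1 + exp (- x))" by simp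
    moreover have "ln (1 + exp (- x)) \<ge> 0" by simp
    ultimately show ?thesis by linarith
  qed
  have Lneg: "L x \<le> ln 2" if "x \<le> 0" for x
  proof -
    have "L x \<le> L 0"
    proof (rule DERIV_nonneg_imp_nondecreasing[OF that])
      fix s
      have "0 \<le> G s (L s)" using U0(2)[of s "L s"] d01(1)[of s] A by (simp add: G_def)
      then show "\<exists>y. (L has_real_derivative y) (at s) \<and> 0 \<le> y" using L by blast
    qed
    then show ?thesis using L0 by simp
  qed
  \<comment> \<open>Dropping A u from the denominator of \<tau> and using L <= 2 ln 2 gives the
    factor exp (5 ln 2) / (2 c^2); what remains decays at least like exp (- |x|) on both
    sides.\<close>
  define B where "B = exp (5 * ln 2) / (2 * c\<^sup>2)"
  have B: "\<tau> x \<le> B * exp (- \<bar>x\<bar>)" for x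
  proof -
    have Lx: "L x \<le> 2 * ln 2"
    proof (cases "0 \<le> x")
      case True then show ?thesis by (rule Lpos)
    next
      case False
      then have "L x \<le> ln 2" by (intro Lneg) simp
      also have "ln 2 \<le> 2 * ln (2::real)" by simp
      finally show ?thesis .
    qed
    have usq: "(u x)\<^sup>2 = c\<^sup>2 * exp (5 / 2 * ln (1 + exp (- x)) + x - 5 / 2 * L x)"
    proof -
      have "u x = c * exp (5 / 4 * ln (1 + exp (- x)) + x / 2 - 5 / 4 * L x)"
        using c by (simp add: u_def U_def q_def exp_add exp_diff)
      then show ?thesis by (simp add: power_mult_distrib exp_double[symmetric] algebra_simps)
    qed
    have dx: "d x = exp (- ln (1 + exp x))" using e1[of x] by (simp add: d_def exp_minus inverse_eq_divide)
    have "\<tau> x \<le> d x / (2 * (u x)\<^sup>2)"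
      unfolding \<tau>_def using d01[of x] u0[of x] A p0[of x] by (intro divide_left_mono) auto
    also have "\<dots> = exp (5 / 2 * L x - x - 5 / 2 * ln (1 + exp (- x)) - ln (1 + exp x)) / (2 * c\<^sup>2)"
    proof -
      have *: "exp (- F) / (2 * (k * exp E)) = exp (- E - F) / (2 * k)" for E F k :: real
        by (simp add: exp_diff exp_minus field_simps)
      show ?thesis unfolding usq dx * by (simp add: algebra_simps)
    qed
    also have "\<dots> \<le> exp (5 * ln 2 - \<bar>x\<bar>) / (2 * c\<^sup>2)"
    proof -
      have "ln (1 + exp x) = x + ln (1 + exp (- x))" by (rule ln_exp_shift)
      moreover have "ln (1 + exp x) \<ge> 0" "ln (1 + exp (- x)) \<ge> 0" by simp_all
      ultimately have "5 / 2 * L x - x - 5 / 2 * ln (1 + exp (- x)) - ln (1 + exp x) \<le> 5 * ln 2 - \<bar>x\<bar>"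
        using Lx by linarith
      then show ?thesis using c by (intro divide_right_mono) auto
    qed
    also have "\<dots> = B * exp (- \<bar>x\<bar>)" by (simp add: B_def exp_diff exp_minus field_simps)
    finally show ?thesis .
  qed
  have Tb: "\<bar>T x\<bar> \<le> B" for x
  proof -
    have B0: "B > 0" using c by (simp add: B_def)
    have "\<bar>T x\<bar> \<le> - B * exp (- \<bar>x\<bar>) - (- B * exp (- 0))"
    proof (rule derivative_domination[where f' = "\<lambda>x. - \<tau> x" and g = "\<lambda>s. - B * exp (- s)" and g' = "\<lambda>s. B * exp (- s)"])
      fix s
      show "\<bar>- \<tau> s\<bar> \<le> B * exp (- \<bar>s\<bar>)" using B[of s] tau0[of s] by simp
      show "((\<lambda>s. - B * exp (- s)) has_real_derivative B * exp (- s)) (at s)"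
        by (auto intro!: derivative_eq_intros)
    qed (use T in auto)
    also have "\<dots> \<le> B" using B0 by simp
    finally show ?thesis .
  qed
  define tm tp where "tm = Inf (range T)" and "tp = Sup (range T)"
  have bdd: "bdd_below (range T)" "bdd_above (range T)"
    using Tb by (auto intro!: bdd_belowI2[of _ "- B"] bdd_aboveI2[of _ _ B] simp: abs_le_iff) (smt (verit) Tb)
  \<comment> \<open>T is continuous, strictly decreasing and bounded, so its range is a bounded open
    interval, the maximal interval of existence.\<close>
  have rng: "range T = {tm<..<tp}"
  proof
    show "range T \<subseteq> {tm<..<tp}"
    proof
      fix t assume "t \<in> range T"
      then obtain x where x: "t = T x" by auto
      have "tm \<le> T (x + 1)" unfolding tm_def using bdd by (intro cInf_lower) auto
      moreover have "T (x - 1) \<le> tp" unfolding tp_def using bdd by (intro cSup_upper) auto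
      ultimately show "t \<in> {tm<..<tp}" using decr[of x "x + 1"] decr[of "x - 1" x] x by simp
    qed
    show "{tm<..<tp} \<subseteq> range T"
    proof
      fix t assume t: "t \<in> {tm<..<tp}"
      obtain x where x: "T x < t" using t bdd cInf_less_iff[of "range T" t] by (auto simp: tm_def)
      obtain y where y: "t < T y" using t bdd less_cSup_iff[of "range T" t] by (auto simp: tp_def)
      have "connected (range T)"
        by (intro connected_continuous_image) (auto simp: continuous_on_eq_continuous_at contT)
      then have "is_interval (range T)" by (simp add: is_interval_connected_1)
      then show "t \<in> range T" by (rule mem_is_interval_1_I[of _ "T x" "T y"]) (use x y in auto)
    qed
  qed
  have inj: "T x = T y \<longleftrightarrow> x = y" for x y using decr[of x y] decr[of y x] by (cases x y rule: linorder_cases) auto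
  define X where "X = inv T"
  have XT: "X (T x) = x" for x unfolding X_def using inj by (intro inv_f_f) (auto simp: inj_def)
  have TX: "T (X t) = t" if "t \<in> {tm<..<tp}" for t unfolding X_def using that by (intro f_inv_into_f) (simp add: rng)
  have X: "(X has_real_derivative - 2 * ((u (X t))\<^sup>2 + A * u (X t)) * (1 + exp (X t))) (at t)" if t: "t \<in> {tm<..<tp}" for t
  proof -
    have "isCont X (T (X t))"
      by (rule isCont_inverse_function[of 1]) (auto simp: XT contT)
    then have cX: "isCont X t" using TX[OF t] by simp
    have "(X has_real_derivative inverse (- \<tau> (X t))) (at t)"
    proof (rule DERIV_inverse_function[where a = tm and b = tp])
      show "(T has_real_derivative - \<tau> (X t)) (at (X t))" by (rule T)
      show "- \<tau> (X t) \<noteq> 0" using tau0[of "X t"] by simp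
    qed (use t TX cX in auto)
    moreover have "inverse (- \<tau> (X t)) = - 2 * ((u (X t))\<^sup>2 + A * u (X t)) * (1 + exp (X t))"
      using p0[of "X t"] e1[of "X t"] by (simp add: \<tau>_def d_def divide_simps) (simp add: algebra_simps)
    ultimately show ?thesis by simp
  qed
  have T0in: "0 \<in> {tm<..<tp}" using T(1) rng by (metis rangeI)
  have X0: "X 0 = 0" using XT[of 0] T(1) by simp
  \<comment> \<open>Inverts the substitution for l, recovering lb from x and l; la is then lb -
    x.\<close>
  define kb where "kb x l = (l - ln (1 + exp (- x))) / 2" for x l :: real
  define lb where "lb t = kb (X t) (L (X t))" for t
  define la where "la t = lb t - X t" for t
  have Ulog: "logu c (kb x l - x) (kb x l) = U x l" for x l
  proof -
    have "logu c (kb x l - x) (kb x l) = exp (ln c) * exp (- (kb x l - x) / 2 - 2 * kb x l)"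
      using c by (simp add: logu_def)
    also have "\<dots> = exp (ln c + (- (kb x l - x) / 2 - 2 * kb x l))" by (rule exp_add[symmetric])
    also have "ln c + (- (kb x l - x) / 2 - 2 * kb x l) = q x - 5 / 4 * l"
      by (simp add: q_def kb_def field_simps)
    finally show ?thesis by (simp add: U_def)
  qed
  have sol: "log_system A c {tm<..<tp} la lb"
    unfolding log_system_def Let_def
  proof (intro conjI ballI)
    show "lb 0 = 0" by (simp add: lb_def kb_def X0 L0)
    then show "la 0 = 0" by (simp add: la_def X0)
    fix t assume t: "t \<in> {tm<..<tp}"
    define x where "x = X t"
    define w where "w = u x"
    have lu: "logu c (la t) (lb t) = w" unfolding la_def lb_def Ulog by (simp add: w_def u_def x_def)
    have w0: "w > 0" by (simp add: w_def u0)
    have dX: "(X has_real_derivative - 2 * (w\<^sup>2 + A * w) * (1 + exp x)) (at t)"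
      using X[OF t] by (simp add: w_def x_def)
    have dL: "((\<lambda>t. L (X t)) has_real_derivative G x (L x) * (- 2 * (w\<^sup>2 + A * w) * (1 + exp x))) (at t)"
      using DERIV_chain2[OF L dX] by (simp add: x_def)
    have "G x (L x) = A / ((A + w) * (1 + exp x))" by (simp add: G_def d_def w_def u_def)
    then have "G x (L x) * (- 2 * (w\<^sup>2 + A * w) * (1 + exp x)) = - 2 * A * w"
      using orbit_slope_cancel[OF A w0 e1[of x]] by simp
    then have dL': "((\<lambda>t. L (X t)) has_real_derivative - 2 * A * w) (at t)" using dL by simp
    have dln: "((\<lambda>t. ln (1 + exp (- X t))) has_real_derivative 2 * (w\<^sup>2 + A * w)) (at t)"
    proof -
      have "((\<lambda>t. ln (1 + exp (- X t))) has_real_derivative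
          (exp (- x) * (2 * (w\<^sup>2 + A * w) * (1 + exp x))) / (1 + exp (- x))) (at t)"
        using e1[of "- X t"] by (auto intro!: derivative_eq_intros dX simp: x_def field_simps)
      moreover have "(exp (- x) * (2 * (w\<^sup>2 + A * w) * (1 + exp x))) / (1 + exp (- x)) = 2 * (w\<^sup>2 + A * w)"
        unfolding exp_neg_add using e1[of x] by simp
      ultimately show ?thesis by simp
    qed
    have dlb: "(lb has_real_derivative - (w\<^sup>2) - 2 * A * w) (at t)"
      unfolding lb_def kb_def by (rule derivative_eq_intros dL' dln refl | simp add: field_simps)+
    then show "(lb has_real_derivative - ((logu c (la t) (lb t))\<^sup>2) - 2 * A * logu c (la t) (lb t)) (at t)"
      by (simp add: lu)
    have "(la has_real_derivative (- (w\<^sup>2) - 2 * A * w) - (- 2 * (w\<^sup>2 + A * w) * (1 + exp x))) (at t)"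
      unfolding la_def by (intro derivative_intros dlb dX)
    moreover have e: "lb t - la t = x" by (simp add: la_def x_def)
    ultimately show "(la has_real_derivative (logu c (la t) (lb t))\<^sup>2 +
        2 * ((logu c (la t) (lb t))\<^sup>2 + A * logu c (la t) (lb t)) * exp (lb t - la t)) (at t)"
      unfolding lu e by (simp add: algebra_simps)
  qed
  \<comment> \<open>A given solution first stays on the orbit l = L(x), by the Lipschitz bound. Then
    T(x(t)) = t fixes the parametrisation, and puts t in the range of T, which is the maximality
    claim.\<close>
  have uniq: "t \<in> {tm<..<tp} \<and> ka t = la t \<and> kb' t = lb t"
    if J: "is_interval J" "open J" "0 \<in> J" "t \<in> J" and s: "log_system A c J ka kb'" for J ka kb' t
  proof -
    define x where "x t = kb' t - ka t" for t
    define l where "l t = 2 * kb' t + ln (1 + exp (- x t))" for t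
    define w where "w t = U (x t) (l t)" for t
    have kk: "kb' t = kb (x t) (l t)" "ka t = kb (x t) (l t) - x t" for t
      by (auto simp: kb_def l_def x_def)
    have wlog: "logu c (ka t) (kb' t) = w t" for t unfolding kk w_def by (rule Ulog)
    have w0: "w t > 0" for t by (simp add: w_def U_def)
    define xd where "xd t = - 2 * ((w t)\<^sup>2 + A * w t) * (1 + exp (x t))" for t
    have dka: "(ka has_real_derivative (w t)\<^sup>2 + 2 * ((w t)\<^sup>2 + A * w t) * exp (x t)) (at t)"
      and dkb: "(kb' has_real_derivative - ((w t)\<^sup>2) - 2 * A * w t) (at t)" if "t \<in> J" for t
      using s that unfolding log_system_def by (auto simp: Let_def wlog x_def)
    have dx: "(x has_real_derivative xd t) (at t)" if "t \<in> J" for t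
      unfolding x_def[abs_def] by (rule derivative_eq_intros dka[OF that] dkb[OF that] refl)+ (simp add: xd_def x_def algebra_simps)
    have ldiff: "(l has_real_derivative - 2 * A * w t) (at t)" if t: "t \<in> J" for t
    proof -
      have "(l has_real_derivative 2 * (- ((w t)\<^sup>2) - 2 * A * w t) + (exp (- x t) * - xd t) / (1 + exp (- x t))) (at t)"
        unfolding l_def[abs_def] using e1[of "- x t"]
        by (auto intro!: derivative_eq_intros dkb[OF t] dx[OF t] simp: field_simps)
      moreover have fr: "(exp (- x t) * - xd t) / (1 + exp (- x t)) = 2 * ((w t)\<^sup>2 + A * w t)"
        unfolding exp_neg_add xd_def using e1[of "x t"] by simp
      have "2 * (- ((w t)\<^sup>2) - 2 * A * w t) + (exp (- x t) * - xd t) / (1 + exp (- x t)) = - 2 * A * w t"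
        unfolding fr by (simp add: algebra_simps)
      ultimately show ?thesis by (simp only:)
    qed
    have Gw: "G (x t) (l t) * xd t = - 2 * A * w t" for t
    proof -
      have "G (x t) (l t) = A / ((A + w t) * (1 + exp (x t)))" by (simp add: G_def d_def w_def)
      then show ?thesis
        using orbit_slope_cancel[OF A w0[of t] e1[of "x t"]] by (simp add: xd_def)
    qed
    have contx: "continuous_on J x" "continuous_on J l"
      using dx ldiff by (meson DERIV_isCont continuous_at_imp_continuous_on)+
    have contw: "continuous_on J w" unfolding w_def U_def
      by (intro continuous_intros continuous_on_compose2[OF contq] contx) auto
    have contxd: "continuous_on J xd" unfolding xd_def by (intro continuous_intros contw contx)
    define E where "E t = (l t - L (x t))\<^sup>2" for t
    have E0: "E t = 0" if t: "t \<in> J" for t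
    proof (rule gronwall_zero[OF J(1,3) t, of E "\<lambda>t. 2 * (l t - L (x t)) * ((G (x t) (l t) - G (x t) (L (x t))) * xd t)"
            "\<lambda>t. 2 * \<bar>xd t\<bar>"])
      fix s assume s: "s \<in> J"
      have "((\<lambda>s. L (x s)) has_real_derivative G (x s) (L (x s)) * xd s) (at s)"
        by (rule DERIV_chain2[OF L dx[OF s]])
      then have "((\<lambda>s. l s - L (x s)) has_real_derivative (G (x s) (l s) - G (x s) (L (x s))) * xd s) (at s)"
        using DERIV_diff[OF ldiff[OF s]] by (simp add: Gw left_diff_distrib)
      then show "(E has_real_derivative 2 * (l s - L (x s)) * ((G (x s) (l s) - G (x s) (L (x s))) * xd s)) (at s)"
        unfolding E_def[abs_def] by (rule DERIV_power[THEN DERIV_cong]) simp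
      have "\<bar>G (x s) (l s) - G (x s) (L (x s))\<bar> \<le> \<bar>l s - L (x s)\<bar>" by fact
      then have "\<bar>l s - L (x s)\<bar> * (\<bar>G (x s) (l s) - G (x s) (L (x s))\<bar> * \<bar>xd s\<bar>) \<le> \<bar>l s - L (x s)\<bar> * (\<bar>l s - L (x s)\<bar> * \<bar>xd s\<bar>)"
        by (intro mult_left_mono mult_right_mono) auto
      also have "\<dots> = \<bar>xd s\<bar> * E s" by (simp add: E_def power2_eq_square abs_mult_self_eq algebra_simps)
      finally show "\<bar>2 * (l s - L (x s)) * ((G (x s) (l s) - G (x s) (L (x s))) * xd s)\<bar> \<le> 2 * \<bar>xd s\<bar> * E s"
        unfolding abs_mult abs_numeral mult.assoc by (intro mult_left_mono) simp_all
      show "0 \<le> E s" by (simp add: E_def)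
    next
      show "E 0 = 0" using s by (simp add: E_def l_def x_def log_system_def L0)
    qed (intro continuous_intros contxd)
    then have lL: "l t = L (x t)" if "t \<in> J" for t using that by (simp add: E_def)
    \<comment> \<open>The derivative of T(x(t)) is - \<tau> x' = 1, so this square has zero
      derivative and the Gronwall lemma applies with coefficient 0.\<close>
    have "(T (x t) - t)\<^sup>2 = 0" if t: "t \<in> J" for t
    proof (rule gronwall_zero[OF J(1,3) t, of "\<lambda>t. (T (x t) - t)\<^sup>2" "\<lambda>_. 0" "\<lambda>_. 0"])
      fix s assume s: "s \<in> J"
      have "- \<tau> (x s) * xd s = 1"
      proof -
        have "w s = u (x s)" by (simp add: w_def u_def lL[OF s])
        then show ?thesis using p0[of "x s"] e1[of "x s"] by (simp add: xd_def \<tau>_def d_def divide_simps)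
      qed
      then have "((\<lambda>t. T (x t)) has_real_derivative 1) (at s)"
        using DERIV_chain2[OF T(2) dx[OF s]] by simp
      then show "((\<lambda>t. (T (x t) - t)\<^sup>2) has_real_derivative 0) (at s)"
        by (auto intro!: derivative_eq_intros)
    next
      show "(T (x 0) - 0)\<^sup>2 = 0" using s T by (simp add: x_def log_system_def)
    qed auto
    then have Tx: "T (x t) = t" using J by simp
    then have tin: "t \<in> {tm<..<tp}" using rng by (metis rangeI)
    have "x t = X t" using XT[of "x t"] Tx by simp
    then have "kb' t = lb t" "ka t = la t" using kk[of t] lL[OF J(4)] by (auto simp: lb_def la_def)
    with tin show ?thesis by blast
  qed
  have U: "J \<subseteq> {tm<..<tp} \<and> (\<forall>t\<in>J. ka t = la t \<and> kb' t = lb t)"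
    if "is_interval J \<and> open J \<and> 0 \<in> J \<and> log_system A c J ka kb'" for J ka kb'
    using uniq[of J _ ka kb'] that by auto
  have "tm < 0" "0 < tp" using T0in by auto
  with sol U show ?thesis
    by - (rule exI[of _ tm], rule exI[of _ tp], rule exI[of _ la], rule exI[of _ lb], blast)
qed

section \<open>Uniqueness and the main theorem\<close>

lemma constant_on_interval:
  fixes f :: "real \<Rightarrow> real"
  assumes "is_interval J" "open J" "t0 \<in> J" "t \<in> J" "\<And>s. s \<in> J \<Longrightarrow> (f has_real_derivative 0) (at s)"
  shows "f t = f t0"
proof -
  have "continuous_on J f" using assms(5) by (meson DERIV_isCont continuous_at_imp_continuous_on)
  then obtain c where "\<And>x. x \<in> J \<Longrightarrow> f x = c"
    using DERIV_zero_connected_constant[of J "{}" f] assms by (auto simp: is_interval_connected_1)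
  then show ?thesis using assms(3,4) by simp
qed

lemma positive_on_interval:
  fixes f :: "real \<Rightarrow> real"
  assumes "is_interval J" "t0 \<in> J" "t \<in> J" "continuous_on J f" "\<And>s. s \<in> J \<Longrightarrow> f s \<noteq> 0" "f t0 > 0"
  shows "f t > 0"
proof (rule ccontr)
  assume "\<not> f t > 0"
  then have "f t \<le> 0" by simp
  have "connected (f ` J)" using assms by (intro connected_continuous_image) (auto simp: is_interval_connected_1)
  then have "is_interval (f ` J)" by (simp add: is_interval_connected_1)
  then have "0 \<in> f ` J"
    by (rule mem_is_interval_1_I[of _ "f t" "f t0"]) (use assms \<open>f t \<le> 0\<close> in auto)
  then show False using assms by auto
qed

lemma wedge_no7:
  assumes "\<And>I. 7 \<in> I \<Longrightarrow> a I = 0" "\<And>I. 7 \<in> I \<Longrightarrow> b I = 0" "7 \<in> K"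
  shows "wedge a b K = 0"
  unfolding wedge_def using assms by (intro sum.neutral) (metis DiffI mult_eq_0_iff)

lemma contr7_psi_yz: "contr (kron 7) (psi_yz y z) = rhoe"
proof (rule homog_eqI[OF _ homog_rhoe])
  show "homog 3 (contr (kron 7) (psi_yz y z))" using homog_psi_yz by (intro homog_contr) simp
  show "list_all (\<lambda>ks. coeff (contr (kron 7) (psi_yz y z)) ks = coeff rhoe ks) (sublists_of_size 3 [1,2,3,4,5,6,7])"
    unfolding sublists_3 by (simp add: coeff_linear coeff_form_of coeff_contr_kron psi_yz_def rhoe_def)
qed

section \<open>Recovering h, the Hermitian matrix and phi from coefficients\<close>

context positive_frame
begin

lemma phi_coeffs:
  "coeff \<phi> [1,2,7] = h * w1" "coeff \<phi> [3,4,7] = - h * w2" "coeff \<phi> [5,6,7] = - h * w3" "coeff \<phi> [1,3,7] = h * p1"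
  "coeff \<phi> [1,4,7] = h * p2" "coeff \<phi> [1,5,7] = h * q1" "coeff \<phi> [1,6,7] = h * q2" "coeff \<phi> [3,5,7] = h * r1" "coeff \<phi> [3,6,7] = h * r2"
proof -
  have "coeff (contr (kron 7) \<phi>) ks = h * coeff W ks" for ks by (simp add: contr7_phi coeff_scale)
  from this[of "[1,2]"] this[of "[3,4]"] this[of "[5,6]"] this[of "[1,3]"] this[of "[1,4]"] this[of "[1,5]"]
    this[of "[1,6]"] this[of "[3,5]"] this[of "[3,6]"]
  show "coeff \<phi> [1,2,7] = h * w1" "coeff \<phi> [3,4,7] = - h * w2" "coeff \<phi> [5,6,7] = - h * w3" "coeff \<phi> [1,3,7] = h * p1"
  "coeff \<phi> [1,4,7] = h * p2" "coeff \<phi> [1,5,7] = h * q1" "coeff \<phi> [1,6,7] = h * q2" "coeff \<phi> [3,5,7] = h * r1" "coeff \<phi> [3,6,7] = h * r2"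
    by (simp_all add: coeff_contr_kron W_coeffs)
qed

text \<open>Since frames are chosen separately at each time, continuity of h must come from a
  formula in the coefficients of phi. The right side is h^3 times the determinant, each coefficient
  of h W carrying one factor h.\<close>

lemma h_polynomial:
  "h = coeff \<phi> [1,2,7] * coeff \<phi> [3,4,7] * coeff \<phi> [5,6,7] + (coeff \<phi> [1,3,7] * coeff \<phi> [1,3,7] + coeff \<phi> [1,4,7] * coeff \<phi> [1,4,7]) * coeff \<phi> [5,6,7]
   + (coeff \<phi> [1,5,7] * coeff \<phi> [1,5,7] + coeff \<phi> [1,6,7] * coeff \<phi> [1,6,7]) * coeff \<phi> [3,4,7]
   - (coeff \<phi> [3,5,7] * coeff \<phi> [3,5,7] + coeff \<phi> [3,6,7] * coeff \<phi> [3,6,7]) * coeff \<phi> [1,2,7]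
   + 2 * (coeff \<phi> [1,3,7] * coeff \<phi> [1,6,7] * coeff \<phi> [3,5,7] - coeff \<phi> [1,4,7] * coeff \<phi> [1,5,7] * coeff \<phi> [3,5,7]
     - coeff \<phi> [1,3,7] * coeff \<phi> [1,5,7] * coeff \<phi> [3,6,7] - coeff \<phi> [1,4,7] * coeff \<phi> [1,6,7] * coeff \<phi> [3,6,7])" (is "h = ?R")
proof -
  have "?R = h * (h\<^sup>2 * pfaffian)" unfolding phi_coeffs pfaffian_def by (simp add: power2_eq_square algebra_simps)
  then show ?thesis by (simp add: pfaffian_h)
qed

text \<open>\<open>\<omega>\<close> is recovered from \<open>\<omega>\<^sup>2 / 2\<close> as the adjugate of the adjugate of a Hermitian matrix.\<close>

lemma off_diagonal:
  assumes z: "P 7 1 = 0" "P 7 2 = 0" "P 7 3 = 0" "P 7 4 = 0" "P 7 5 = 0" "P 7 6 = 0"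
  defines "S \<equiv> coeff (psi_of \<phi>)"
  shows "p1 = h\<^sup>2 * (S [1,2,3,4] * S [1,3,5,6] - S [1,3,4,6] * S [1,2,3,5] + S [1,3,4,5] * S [1,2,3,6])"
    "p2 = h\<^sup>2 * (S [1,2,3,4] * S [1,4,5,6] + S [1,3,4,6] * S [1,2,3,6] + S [1,3,4,5] * S [1,2,3,5])"
    "q1 = h\<^sup>2 * (S [1,2,3,5] * S [1,4,5,6] + S [1,2,3,6] * S [1,3,5,6] + S [1,2,5,6] * S [1,3,4,5])"
    "q2 = h\<^sup>2 * (S [1,2,3,6] * S [1,4,5,6] - S [1,2,3,5] * S [1,3,5,6] + S [1,2,5,6] * S [1,3,4,6])"
    "r1 = h\<^sup>2 * (S [3,4,5,6] * S [1,2,3,5] - S [1,3,4,5] * S [1,4,5,6] + S [1,3,4,6] * S [1,3,5,6])"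
    "r2 = h\<^sup>2 * (S [3,4,5,6] * S [1,2,3,6] - S [1,3,4,6] * S [1,4,5,6] - S [1,3,4,5] * S [1,3,5,6])"
proof -
  note C = psi_coeffs[unfolded z, simplified, folded S_def]
  \<comment> \<open>The adjugate of the adjugate of a 3 by 3 matrix is the determinant times the
    matrix; the determinant is 1 / h^2.\<close>
  have *: "x = h\<^sup>2 * y" if "y = pfaffian * x" for x y
    using pfaffian_h that by (simp add: mult.assoc[symmetric])
  show "p1 = h\<^sup>2 * (S [1,2,3,4] * S [1,3,5,6] - S [1,3,4,6] * S [1,2,3,5] + S [1,3,4,5] * S [1,2,3,6])"
    by (rule *) (simp add: C pfaffian_def algebra_simps)
  show "p2 = h\<^sup>2 * (S [1,2,3,4] * S [1,4,5,6] + S [1,3,4,6] * S [1,2,3,6] + S [1,3,4,5] * S [1,2,3,5])"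
    by (rule *) (simp add: C pfaffian_def algebra_simps)
  show "q1 = h\<^sup>2 * (S [1,2,3,5] * S [1,4,5,6] + S [1,2,3,6] * S [1,3,5,6] + S [1,2,5,6] * S [1,3,4,5])"
    by (rule *) (simp add: C pfaffian_def algebra_simps)
  show "q2 = h\<^sup>2 * (S [1,2,3,6] * S [1,4,5,6] - S [1,2,3,5] * S [1,3,5,6] + S [1,2,5,6] * S [1,3,4,6])"
    by (rule *) (simp add: C pfaffian_def algebra_simps)
  show "r1 = h\<^sup>2 * (S [3,4,5,6] * S [1,2,3,5] - S [1,3,4,5] * S [1,4,5,6] + S [1,3,4,6] * S [1,3,5,6])"
    by (rule *) (simp add: C pfaffian_def algebra_simps)
  show "r2 = h\<^sup>2 * (S [3,4,5,6] * S [1,2,3,6] - S [1,3,4,6] * S [1,4,5,6] - S [1,3,4,5] * S [1,3,5,6])"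
    by (rule *) (simp add: C pfaffian_def algebra_simps)
qed

text \<open>For diagonal W with w3 = w2 the normalisation of the determinant reads h^2 w1 w2^2 = 1
  and fixes the positive h.\<close>

lemma phi_diagonal:
  assumes z: "P 7 1 = 0" "P 7 2 = 0" "P 7 3 = 0" "P 7 4 = 0" "P 7 5 = 0" "P 7 6 = 0"
    and off: "p1 = 0" "p2 = 0" "q1 = 0" "q2 = 0" "r1 = 0" "r2 = 0" and w: "w3 = w2"
  shows "h = 1 / (sqrt w1 * w2)" "\<phi> = phi_yz (sqrt w1) (sqrt w2)"
proof -
  have hh: "h\<^sup>2 * (w1 * w2 * w2) = 1" using pfaffian_h by (simp add: pfaffian_def off w)
  have "h\<^sup>2 = (1 / (sqrt w1 * w2))\<^sup>2"
    using hh w_pos by (simp add: power_divide power_mult_distrib field_simps power2_eq_square)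
  then show h: "h = 1 / (sqrt w1 * w2)" using hpos w_pos by (simp add: power2_eq_iff_nonneg)
  have W': "W = form_of [([1,2],w1),([3,4],-w2),([5,6],-w2)]" (is "_ = form_of ?X")
  proof (rule homog_eqI[OF homog_W])
    show "homog 2 (form_of ?X)" by (rule homog_form_of) simp_all
    show "list_all (\<lambda>ks. coeff W ks = coeff (form_of ?X) ks) (sublists_of_size 2 [1,2,3,4,5,6,7])"
      unfolding sublists_2 W_form_of by (simp add: coeff_form_of off w)
  qed
  have "sqrt w1 * sqrt w1 = w1" "sqrt w1 > 0" using w_pos by simp_all
  then have e: "h * w1 = sqrt w1 / w2" "h * w2 = inverse (sqrt w1)" "1 / h = sqrt w1 * w2"
    unfolding h using w_pos by (simp_all add: field_simps)
  show "\<phi> = phi_yz (sqrt w1) (sqrt w2)"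
  proof (rule homog_eqI[OF _ homog_phi_yz])
    show "homog 3 \<phi>" unfolding phi by (intro homog_pull homog_phi0)
    have q: "(sqrt w2)\<^sup>2 = w2" using w_pos by simp
    show "list_all (\<lambda>ks. coeff \<phi> ks = coeff (phi_yz (sqrt w1) (sqrt w2)) ks) (sublists_of_size 3 [1,2,3,4,5,6,7])"
      unfolding sublists_3 phi_W[OF z] W' phi_yz_form_of q e(3)
      by (simp add: coeff_linear coeff_form_of coeff_lmul_kron rhohat_def e(1,2))
  qed
qed

end

lemma coflow_log_system:
  assumes A: "A > 0" and sol: "coflow_solution A J \<Phi>"
  shows "\<exists>la lb. log_system A (sqrt 6 / 6) J la lb \<and> (\<forall>t\<in>J. \<Phi> t = phi_yz (exp (la t / 2)) (exp (lb t / 2)))"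
proof -
  have J: "is_interval J" "open J" "0 \<in> J" and init: "\<Phi> 0 = phi2"
    and cont: "\<And>I. continuous_on J (\<lambda>t. \<Phi> t I)"
    using sol by (auto simp: coflow_solution_def)
  have "\<forall>t\<in>J. \<exists>P h. special_frame (\<Phi> t) P h"
    using sol special_frame_exists by (auto simp: coflow_solution_def)
  \<comment> \<open>An arbitrary choice at each t, so nothing is known about the regularity of P and
    h at this point.\<close>
  then obtain P h where fr: "\<And>t. t \<in> J \<Longrightarrow> special_frame (\<Phi> t) (P t) (h t)" by metis
  define R where "R t = flow_form A (\<Phi> t) (h t)" for t
  define S where "S ks t = coeff (psi_of (\<Phi> t)) ks" for ks t
  have dpsi: "((\<lambda>s. psi_of (\<Phi> s) I) has_real_derivative R t I) (at t)" if t: "t \<in> J" for t I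
  proof -
    have "dext (psi_of (\<Phi> t)) = fzero" using sol t by (auto simp: coflow_solution_def)
    from coflow_rhs[OF fr[OF t] this, of A] show ?thesis
      using sol t unfolding coflow_solution_def R_def flow_form_def by (metis (no_types, lifting))
  qed
  have dS: "(S ks has_real_derivative coeff (R t) ks) (at t)" if "t \<in> J" for t ks
    using dpsi[OF that] by (simp add: S_def[abs_def] coeff_def)
  have psi_init: "psi_of phi2 = psi_yz 1 1" unfolding phi2_eq_phi_yz by (rule psi_of_yz) simp_all
  have S0: "S ks 0 = coeff (psi_yz 1 1) ks" for ks by (simp add: S_def init psi_init)
  \<comment> \<open>The right-hand side of the flow has no term containing e^7, so those
    coefficients of psi keep their initial values.\<close>
  have rho: "contr (kron 7) (psi_of (\<Phi> t)) = rhoe" if t: "t \<in> J" for t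
  proof -
    have "psi_of (\<Phi> t) I = psi_yz 1 1 I" if I: "7 \<in> I" for I
    proof -
      have c7: "contr (kron 7) b I = 0" if "7 \<in> I" for b I using that by (simp add: contr_kron)
      have om: "omega I = 0" if "7 \<in> I" for I
        using fun_cong[OF contr7_omega, of "I - {7}"] that by (simp add: contr_kron sort_sign_def insert_absorb)
      have "R s I = 0" for s unfolding R_def flow_form_def using I wedge_no7[OF om c7] wedge_no7[OF om om] by simp
      then have "psi_of (\<Phi> t) I = psi_of (\<Phi> 0) I"
        using dpsi by (intro constant_on_interval[OF J t]) metis
      then show ?thesis by (simp add: init psi_init)
    qed
    then have "contr (kron 7) (psi_of (\<Phi> t)) = contr (kron 7) (psi_yz 1 1)"
      by (auto simp: contr_kron fun_eq_iff)
    then show ?thesis by (simp add: contr7_psi_yz)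
  qed
  have fixed: "fixed_rho (\<Phi> t) (P t) (h t)" if "t \<in> J" for t
    using fr rho that by unfold_locales
  have ccf: "continuous_on J (\<lambda>t. coeff (\<Phi> t) ks)" for ks unfolding coeff_def by (rule cont)
  \<comment> \<open>A continuous nowhere vanishing coefficient keeps its initial sign; this selects
    s = 1 for all times.\<close>
  have "coeff (\<Phi> t) [1,2,7] > 0" if t: "t \<in> J" for t
  proof (rule positive_on_interval[OF J(1,3) t ccf])
    show "coeff (\<Phi> s) [1,2,7] \<noteq> 0" if "s \<in> J" for s
      using fixed_rho.phi127_nonzero[OF fixed[OF that]] .
    show "0 < coeff (\<Phi> 0) [1,2,7]" by (simp add: init phi2_eq_phi_yz phi_yz_form_of coeff_form_of)
  qed
  then have pframe: "positive_frame (\<Phi> t) (P t) (h t)" if "t \<in> J" for t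
    using fixed[OF that] that by (simp add: positive_frame_def positive_frame_axioms_def)
  note pfaffian = positive_frame.h_polynomial[OF pframe] positive_frame.phi_coeffs[OF pframe]
  have conth: "continuous_on J h"
    by (subst continuous_on_cong[OF refl pfaffian(1)], assumption) (intro continuous_intros ccf)
  have hpos: "h t > 0" if "t \<in> J" for t using fr[OF that] by (simp add: special_frame_def)
  define k where "k t = 2 * A * (sqrt 6 / 6) * h t" for t
  have contk: "continuous_on J k" unfolding k_def by (intro continuous_intros conth)
  have contS: "continuous_on J (S ks)" for ks
    using dS by (meson DERIV_isCont continuous_at_imp_continuous_on)

  note rc = positive_frame.rhs_coeffs[OF pframe, of _ A, folded k_def R_def]
  \<comment> \<open>The paired coefficients in \<open>no_theta\<close> have equal or opposite
    right-hand sides, so their differences or sums are conserved.\<close>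
  have const: "S a t + r * S b t = S a 0 + r * S b 0"
    if "\<And>s. s \<in> J \<Longrightarrow> coeff (R s) a + r * coeff (R s) b = 0" and t: "t \<in> J" for a b r t
  proof (rule constant_on_interval[OF J t, of "\<lambda>t. S a t + r * S b t"])
    fix s assume s: "s \<in> J"
    have "((\<lambda>t. S a t + r * S b t) has_real_derivative coeff (R s) a + r * coeff (R s) b) (at s)"
      by (intro derivative_intros DERIV_cmult dS s)
    then show "((\<lambda>t. S a t + r * S b t) has_real_derivative 0) (at s)" using that(1)[OF s] by simp
  qed
  have theta: "P t 7 1 = 0" "P t 7 2 = 0" "P t 7 3 = 0" "P t 7 4 = 0" "P t 7 5 = 0" "P t 7 6 = 0"
    if t: "t \<in> J" for t
  proof -
    have "S [1,2,3,5] t + (- 1) * S [1,2,4,6] t = S [1,2,3,5] 0 + (- 1) * S [1,2,4,6] 0"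
      "S [1,2,3,6] t + 1 * S [1,2,4,5] t = S [1,2,3,6] 0 + 1 * S [1,2,4,5] 0"
      "S [1,3,4,5] t + 1 * S [2,3,4,6] t = S [1,3,4,5] 0 + 1 * S [2,3,4,6] 0"
      "S [1,3,4,6] t + (- 1) * S [2,3,4,5] t = S [1,3,4,6] 0 + (- 1) * S [2,3,4,5] 0"
      "S [1,3,5,6] t + 1 * S [2,4,5,6] t = S [1,3,5,6] 0 + 1 * S [2,4,5,6] 0"
      "S [1,4,5,6] t + (- 1) * S [2,3,5,6] t = S [1,4,5,6] 0 + (- 1) * S [2,3,5,6] 0"
      by (rule const[OF _ t], simp add: rc)+
    then have e: "S [1,2,3,5] t = S [1,2,4,6] t" "S [1,2,3,6] t = - S [1,2,4,5] t" "S [1,3,4,5] t = - S [2,3,4,6] t"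
      "S [1,3,4,6] t = S [2,3,4,5] t" "S [1,3,5,6] t = - S [2,4,5,6] t" "S [1,4,5,6] t = S [2,3,5,6] t"
      unfolding S0 by (simp_all add: psi_yz_def coeff_form_of)
    show "P t 7 1 = 0" "P t 7 2 = 0" "P t 7 3 = 0" "P t 7 4 = 0" "P t 7 5 = 0" "P t 7 6 = 0"
      using positive_frame.no_theta[OF pframe[OF t] e[unfolded S_def]] by blast+
  qed
  {
    fix t assume t: "t \<in> J"
    note positive_frame.off_diagonal[OF pframe[OF t] theta[OF t], folded S_def]
  } note od = this

  define ob where "ob i = (if i = (1::nat) then [1,3,5,6] else if i = 2 then [1,4,5,6] else if i = 3 then [1,3,4,5]
      else if i = 4 then [1,3,4,6] else if i = 5 then [1,2,3,5] else [1,2,3,6::nat])" for i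
  \<comment> \<open>Each derivative is, up to k h^2, a quadratic expression in S every term of which
    contains some \<open>S (ob j)\<close>. Taking the other factor as a coefficient makes the system
    linear and homogeneous along the given solution.\<close>
  define M where "M i j t = k t * (h t)\<^sup>2 *
     (if i = (1::nat) then (if j = (1::nat) then S [1,2,3,4] t else if j = 5 then - S [1,3,4,6] t else if j = 6 then S [1,3,4,5] t else 0)
      else if i = 2 then (if j = 2 then S [1,2,3,4] t else if j = 6 then S [1,3,4,6] t else if j = 5 then S [1,3,4,5] t else 0)
      else if i = 3 then (if j = 2 then S [1,2,3,5] t else if j = 1 then S [1,2,3,6] t else if j = 3 then S [1,2,5,6] t else 0)
      else if i = 4 then (if j = 2 then S [1,2,3,6] t else if j = 1 then - S [1,2,3,5] t else if j = 4 then S [1,2,5,6] t else 0)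
      else if i = 5 then (if j = 5 then S [3,4,5,6] t else if j = 2 then - S [1,3,4,5] t else if j = 1 then S [1,3,4,6] t else 0)
      else (if j = 6 then S [3,4,5,6] t else if j = 2 then - S [1,3,4,6] t else if j = 1 then - S [1,3,4,5] t else 0))" for i j t
  have off: "S (ob i) t = 0" if t: "t \<in> J" and i: "i \<in> {1,2,3,4,5,6}" for t i
  proof (rule linear_ode_zero[OF J(1,3) t _ i, of "\<lambda>i. S (ob i)" M])
    have ifc: "continuous_on J (\<lambda>x. if p then f x else g x)"
      if "continuous_on J f" "continuous_on J g" for f g :: "real \<Rightarrow> real" and p
      using that by (cases p) simp_all
    show "continuous_on J (M i j)" for i j
      unfolding M_def by (intro continuous_on_mult contk conth ifc continuous_on_power continuous_on_minus contS continuous_on_const)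
    show "S (ob i) 0 = 0" for i unfolding S0 by (simp add: ob_def psi_yz_def coeff_form_of)
    fix i s assume i: "i \<in> {1,2,3,4,5,6::nat}" and s: "s \<in> J"
    have "coeff (R s) (ob i) = (\<Sum>j\<in>{1,2,3,4,5,6}. M i j s * S (ob j) s)"
      using i by (elim insertE emptyE) (simp_all add: ob_def M_def rc[OF s] od[OF s], simp_all add: algebra_simps)
    then show "(S (ob i) has_real_derivative (\<Sum>j\<in>{1,2,3,4,5,6}. M i j s * S (ob j) s)) (at s)"
      using dS[OF s] by metis
  qed simp
  have off6: "S [1,3,5,6] t = 0" "S [1,4,5,6] t = 0" "S [1,3,4,5] t = 0" "S [1,3,4,6] t = 0" "S [1,2,3,5] t = 0" "S [1,2,3,6] t = 0"
    if t: "t \<in> J" for t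
    using off[OF t, of 1] off[OF t, of 2] off[OF t, of 3] off[OF t, of 4] off[OF t, of 5] off[OF t, of 6]
    by (simp_all add: ob_def)
  {
    fix t assume t: "t \<in> J"
    note od[OF t, unfolded off6[OF t], simplified]
  } note wz = this
  define a where "a t = positive_frame.w1 (P t)" for t
  define b where "b t = positive_frame.w2 (P t)" for t
  define b' where "b' t = positive_frame.w3 (P t)" for t
  have wpos: "a t > 0" "b t > 0" "b' t > 0" if "t \<in> J" for t
    using positive_frame.w_pos[OF pframe[OF that]] by (simp_all add: a_def b_def b'_def)
  note pc = positive_frame.psi_coeffs(1-3)[OF pframe, folded S_def a_def b_def b'_def]
  have diag: "S [1,2,3,4] t = - a t * b t" "S [1,2,5,6] t = - a t * b' t" "S [3,4,5,6] t = b t * b' t" if t: "t \<in> J" for t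
    using pc[OF t] wz[OF t] by simp_all
  note rd = rc(1-3)[folded a_def b_def b'_def]
  have conta: "continuous_on J a"
  proof -
    have "a t = coeff (\<Phi> t) [1,2,7] / h t" if "t \<in> J" for t
      using positive_frame.phi_coeffs(1)[OF pframe[OF that]] hpos[OF that] by (simp add: a_def)
    then show ?thesis
      by (subst continuous_on_cong[OF refl], assumption) (intro continuous_intros ccf conth, use hpos in force)
  qed
  \<comment> \<open>The difference of these two coefficients is a (b' - b) and its derivative is k
    (b' - b): a linear homogeneous equation with coefficient k / a.\<close>
  have bb: "b' t = b t" if t: "t \<in> J" for t
  proof -
    have "S [1,2,3,4] t - S [1,2,5,6] t = 0"
    proof (rule linear_ode_zero[OF J(1,3) t, of "{0::nat}" 0 "\<lambda>_ t. S [1,2,3,4] t - S [1,2,5,6] t" "\<lambda>_ _ t. k t / a t"])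
      fix s assume s: "s \<in> J"
      have "((\<lambda>t. S [1,2,3,4] t - S [1,2,5,6] t) has_real_derivative k s * (b' s - b s)) (at s)"
        using DERIV_diff[OF dS[OF s] dS[OF s], of "[1,2,3,4]" "[1,2,5,6]"] by (simp add: rd[OF s] algebra_simps)
      moreover have "k s * (b' s - b s) = k s / a s * (S [1,2,3,4] s - S [1,2,5,6] s)"
        using wpos[OF s] by (simp add: diag[OF s] field_simps)
      ultimately show "((\<lambda>t. S [1,2,3,4] t - S [1,2,5,6] t) has_real_derivative
          (\<Sum>j\<in>{0::nat}. k s / a s * (S [1,2,3,4] s - S [1,2,5,6] s))) (at s)" by simp
    next
      show "continuous_on J (\<lambda>t. k t / a t)"
        by (intro continuous_intros contk conta) (use wpos in force)
      show "S [1,2,3,4] 0 - S [1,2,5,6] 0 = 0" unfolding S0 by (simp add: psi_yz_def coeff_form_of)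
    qed simp_all
    then show ?thesis using wpos[OF t] by (simp add: diag[OF t])
  qed
  have ph: "h t = 1 / (sqrt (a t) * b t)" "\<Phi> t = phi_yz (sqrt (a t)) (sqrt (b t))" if t: "t \<in> J" for t
    using positive_frame.phi_diagonal[OF pframe[OF t] theta[OF t] wz[OF t], folded a_def b_def b'_def] bb[OF t] by auto

  \<comment> \<open>Defined through psi, whose derivative is known, and not through a and b, which
    depend on the chosen frames: here S_3456 = b^2 and - S_1234 = a b.\<close>
  define lb where "lb t = ln (S [3,4,5,6] t) / 2" for t
  define la where "la t = ln (- S [1,2,3,4] t) - lb t" for t
  have lab: "lb t = ln (b t)" "la t = ln (a t)" if t: "t \<in> J" for t
    using wpos[OF t] by (simp_all add: lb_def la_def diag[OF t] bb[OF t] ln_mult)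
  have "log_system A (sqrt 6 / 6) J la lb"
    unfolding log_system_def Let_def
  proof (intro conjI ballI)
    show "lb 0 = 0" by (simp add: lb_def S0 psi_yz_def coeff_form_of)
    then show "la 0 = 0" by (simp add: la_def S0 psi_yz_def coeff_form_of)
    fix t assume t: "t \<in> J"
    define u where "u = logu (sqrt 6 / 6) (la t) (lb t)"
    have p: "a t > 0" "b t > 0" "h t > 0" using wpos[OF t] hpos[OF t] by simp_all
    \<comment> \<open>Since h = 1 / (sqrt a b), the exponential in \<open>logu\<close> is h / b; the
      two positive quantities are compared through their squares.\<close>
    have "exp (- la t / 2 - 2 * lb t) = h t / b t"
    proof (rule power2_eq_imp_eq)
      have "(exp (- la t / 2 - 2 * lb t))\<^sup>2 = exp (- ln (a t) - 4 * ln (b t))"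
        by (simp add: lab[OF t] exp_double[symmetric] algebra_simps)
      also have "\<dots> = 1 / (a t * b t ^ 4)"
        using p exp_of_nat_mult[of 4 "ln (b t)"] by (simp add: exp_diff exp_minus field_simps)
      also have "\<dots> = (h t / b t)\<^sup>2"
        using p by (simp add: ph(1)[OF t] power_divide power_mult_distrib power2_eq_square power4_eq_xxxx)
      finally show "(exp (- la t / 2 - 2 * lb t))\<^sup>2 = (h t / b t)\<^sup>2" .
    qed (use p in auto)
    then have u: "u = sqrt 6 / 6 * (h t / b t)" by (simp add: u_def logu_def)
    have usq: "u\<^sup>2 = (h t)\<^sup>2 / (6 * (b t)\<^sup>2)"
      by (simp add: u power_mult_distrib power_divide)
    have k: "k t = 2 * A * u * b t" using p by (simp add: k_def u)
    have hu: "(h t)\<^sup>2 / 3 = 2 * u\<^sup>2 * (b t)\<^sup>2" using p by (simp add: usq)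
    have S1: "S [3,4,5,6] t = (b t)\<^sup>2" "S [1,2,3,4] t = - a t * b t"
      using diag[OF t] bb[OF t] by (simp_all add: power2_eq_square)
    have dln: "((\<lambda>t. ln (f t)) has_real_derivative 1 / f t * f') (at t)"
      if "(f has_real_derivative f') (at t)" "f t > 0" for f f'
      using DERIV_chain2[OF DERIV_ln_divide[OF that(2)] that(1)] .
    have "(lb has_real_derivative 1 / S [3,4,5,6] t * coeff (R t) [3,4,5,6] / 2) (at t)"
      unfolding lb_def[abs_def] using p by (intro DERIV_cdivide dln dS[OF t]) (simp add: S1)
    then have "(lb has_real_derivative (- k t * (2 * b t) - (h t)\<^sup>2 / 3) / (b t)\<^sup>2 / 2) (at t)"
      by (simp add: S1 rd[OF t] bb[OF t])
    moreover have "(- k t * (2 * b t) - (h t)\<^sup>2 / 3) / (b t)\<^sup>2 / 2 = - u\<^sup>2 - 2 * A * u"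
      unfolding k hu using p by (simp add: field_simps power2_eq_square)
    ultimately have dlb: "(lb has_real_derivative - u\<^sup>2 - 2 * A * u) (at t)" by simp
    then show "(lb has_real_derivative - ((logu (sqrt 6 / 6) (la t) (lb t))\<^sup>2) - 2 * A * logu (sqrt 6 / 6) (la t) (lb t)) (at t)"
      by (simp add: u_def)
    have "(la has_real_derivative 1 / (- S [1,2,3,4] t) * - coeff (R t) [1,2,3,4] - (- u\<^sup>2 - 2 * A * u)) (at t)"
      unfolding la_def[abs_def] using p
      by (intro DERIV_diff[OF dln[OF DERIV_minus[OF dS[OF t]]] dlb]) (simp add: S1)
    then have "(la has_real_derivative - (k t * (a t - b t) - (h t)\<^sup>2 / 3) / (a t * b t) - (- u\<^sup>2 - 2 * A * u)) (at t)"
      by (simp add: S1 rd[OF t])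
    moreover have "exp (lb t - la t) = b t / a t" using p by (simp add: lab[OF t] exp_diff)
    moreover have "- (k t * (a t - b t) - (h t)\<^sup>2 / 3) / (a t * b t) - (- u\<^sup>2 - 2 * A * u)
        = u\<^sup>2 + 2 * (u\<^sup>2 + A * u) * (b t / a t)"
      unfolding k hu using p by (simp add: field_simps power2_eq_square)
    ultimately have "(la has_real_derivative u\<^sup>2 + 2 * (u\<^sup>2 + A * u) * exp (lb t - la t)) (at t)" by (simp only:)
    then show "(la has_real_derivative (logu (sqrt 6 / 6) (la t) (lb t))\<^sup>2 + 2 * ((logu (sqrt 6 / 6) (la t) (lb t))\<^sup>2
        + A * logu (sqrt 6 / 6) (la t) (lb t)) * exp (lb t - la t)) (at t)"
      by (simp add: u_def)
  qed
  moreover have "\<Phi> t = phi_yz (exp (la t / 2)) (exp (lb t / 2))" if t: "t \<in> J" for t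
  proof -
    have "exp (ln x / 2) = sqrt x" if "x > 0" for x :: real
      using that by (simp add: ln_sqrt[symmetric])
    then show ?thesis using wpos[OF t] ph(2)[OF t] by (simp add: lab[OF t])
  qed
  ultimately show ?thesis by blast
qed

text \<open>The planar system is used in both directions: its maximal solution yields a coflow, and
  every coflow yields a solution of it. Maximality and uniqueness then pass from the planar system
  to curves of arbitrary G2 forms.\<close>

theorem theorem5p4:
  fixes A :: real
  assumes "A > 0"
  shows "\<exists>tm tp :: real. \<exists>y z :: real \<Rightarrow> real.
     tm < 0 \<and> 0 < tp \<and> y 0 = 1 \<and> z 0 = 1 \<and>
     (\<forall>t\<in>{tm<..<tp}.
        (y has_real_derivative
          (2 * A * sqrt 6 * y t * z t ^ 6 + 2 * z t ^ 2 + y t ^ 2) / (12 * y t ^ 3 * z t ^ 8)) (at t) \<and>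
        (z has_real_derivative
          - ((2 * A * sqrt 6 * y t * z t ^ 4 + 1) / (12 * y t ^ 2 * z t ^ 7))) (at t)) \<and>
     coflow_solution A {tm<..<tp} (\<lambda>t. phi_yz (y t) (z t)) \<and>
     (\<forall>J \<Phi>. coflow_solution A J \<Phi> \<longrightarrow>
        J \<subseteq> {tm<..<tp} \<and> (\<forall>t\<in>J. \<Phi> t = phi_yz (y t) (z t)))"
proof -
  obtain tm tp la lb where t: "tm < 0" "0 < tp" and sys: "log_system A (sqrt 6 / 6) {tm<..<tp} la lb"
    and uniq: "\<And>J ka kb. is_interval J \<and> open J \<and> 0 \<in> J \<and> log_system A (sqrt 6 / 6) J ka kb \<Longrightarrow>
        J \<subseteq> {tm<..<tp} \<and> (\<forall>t\<in>J. ka t = la t \<and> kb t = lb t)"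
    using log_system_solution[OF assms, of "sqrt 6 / 6"] by auto
  \<comment> \<open>The exponents are halved because la and lb are the logarithms of y^2 and
    z^2.\<close>
  define y where "y t = exp (la t / 2)" for t
  define z where "z t = exp (lb t / 2)" for t
  have init: "y 0 = 1" "z 0 = 1" using sys by (simp_all add: y_def z_def log_system_def)
  have pos: "y t > 0" "z t > 0" for t by (simp_all add: y_def z_def)
  have deriv: "(y has_real_derivative
          (2 * A * sqrt 6 * y t * z t ^ 6 + 2 * z t ^ 2 + y t ^ 2) / (12 * y t ^ 3 * z t ^ 8)) (at t)"
    "(z has_real_derivative
          - ((2 * A * sqrt 6 * y t * z t ^ 4 + 1) / (12 * y t ^ 2 * z t ^ 7))) (at t)" if t: "t \<in> {tm<..<tp}" for t
  proof -
    define u where "u = logu (sqrt 6 / 6) (la t) (lb t)"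
    have d: "(la has_real_derivative u\<^sup>2 + 2 * (u\<^sup>2 + A * u) * exp (lb t - la t)) (at t)"
      "(lb has_real_derivative - (u\<^sup>2) - 2 * A * u) (at t)"
      using sys t by (auto simp: log_system_def Let_def u_def)
    have q: "z t ^ 2 = z t * z t" "z t ^ 4 = z t * z t * z t * z t" "z t ^ 6 = z t * z t * z t * z t * z t * z t"
      "z t ^ 7 = z t * z t * z t * z t * z t * z t * z t" "z t ^ 8 = z t * z t * z t * z t * z t * z t * z t * z t"
      "y t ^ 2 = y t * y t" "y t ^ 3 = y t * y t * y t"
      by (simp_all add: power_numeral_reduce)
    have "u = sqrt 6 / 6 * (exp (- (la t / 2)) * exp (- 4 * (lb t / 2)))"
      unfolding u_def logu_def exp_add[symmetric] by simp
    also have "exp (- 4 * (lb t / 2)) = 1 / z t ^ 4"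
      using exp_of_nat_mult[of 4 "lb t / 2"] by (simp add: z_def exp_minus inverse_eq_divide)
    finally have u: "u = sqrt 6 / (6 * (y t * (z t * z t * z t * z t)))"
      unfolding q by (simp add: y_def exp_minus field_simps)
    have usq: "u\<^sup>2 = 1 / (6 * (y t * (z t * z t * z t * z t))\<^sup>2)"
      unfolding u by (simp add: power_divide power_mult_distrib)
    have e: "exp (lb t - la t) = (z t * z t) / (y t * y t)"
      unfolding y_def z_def exp_add[symmetric] exp_diff[symmetric] by simp
    have "(y has_real_derivative y t * ((u\<^sup>2 + 2 * (u\<^sup>2 + A * u) * exp (lb t - la t)) / 2)) (at t)"
      unfolding y_def[abs_def] by (intro DERIV_fun_exp DERIV_cdivide d)
    moreover have "y t * ((u\<^sup>2 + 2 * (u\<^sup>2 + A * u) * exp (lb t - la t)) / 2) =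
       (2 * A * sqrt 6 * y t * z t ^ 6 + 2 * z t ^ 2 + y t ^ 2) / (12 * y t ^ 3 * z t ^ 8)"
      unfolding e usq u q power2_eq_square using pos[of t] by (simp add: field_simps)
    ultimately show "(y has_real_derivative
          (2 * A * sqrt 6 * y t * z t ^ 6 + 2 * z t ^ 2 + y t ^ 2) / (12 * y t ^ 3 * z t ^ 8)) (at t)" by (simp only:)
    have "(z has_real_derivative z t * ((- (u\<^sup>2) - 2 * A * u) / 2)) (at t)"
      unfolding z_def[abs_def] by (intro DERIV_fun_exp DERIV_cdivide d)
    moreover have "z t * ((- (u\<^sup>2) - 2 * A * u) / 2) = - ((2 * A * sqrt 6 * y t * z t ^ 4 + 1) / (12 * y t ^ 2 * z t ^ 7))"
      unfolding usq u q power2_eq_square using pos[of t] by (simp add: field_simps)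
    ultimately show "(z has_real_derivative
          - ((2 * A * sqrt 6 * y t * z t ^ 4 + 1) / (12 * y t ^ 2 * z t ^ 7))) (at t)" by (simp only:)
  qed
  have "coflow_solution A {tm<..<tp} (\<lambda>t. phi_yz (y t) (z t))"
    by (rule coflow_yz) (use t init pos deriv in auto)
  moreover have "J \<subseteq> {tm<..<tp} \<and> (\<forall>t\<in>J. \<Phi> t = phi_yz (y t) (z t))" if s: "coflow_solution A J \<Phi>" for J \<Phi>
  proof -
    obtain ka kb where "log_system A (sqrt 6 / 6) J ka kb" "\<forall>t\<in>J. \<Phi> t = phi_yz (exp (ka t / 2)) (exp (kb t / 2))"
      using coflow_log_system[OF assms s] by blast
    moreover have "is_interval J" "open J" "0 \<in> J" using s by (auto simp: coflow_solution_def)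
    ultimately show ?thesis using uniq[of J ka kb] by (simp add: y_def z_def)
  qed
  ultimately show ?thesis
    using t init deriv by (intro exI[of _ tm] exI[of _ tp] exI[of _ y] exI[of _ z]) simp
qed

end
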